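(* Let $p$ be a probability distribution on $\mathbb{Z}$ with finite support, and let $v=\sum_x x\,p(x)$ and $\sigma_1^2=\sum_x (x-v)^2p(x)$. For $x\in\mathbb{Z}$, $k\in\mathbb{N}$, let $X^{x,k}_\cdot$ be independent discrete-time random walks on $\mathbb{Z}$ with $X^{x,k}_0=x$ and step distribution $p$. Let the initial occupation variables $\{\eta_x(0):x\in\mathbb{Z}\}$ be i.i.d. $\mathbb{Z}_+$-valued random variables with finite mean $\mu_0=E[\eta_x(0)]$ and finite variance $\sigma_0^2=\mathrm{Var}[\eta_x(0)]$, independent of the walks. For $n\in\mathbb{N}$ and $(t,r)\in\mathbb{R}_+\times\mathbb{R}$ let $$Y_n(t,r)=\sum_{x\le 0}\sum_{k=1}^{\eta_x(0)}\mathbf{1}\{X^{x,k}_{\lfloor nt\rfloor}>\lfloor ntv\rfloor+r\sqrt n\}-\sum_{x>0}\sum_{k=1}^{\eta_x(0)}\mathbf{1}\{X^{x,k}_{\lfloor nt\rfloor}\le\lfloor ntv\rfloor+r\sqrt n\},$$ $$\overline{Y}_n(t,r)=n^{-1/4}\bigl(Y_n(t,r)-E\,Y_n(t,r)\bigr).$$ Then as $n\to\infty$ the finite-dimensional distributions of $\{\overline{Y}_n(t,r):(t,r)\in\mathbb{R}_+\times\mathbb{R}\}$ converge weakly to the finite-dimensional distributions of the mean zero Gaussian process $\{Z(t,r):(t,r)\in\mathbb{R}_+\times\mathbb{R}\}$ with covariance $$\mathbf{E}[Z(s,q)Z(t,r)]=\mu_0\,\Gamma_1\bigl((s,q),(t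,r)\bigr)+\sigma_0^2\,\Gamma_2\bigl((s,q),(t,r)\bigr).$$
   Context: $\mathbb{Z}_+=\{0,1,2,\dots\}$, $\mathbb{N}=\{1,2,\dots\}$, $\mathbb{R}_+=[0,\infty)$. Let $\varphi_{\nu^2}(x)=\frac1{\sqrt{2\pi\nu^2}}e^{-x^2/(2\nu^2)}$, $\Phi_{\nu^2}(x)=\int_{-\infty}^x\varphi_{\nu^2}(y)\,dy$ and $$\Psi_{\nu^2}(x)=\nu^2\varphi_{\nu^2}(x)-x\bigl(1-\Phi_{\nu^2}(x)\bigr),$$ with $\Psi_0(x)=\max(-x,0)$ (the limit as $\nu\to0$). Define, with $\sigma_1^2$ as in the claim, $$\Gamma_1\bigl((s,q),(t,r)\bigr)=\Psi_{\sigma_1^2(t+s)}(r-q)-\Psi_{\sigma_1^2|t-s|}(r-q),$$ $$\Gamma_2\bigl((s,q),(t,r)\bigr)=\Psi_{\sigma_1^2 s}(-q)+\Psi_{\sigma_1^2 t}(r)-\Psi_{\sigma_1^2(t+s)}(r-q).$$ *)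

theory Defs
  imports "HOL-Probability.Probability"
begin

subsection \<open>The covariance functions\<close>

text \<open>The first argument of \<open>Phi\<close> and \<open>Psi\<close> is the variance \<open>\<nu>\<^sup>2\<close>, whereas
  \<^const>\<open>normal_density\<close> takes the standard deviation.\<close>

definition Phi :: "real \<Rightarrow> real \<Rightarrow> real" where
  "Phi \<nu>2 x = (LINT y:{..x}|lborel. normal_density 0 (sqrt \<nu>2) y)"

definition Psi :: "real \<Rightarrow> real \<Rightarrow> real" where
  "Psi \<nu>2 x =
     (if \<nu>2 = 0 then max (- x) 0
      else \<nu>2 * normal_density 0 (sqrt \<nu>2) x - x * (1 - Phi \<nu>2 x))"

definition Gamma1 :: "real \<Rightarrow> real \<times> real \<Rightarrow> real \<times> real \<Rightarrow> real" where
  "Gamma1 \<sigma>2 = (\<lambda>(s, q) (t, r).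
     Psi (\<sigma>2 * (t + s)) (r - q) - Psi (\<sigma>2 * \<bar>t - s\<bar>) (r - q))"

definition Gamma2 :: "real \<Rightarrow> real \<times> real \<Rightarrow> real \<times> real \<Rightarrow> real" where
  "Gamma2 \<sigma>2 = (\<lambda>(s, q) (t, r).
     Psi (\<sigma>2 * s) (- q) + Psi (\<sigma>2 * t) r - Psi (\<sigma>2 * (t + s)) (r - q))"

subsection \<open>Independence and random walks\<close>

definition iid_vars :: "'a measure \<Rightarrow> 'b measure \<Rightarrow> ('i \<Rightarrow> 'a \<Rightarrow> 'b) \<Rightarrow> 'i set \<Rightarrow> bool" where
  "iid_vars M S X I \<longleftrightarrow>
     prob_space.indep_vars M (\<lambda>_. S) X I \<and>
     (\<forall>i\<in>I. \<forall>j\<in>I. distr M S (X i) = distr M S (X j))"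

text \<open>Independence of two random elements; unlike \<^const>\<open>prob_space.indep_var\<close> it allows
  different value types.\<close>

definition indep_elements ::
  "'a measure \<Rightarrow> 'b measure \<Rightarrow> ('a \<Rightarrow> 'b) \<Rightarrow> 'c measure \<Rightarrow> ('a \<Rightarrow> 'c) \<Rightarrow> bool" where
  "indep_elements M S X T Y \<longleftrightarrow>
     X \<in> measurable M S \<and> Y \<in> measurable M T \<and>
     prob_space.indep_set M
       {X -` A \<inter> space M | A. A \<in> sets S} {Y -` B \<inter> space M | B. B \<in> sets T}"

definition random_walk :: "'a measure \<Rightarrow> int pmf \<Rightarrow> int \<Rightarrow> (nat \<Rightarrow> 'a \<Rightarrow> int) \<Rightarrow> bool" where
  "random_walk M p x W \<longleftrightarrow>
     (\<forall>m. W m \<in> measurable M (count_space UNIV)) \<and>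
     (AE \<omega> in M. W 0 \<omega> = x) \<and>
     prob_space.indep_vars M (\<lambda>_. count_space UNIV) (\<lambda>m \<omega>. W (Suc m) \<omega> - W m \<omega>) UNIV \<and>
     (\<forall>m. distr M (count_space UNIV) (\<lambda>\<omega>. W (Suc m) \<omega> - W m \<omega>) = measure_pmf p)"

abbreviation path_space :: "(nat \<Rightarrow> int) measure" where
  "path_space \<equiv> PiM UNIV (\<lambda>_. count_space UNIV)"

subsection \<open>The current process\<close>

text \<open>For a step distribution with finite support, almost surely only finitely many terms of
  each infinite sum are nonzero; on the remaining null set a divergent \<^const>\<open>infsum\<close> is \<open>0\<close>.\<close>

definition current ::
  "(int \<Rightarrow> 'a \<Rightarrow> nat) \<Rightarrow> (int \<Rightarrow> nat \<Rightarrow> nat \<Rightarrow> 'a \<Rightarrow> int) \<Rightarrow> real \<Rightarrow> nat \<Rightarrow> real \<times> real \<Rightarrow> 'a \<Rightarrow> real"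
  where
  "current \<eta> X v n = (\<lambda>(t, r) \<omega>.
     infsum (\<lambda>x. \<Sum>k=1..\<eta> x \<omega>.
         of_bool (real_of_int (X x k (nat \<lfloor>real n * t\<rfloor>) \<omega>)
                    > real_of_int \<lfloor>real n * t * v\<rfloor> + r * sqrt (real n))) {..0}
   - infsum (\<lambda>x. \<Sum>k=1..\<eta> x \<omega>.
         of_bool (real_of_int (X x k (nat \<lfloor>real n * t\<rfloor>) \<omega>)
                    \<le> real_of_int \<lfloor>real n * t * v\<rfloor> + r * sqrt (real n))) {0<..})"

definition scaled_current ::
  "'a measure \<Rightarrow> (int \<Rightarrow> 'a \<Rightarrow> nat) \<Rightarrow> (int \<Rightarrow> nat \<Rightarrow> nat \<Rightarrow> 'a \<Rightarrow> int) \<Rightarrow> real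
    \<Rightarrow> nat \<Rightarrow> real \<times> real \<Rightarrow> 'a \<Rightarrow> real"
  where
  "scaled_current M \<eta> X v n i \<omega> =
     real n powr (- 1 / 4) * (current \<eta> X v n i \<omega> - (LINT \<omega>'|M. current \<eta> X v n i \<omega>'))"

subsection \<open>Gaussian processes and convergence of finite-dimensional distributions\<close>

text \<open>Point masses count as normal laws, so that degenerate covariances are allowed.\<close>

definition normal_law :: "real measure \<Rightarrow> bool" where
  "normal_law L \<longleftrightarrow>
     (\<exists>m. L = return borel m) \<or>
     (\<exists>m \<sigma>. \<sigma> > 0 \<and> L = density lborel (normal_density m \<sigma>))"

definition gaussian_process :: "'b measure \<Rightarrow> 'i set \<Rightarrow> ('i \<Rightarrow> 'b \<Rightarrow> real) \<Rightarrow> bool" where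
  "gaussian_process N T Z \<longleftrightarrow>
     prob_space N \<and> (\<forall>i\<in>T. Z i \<in> borel_measurable N) \<and>
     (\<forall>J a. finite J \<and> J \<subseteq> T \<longrightarrow> normal_law (distr N borel (\<lambda>\<omega>. \<Sum>i\<in>J. a i * Z i \<omega>)))"

definition weakly_converges :: "'b topology \<Rightarrow> (nat \<Rightarrow> 'b measure) \<Rightarrow> 'b measure \<Rightarrow> bool" where
  "weakly_converges S \<mu> L \<longleftrightarrow>
     (\<forall>f :: 'b \<Rightarrow> real. continuous_map S euclideanreal f \<and> bounded (f ` topspace S) \<longrightarrow>
        (\<lambda>n. LINT x|\<mu> n. f x) \<longlonglongrightarrow> (LINT x|L. f x))"

definition fdd :: "'b measure \<Rightarrow> 'i set \<Rightarrow> ('i \<Rightarrow> 'b \<Rightarrow> real) \<Rightarrow> ('i \<Rightarrow> real) measure" where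
  "fdd M J Y = distr M (PiM J (\<lambda>_. borel)) (\<lambda>\<omega>. \<lambda>i\<in>J. Y i \<omega>)"

definition fdd_converges ::
  "'i set \<Rightarrow> 'a measure \<Rightarrow> (nat \<Rightarrow> 'i \<Rightarrow> 'a \<Rightarrow> real) \<Rightarrow> 'b measure \<Rightarrow> ('i \<Rightarrow> 'b \<Rightarrow> real) \<Rightarrow> bool"
  where
  "fdd_converges T M Y N Z \<longleftrightarrow>
     (\<forall>J. finite J \<and> J \<subseteq> T \<longrightarrow>
        weakly_converges (product_topology (\<lambda>_. euclideanreal) J)
          (\<lambda>n. fdd M J (Y n)) (fdd N J Z))"

end

theory Submission
  imports Defs "HOL-Real_Asymp.Real_Asymp"
begin

text \<open>Fix finitely many space-time points \<open>j = (t, r)\<close> and real weights \<open>a j\<close>. Everything rests on the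
characteristic function of the combination \<open>\<Sum>j. a j * scaled_current j\<close>, whose limit is
\<open>exp (- V / 2)\<close>, where \<open>V\<close> is the quadratic form of the claimed covariance in the weights \<open>a\<close>.

\<^emph>\<open>Factorisation over starting sites.\<close> A particle that starts at \<open>x\<close> contributes
\<open>of_bool (x \<le> 0) - of_bool (x \<le> c)\<close> to the current, where the excess \<open>c\<close> is the (integer) observation
level minus the displacement of the particle; call the weighted sum of these contributions over \<open>j\<close> the
score \<open>g\<close> of the particle. Jumps are bounded, so that only finitely many sites matter, and after
conditioning on the occupation variables the characteristic function becomes a product over the sites of
\<open>pgf (E (exp (\<i> * \<theta> * g)))\<close> with \<open>\<theta> = n powr (-1/4)\<close> (\<open>scaled_current_char\<close>). A second-order expansion
of the generating function \<open>pgf\<close>, for which two moments of the occupation variable suffice, shows that a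
site behaves like a Gaussian with variance
\<open>\<mu>0 * Var g + \<sigma>0_sq * (E g)\<^sup>2\<close>, the error being \<open>o (\<theta>\<^sup>2)\<close> times the probability that \<open>g \<noteq> 0\<close>
(\<open>site_estimate\<close>). These probabilities add up to \<open>O (sqrt n)\<close>, hence the errors vanish
(\<open>triangular_product_limit\<close>).

\<^emph>\<open>Exact spatial sums.\<close> What remains are sums over \<open>x\<close> of second moments of the contributions. They
are computed before any limit is taken: for integers \<open>c\<close> and \<open>d\<close> the products of the contributions add
up to \<open>max 0 c + max 0 (- d) - max 0 (c - d)\<close> (\<open>sum_crossing_product\<close>). So the variance of the current is a
combination of expected positive parts of walks and of differences of walks, and the central limit theorem
together with a second-moment bound turns each of them into a value of \<open>Psi\<close>, which is the expected positive
part of a shifted Gaussian. Differences within one walk have variance \<open>\<sigma>1_sq * \<bar>t - s\<bar>\<close>, differences of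
independent walks have variance \<open>\<sigma>1_sq * (t + s)\<close>; this is the origin of \<open>Gamma1\<close> and \<open>Gamma2\<close>
(\<open>crossing_limits\<close>).

\<^emph>\<open>The limit process and weak convergence.\<close> The limits of characteristic functions are bounded by 1 in
modulus, so that \<open>V \<ge> 0\<close> for all weights, and the covariance is positive semidefinite. A triangular
factorisation gives the finite-dimensional Gaussian laws, and Kolmogorov extension gives the process
(\<open>gaussian_process_exists\<close>). Convergence of the characteristic functions of all linear combinations implies
weak convergence in finite dimension (\<open>cramer_wold_weak_convergence\<close>).\<close>

section \<open>Weak convergence and characteristic functions in finite dimension\<close>

text \<open>Continuity makes \<open>f\<close> the pointwise limit of its values at the dyadic roundings of
the argument, and these depend on a discrete random element.\<close>

lemma product_continuous_map_borel_measurable: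
  fixes f :: "('i \<Rightarrow> real) \<Rightarrow> real"
  assumes J: "finite J" and f: "continuous_map (product_topology (\<lambda>_. euclideanreal) J) euclideanreal f"
  shows "f \<in> borel_measurable (PiM J (\<lambda>_. borel))"
proof -
  define d :: "nat \<Rightarrow> ('i \<Rightarrow> int) \<Rightarrow> ('i \<Rightarrow> real)" where
    "d n z = (\<lambda>i\<in>J. real_of_int (z i) / 2 ^ n)" for n z
  have conv: "(\<lambda>n. real_of_int \<lfloor>x * 2 ^ n\<rfloor> / 2 ^ n) \<longlonglongrightarrow> x" for x :: real
  proof (rule tendsto_sandwich[where f="\<lambda>n. x - (1/2)^n" and h="\<lambda>_. x"])
    show "\<forall>\<^sub>F n in sequentially. x - (1/2)^n \<le> real_of_int \<lfloor>x * 2 ^ n\<rfloor> / 2 ^ n"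
    proof (intro always_eventually allI)
      fix n
      have "x * 2 ^ n - 1 \<le> real_of_int \<lfloor>x * 2 ^ n\<rfloor>" by linarith
      then have "(x * 2 ^ n - 1) / 2 ^ n \<le> real_of_int \<lfloor>x * 2 ^ n\<rfloor> / 2 ^ n"
        by (rule divide_right_mono) simp
      then show "x - (1/2)^n \<le> real_of_int \<lfloor>x * 2 ^ n\<rfloor> / 2 ^ n"
        by (simp add: diff_divide_distrib power_one_over)
    qed
    show "\<forall>\<^sub>F n in sequentially. real_of_int \<lfloor>x * 2 ^ n\<rfloor> / 2 ^ n \<le> x"
      by (intro always_eventually allI) (simp add: field_simps)
    show "(\<lambda>n. x - (1/2)^n) \<longlonglongrightarrow> x"
      by (rule tendsto_eq_intros LIMSEQ_realpow_zero | simp)+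
  qed simp
  show ?thesis
  proof (rule borel_measurable_LIMSEQ_real)
    fix x :: "'i \<Rightarrow> real" assume x: "x \<in> space (PiM J (\<lambda>_. borel))"
    have "limitin (product_topology (\<lambda>_. euclideanreal) J) (\<lambda>n. d n (\<lambda>i\<in>J. \<lfloor>x i * (2::real) ^ n\<rfloor>)) x sequentially"
      unfolding limitin_componentwise using x conv
      by (auto simp: space_PiM d_def PiE_def)
    then have "limitin euclideanreal (f \<circ> (\<lambda>n. d n (\<lambda>i\<in>J. \<lfloor>x i * (2::real) ^ n\<rfloor>))) (f x) sequentially"
      by (rule continuous_map_limit[OF f])
    then show "(\<lambda>n. f (d n (\<lambda>i\<in>J. \<lfloor>x i * (2::real) ^ n\<rfloor>))) \<longlonglongrightarrow> f x"
      by (simp add: o_def)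
  next
    fix n
    have "(\<lambda>x. \<lambda>i\<in>J. \<lfloor>x i * (2::real) ^ n\<rfloor>) \<in> measurable (PiM J (\<lambda>_. borel)) (PiM J (\<lambda>_. count_space (UNIV::int set)))"
      by measurable
    also have "PiM J (\<lambda>_. count_space (UNIV::int set)) = count_space (PiE J (\<lambda>_. UNIV))"
      using J by (intro count_space_PiM_finite) auto
    finally have 1: "(\<lambda>x. \<lambda>i\<in>J. \<lfloor>x i * (2::real) ^ n\<rfloor>) \<in> measurable (PiM J (\<lambda>_. borel)) (count_space (PiE J (\<lambda>_. UNIV::int set)))" .
    show "(\<lambda>x. f (d n (\<lambda>i\<in>J. \<lfloor>x i * (2::real) ^ n\<rfloor>))) \<in> borel_measurable (PiM J (\<lambda>_. borel))"
      by (rule measurable_compose[OF 1]) auto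
  qed
qed

text \<open>By Levy's theorem the laws converge weakly, and a continuous function that cuts off small arguments
transfers a tail bound from the limit to the sequence.\<close>

lemma char_convergence_imp_tight:
  fixes \<mu> :: "nat \<Rightarrow> real measure"
  assumes \<mu>: "\<And>n. real_distribution (\<mu> n)" and L: "real_distribution L"
    and ch: "\<And>t. (\<lambda>n. char (\<mu> n) t) \<longlonglongrightarrow> char L t" and "e > 0"
  obtains R where "R > 0" "measure L {x. \<bar>x\<bar> > R} < e" "\<forall>\<^sub>F n in sequentially. measure (\<mu> n) {x. \<bar>x\<bar> > R} < e"
proof -
  interpret L: real_distribution L by fact
  interpret \<mu>: real_distribution "\<mu> n" for n by fact
  have wc: "weak_conv_m \<mu> L" by (rule levy_continuity[OF \<mu> L ch])
  define g :: "real \<Rightarrow> real \<Rightarrow> real" where "g R x = min 1 (max 0 (\<bar>x\<bar> - R))" for R x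
  have cont: "isCont (g R) x" for R x unfolding g_def by (intro continuous_intros)
  have g01: "0 \<le> g R x" "g R x \<le> 1" for R x by (auto simp: g_def)
  have [measurable]: "g R \<in> borel_measurable borel" for R unfolding g_def by measurable
  have "(\<lambda>n. LINT x|L. g (real n) x) \<longlonglongrightarrow> (LINT x|L. 0)"
  proof (rule integral_dominated_convergence[where w="\<lambda>_. 1"])
    show "AE x in L. (\<lambda>n. g (real n) x) \<longlonglongrightarrow> 0"
    proof (rule AE_I2)
      fix x
      obtain N where "real N \<ge> \<bar>x\<bar>" using real_arch_simple by blast
      then have "\<forall>n\<ge>N. g (real n) x = 0" by (auto simp: g_def)
      then show "(\<lambda>n. g (real n) x) \<longlonglongrightarrow> 0"
        by (intro tendsto_eventually) (auto simp: eventually_sequentially)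
    qed
  qed (use g01 in auto)
  then have "\<forall>\<^sub>F n in sequentially. (LINT x|L. g (real n) x) < e"
    using \<open>e > 0\<close> by (intro order_tendstoD) auto
  then obtain N where N: "(LINT x|L. g (real N) x) < e"
    by (auto simp: eventually_sequentially)
  have "(\<lambda>n. LINT x|\<mu> n. g (real N) x) \<longlonglongrightarrow> (LINT x|L. g (real N) x)"
    by (rule weak_conv_imp_integral_bdd_continuous_conv[OF \<mu> L wc, where B=1]) (use cont g01 in auto)
  then have ev: "\<forall>\<^sub>F n in sequentially. (LINT x|\<mu> n. g (real N) x) < e"
    using N by (intro order_tendstoD) auto
  have bd: "measure P {x. \<bar>x\<bar> > real (N + 1)} \<le> (LINT x|P. g (real N) x)" if "real_distribution P" for P
  proof -
    interpret P: real_distribution P by fact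
    have "measure P {x. \<bar>x\<bar> > real (N + 1)} = (LINT x|P. indicator {x. \<bar>x\<bar> > real (N + 1)} x)"
      by simp
    also have "\<dots> \<le> (LINT x|P. g (real N) x)"
      by (intro integral_mono P.integrable_const_bound[where B=1])
         (auto simp: g_def indicator_def)
    finally show ?thesis .
  qed
  show ?thesis
  proof (rule that[of "real (N + 1)"])
    show "measure L {x. \<bar>x\<bar> > real (N + 1)} < e" using bd[OF L] N by linarith
    show "\<forall>\<^sub>F n in sequentially. measure (\<mu> n) {x. \<bar>x\<bar> > real (N + 1)} < e"
      using ev by eventually_elim (use bd[OF \<mu>] in \<open>auto intro: le_less_trans\<close>)
  qed simp
qed

lemma iexp_of_real_add: "iexp (x + y) = iexp x * iexp y"
  by (simp add: distrib_left exp_add)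

lemma sin_as_iexp: "complex_of_real (sin c) = (iexp c - iexp (- c)) / (2 * \<i>)"
  unfolding sin_of_real[symmetric] sin_exp_eq by simp

text \<open>Call a bounded function \<open>g\<close> admissible if the integrals of \<open>g\<close> times any character converge. The constant 1
is admissible by assumption, and multiplication by \<open>sin (c * x i)\<close> preserves admissibility because it only
shifts the frequency of the character. Therefore all polynomials in these sines have convergent integrals,
and Stone-Weierstrass on the cube extends this to all continuous functions of them. The sines are indexed by
natural numbers, so that the cube lies in a metrisable function space.\<close>

lemma sin_substitution_convergence:
  fixes \<mu> :: "nat \<Rightarrow> ('i \<Rightarrow> real) measure" and L :: "('i \<Rightarrow> real) measure" and F :: "(nat \<Rightarrow> real) \<Rightarrow> real"
  assumes J: "finite J"
    and \<mu>: "\<And>n. prob_space (\<mu> n)" and sets_\<mu>: "\<And>n. sets (\<mu> n) = sets (PiM J (\<lambda>_. borel))"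
    and L: "prob_space L" and sets_L: "sets L = sets (PiM J (\<lambda>_. borel))"
    and ch: "\<And>a. (\<lambda>n. LINT x|\<mu> n. iexp (\<Sum>i\<in>J. a i * x i)) \<longlonglongrightarrow> (LINT x|L. iexp (\<Sum>i\<in>J. a i * x i))"
    and b: "b \<in> {..<d::nat} \<rightarrow> J"
    and contF: "continuous_on (PiE {..<d} (\<lambda>_. {-1..1})) F"
    and Fm: "(\<lambda>x. F (\<lambda>k\<in>{..<d}. sin (c * x (b k)))) \<in> borel_measurable (PiM J (\<lambda>_. borel))"
  shows "(\<lambda>n. LINT x|\<mu> n. F (\<lambda>k\<in>{..<d}. sin (c * x (b k)))) \<longlonglongrightarrow> (LINT x|L. F (\<lambda>k\<in>{..<d}. sin (c * x (b k))))"
proof -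
  let ?P = "PiM J (\<lambda>_. borel :: real measure)"
  interpret L: prob_space L by fact
  interpret \<mu>: prob_space "\<mu> n" for n by fact
  note [measurable_cong] = sets_\<mu> sets_L
  note [measurable] = Fm
  define u :: "('i \<Rightarrow> real) \<Rightarrow> (nat \<Rightarrow> real)" where "u x = (\<lambda>k\<in>{..<d}. sin (c * x (b k)))" for x
  define S :: "(nat \<Rightarrow> real) set" where "S = PiE {..<d} (\<lambda>_. {-1..1})"
  have uS: "u x \<in> S" for x by (auto simp: u_def S_def)
  have compS: "compact S"
  proof -
    have S_eq: "S = PiE UNIV (\<lambda>i. if i < d then {-1..1} else {undefined})"
      by (auto simp: S_def PiE_def Pi_def extensional_def split: if_splits)
    have "compactin (product_topology (\<lambda>_::nat. euclideanreal) UNIV) S"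
      unfolding S_eq compactin_PiE by auto
    then show ?thesis by (simp add: euclidean_product_topology)
  qed
  define E where "E a x = iexp (\<Sum>i\<in>J. a i * x i)" for a x :: "'i \<Rightarrow> real"
  have nE[simp]: "norm (E a x) = 1" for a x by (simp add: E_def)
  have Em[measurable]: "E a \<in> borel_measurable ?P" for a unfolding E_def by measurable
  have E0: "E (\<lambda>_. 0) x = 1" for x by (simp add: E_def)
  note chE = ch[folded E_def]
  define W :: "(('i \<Rightarrow> real) \<Rightarrow> complex) set" where
    "W = {g. g \<in> borel_measurable ?P \<and> (\<exists>C. \<forall>x. norm (g x) \<le> C) \<and>
       (\<forall>a. (\<lambda>n. LINT x|\<mu> n. g x * E a x) \<longlonglongrightarrow> (LINT x|L. g x * E a x))}"
  have WI: "g \<in> W" if "\<And>x. norm (g x) \<le> C" "g \<in> borel_measurable ?P"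
      "\<And>a. (\<lambda>n. LINT x|\<mu> n. g x * E a x) \<longlonglongrightarrow> (LINT x|L. g x * E a x)" for g C
    using that unfolding W_def by blast
  have Wm: "g \<in> borel_measurable ?P" if "g \<in> W" for g using that by (auto simp: W_def)
  have Wl: "(\<lambda>n. LINT x|\<mu> n. g x * E a x) \<longlonglongrightarrow> (LINT x|L. g x * E a x)"
    if "g \<in> W" for g a using that by (auto simp: W_def)
  have Wb: "\<exists>C. \<forall>x. norm (g x) \<le> C" if "g \<in> W" for g using that by (auto simp: W_def)
  have int: "integrable P (\<lambda>x. g x * E a x)"
    if gW: "g \<in> W" and P: "prob_space P" "sets P = sets ?P" for g a P
  proof -
    interpret P: prob_space P by fact
    obtain C where C: "\<And>x. norm (g x) \<le> C" using Wb[OF gW] by blast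
    note [measurable_cong] = P(2)
    have [measurable]: "g \<in> borel_measurable ?P" using Wm[OF gW] .
    show ?thesis by (rule P.integrable_const_bound[where B=C]) (use C in \<open>auto simp: norm_mult\<close>)
  qed
  note int' = int[OF _ \<mu> sets_\<mu>] int[OF _ L sets_L]
  have W1: "(\<lambda>_. 1) \<in> W"
    using chE by (auto simp: W_def intro!: exI[of _ 1])
  have Wadd: "(\<lambda>x. g x + h x) \<in> W" if gW: "g \<in> W" "h \<in> W" for g h
  proof -
    obtain C where C: "\<And>x. norm (g x) \<le> C" using Wb[OF gW(1)] by blast
    obtain D where D: "\<And>x. norm (h x) \<le> D" using Wb[OF gW(2)] by blast
    have "norm (g x + h x) \<le> C + D" for x using norm_triangle_mono[OF C D] .
    moreover have "(\<lambda>n. LINT x|\<mu> n. (g x + h x) * E a x) \<longlonglongrightarrow> (LINT x|L. (g x + h x) * E a x)" for a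
      using tendsto_add[OF Wl[OF gW(1)] Wl[OF gW(2)], of a a]
      by (simp add: distrib_right Bochner_Integration.integral_add[OF int'(1)[OF gW(1)] int'(1)[OF gW(2)]]
          Bochner_Integration.integral_add[OF int'(2)[OF gW(1)] int'(2)[OF gW(2)]])
    ultimately show ?thesis using borel_measurable_add[OF Wm[OF gW(1)] Wm[OF gW(2)]] by (intro WI)
  qed
  have Wscale: "(\<lambda>x. complex_of_real r * g x) \<in> W" if gW: "g \<in> W" for g r
  proof -
    obtain C where C: "\<And>x. norm (g x) \<le> C" using Wb[OF gW] by blast
    have "norm (complex_of_real r * g x) \<le> \<bar>r\<bar> * C" for x by (simp add: norm_mult mult_left_mono C)
    moreover have "(\<lambda>n. LINT x|\<mu> n. complex_of_real r * g x * E a x) \<longlonglongrightarrow> (LINT x|L. complex_of_real r * g x * E a x)" for a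
      using tendsto_mult[OF tendsto_const Wl[OF gW], of "complex_of_real r" a] by (simp add: mult.assoc)
    ultimately show ?thesis using borel_measurable_times[OF borel_measurable_const Wm[OF gW]] by (intro WI)
  qed
  have Wsin: "(\<lambda>x. complex_of_real (sin (c * x i)) * g x) \<in> W" if gW: "g \<in> W" and i: "i \<in> J" for g i
  proof -
    obtain C where C: "\<And>x. norm (g x) \<le> C" using Wb[OF gW] by blast
    have "norm (complex_of_real (sin (c * x i)) * g x) \<le> 1 * C" for x
      unfolding norm_mult by (intro mult_mono C) auto
    moreover have "(\<lambda>x. complex_of_real (sin (c * x i)) * g x) \<in> borel_measurable ?P"
      using i Wm[OF gW(1)] by measurable
    moreover have "(\<lambda>n. LINT x|\<mu> n. complex_of_real (sin (c * x i)) * g x * E a x) \<longlonglongrightarrow>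
        (LINT x|L. complex_of_real (sin (c * x i)) * g x * E a x)" for a
    proof -
      define a1 where "a1 = a(i := a i + c)"
      define a2 where "a2 = a(i := a i - c)"
      have s: "(\<Sum>j\<in>J. (a(i := a i + d)) j * x j) = (\<Sum>j\<in>J. a j * x j) + d * x i" for d x
        using i J by (simp add: sum.remove[of J i] algebra_simps)
      have e1: "(\<Sum>j\<in>J. a1 j * x j) = (\<Sum>j\<in>J. a j * x j) + c * x i" for x
        unfolding a1_def by (rule s)
      have e2: "(\<Sum>j\<in>J. a2 j * x j) = (\<Sum>j\<in>J. a j * x j) + (- (c * x i))" for x
        unfolding a2_def using s[of "-c" x] by simp
      have eq: "complex_of_real (sin (c * x i)) * g x * E a x =
         (g x * E a1 x - g x * E a2 x) / (2 * \<i>)" for x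
        unfolding E_def e1 e2 iexp_of_real_add sin_as_iexp by (simp add: field_simps)
      show ?thesis unfolding eq
        using tendsto_divide[OF tendsto_diff[OF Wl[OF gW(1), of a1] Wl[OF gW(1), of a2]] tendsto_const[of "2*\<i>"]]
        by (simp add: Bochner_Integration.integral_diff[OF int'(1)[OF gW(1)] int'(1)[OF gW(1)]]
          Bochner_Integration.integral_diff[OF int'(2)[OF gW(1)] int'(2)[OF gW(1)]])
    qed
    ultimately show ?thesis by (intro WI)
  qed
  define R where "R = {h. continuous_on S h \<and> (\<forall>g\<in>W. (\<lambda>x. complex_of_real (h (u x)) * g x) \<in> W)}"
  have R2: "(\<lambda>x. complex_of_real (h (u x)) * g x) \<in> W" if "h \<in> R" "g \<in> W" for h g
    using that unfolding R_def by blast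
  interpret function_ring_on R S
  proof
    show "compact S" by fact
    show "(\<lambda>z. f z * g z) \<in> R" if "f \<in> R" "g \<in> R" for f g
    proof -
      have "(\<lambda>x. complex_of_real (f (u x)) * (complex_of_real (g (u x)) * h x)) \<in> W" if "h \<in> W" for h
        by (rule R2[OF \<open>f \<in> R\<close> R2[OF \<open>g \<in> R\<close> that]])
      then show ?thesis using that by (auto simp: R_def mult.assoc intro: continuous_on_mult)
    qed
    show "(\<lambda>z. f z + g z) \<in> R" if "f \<in> R" "g \<in> R" for f g
    proof -
      have "(\<lambda>x. complex_of_real (f (u x)) * h x + complex_of_real (g (u x)) * h x) \<in> W" if "h \<in> W" for h
        by (intro Wadd R2 that \<open>f \<in> R\<close> \<open>g \<in> R\<close>)
      then show ?thesis using that by (auto simp: R_def distrib_right intro: continuous_on_add)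
    qed
    show "(\<lambda>_. r) \<in> R" for r by (auto simp: R_def intro: Wscale)
    show "\<exists>f\<in>R. f x \<noteq> f y" if "x \<in> S" "y \<in> S" "x \<noteq> y" for x y
    proof -
      have "\<exists>i\<in>{..<d}. x i \<noteq> y i"
      proof (rule ccontr)
        assume "\<not> ?thesis"
        then have "x = y" using \<open>x \<in> S\<close> \<open>y \<in> S\<close> unfolding S_def by (intro PiE_ext) auto
        with \<open>x \<noteq> y\<close> show False by simp
      qed
      then obtain i where i: "i \<in> {..<d}" "x i \<noteq> y i" by blast
      have "continuous_on S (\<lambda>z. z i)"
        by (rule continuous_on_subset[OF continuous_on_product_coordinates]) simp
      moreover have "(\<lambda>x. complex_of_real (u x i) * g x) \<in> W" if "g \<in> W" for g
        using Wsin[OF that funcset_mem[OF b i(1)]] i(1) by (simp add: u_def)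
      ultimately have "(\<lambda>z. z i) \<in> R" unfolding R_def by blast
      with i(2) show ?thesis by (intro bexI[of _ "\<lambda>z. z i"])
    qed
  qed (auto simp: R_def)
  have lim_R: "(\<lambda>n. LINT x|\<mu> n. h (u x)) \<longlonglongrightarrow> (LINT x|L. h (u x))" and m_R: "(\<lambda>x. h (u x)) \<in> borel_measurable ?P" if "h \<in> R" for h
  proof -
    have w: "(\<lambda>x. complex_of_real (h (u x)) * 1) \<in> W" by (rule R2[OF that W1])
    have "(\<lambda>x. Re (complex_of_real (h (u x)) * 1)) \<in> borel_measurable ?P"
      by (rule measurable_compose[OF Wm[OF w]]) simp
    then show "(\<lambda>x. h (u x)) \<in> borel_measurable ?P" by simp
    show "(\<lambda>n. LINT x|\<mu> n. h (u x)) \<longlonglongrightarrow> (LINT x|L. h (u x))"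
      using Wl[OF w, of "\<lambda>_. 0"] by (simp add: E0 tendsto_of_real_iff)
  qed
  have "(\<lambda>n. LINT x|\<mu> n. F (u x)) \<longlonglongrightarrow> (LINT x|L. F (u x))"
  proof (rule LIMSEQ_I)
    fix e :: real assume "e > 0"
    obtain h where h: "h \<in> R" "\<And>z. z \<in> S \<Longrightarrow> \<bar>F z - h z\<bar> < e / 3"
      using Stone_Weierstrass_basic[of F "e / 3"] contF \<open>e > 0\<close> unfolding S_def[symmetric] by auto
    have close: "\<bar>(LINT x|P. F (u x)) - (LINT x|P. h (u x))\<bar> \<le> e / 3" if P: "prob_space P" "sets P = sets ?P" for P
    proof -
      interpret P: prob_space P by fact
      note [measurable_cong] = P(2)
      have [measurable]: "(\<lambda>x. F (u x)) \<in> borel_measurable ?P" "(\<lambda>x. h (u x)) \<in> borel_measurable ?P"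
        using Fm m_R[OF h(1)] by (auto simp: u_def[abs_def])
      have bdd: "\<exists>B. \<forall>z\<in>S. norm (k z) \<le> B" if "continuous_on S k" for k :: "_ \<Rightarrow> real"
        using compact_imp_bounded[OF compact_continuous_image[OF that compS]] by (auto simp: bounded_iff)
      obtain B1 where B1: "\<And>z. z \<in> S \<Longrightarrow> norm (F z) \<le> B1" using bdd contF unfolding S_def[symmetric] by blast
      obtain B2 where B2: "\<And>z. z \<in> S \<Longrightarrow> norm (h z) \<le> B2" using bdd h(1) unfolding R_def by blast
      have i1: "integrable P (\<lambda>x. F (u x))" by (rule P.integrable_const_bound[where B=B1]) (use B1 uS in auto)
      have i2: "integrable P (\<lambda>x. h (u x))" by (rule P.integrable_const_bound[where B=B2]) (use B2 uS in auto)
      have "\<bar>(LINT x|P. F (u x)) - (LINT x|P. h (u x))\<bar> = \<bar>LINT x|P. F (u x) - h (u x)\<bar>"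
        using i1 i2 by simp
      also have "\<dots> \<le> (LINT x|P. \<bar>F (u x) - h (u x)\<bar>)" by (rule integral_abs_bound)
      also have "\<dots> \<le> (LINT x|P. e / 3)"
        by (intro integral_mono) (use i1 i2 h(2) uS in \<open>auto intro!: less_imp_le\<close>)
      finally show ?thesis by (simp add: P.prob_space)
    qed
    from LIMSEQ_D[OF lim_R[OF h(1)], of "e / 3"] \<open>e > 0\<close>
    obtain no where no: "\<And>n. n \<ge> no \<Longrightarrow> \<bar>(LINT x|\<mu> n. h (u x)) - (LINT x|L. h (u x))\<bar> < e / 3" by auto
    have "norm ((LINT x|\<mu> n. F (u x)) - (LINT x|L. F (u x))) < e" if "n \<ge> no" for n
      using no[OF that] close[OF \<mu> sets_\<mu>, of n] close[OF L sets_L] unfolding real_norm_def by linarith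
    then show "\<exists>no. \<forall>n\<ge>no. norm ((LINT x|\<mu> n. F (u x)) - (LINT x|L. F (u x))) < e" by blast
  qed
  then show ?thesis by (simp add: u_def)
qed

text \<open>On a large box a bounded continuous function \<open>f\<close> agrees with a continuous function of the sines
\<open>sin (c * x i)\<close>, namely with \<open>f\<close> evaluated at \<open>arcsin (sin (c * x i)) / c\<close>, and this substitute obeys the
same bound as \<open>f\<close> everywhere. The box carries almost all mass by tightness of the marginals, and the
integrals of the substitute converge by the previous lemma.\<close>

theorem cramer_wold_weak_convergence:
  fixes \<mu> :: "nat \<Rightarrow> ('i \<Rightarrow> real) measure" and L :: "('i \<Rightarrow> real) measure"
  assumes J: "finite J"
    and \<mu>: "\<And>n. prob_space (\<mu> n)" and sets_\<mu>: "\<And>n. sets (\<mu> n) = sets (PiM J (\<lambda>_. borel))"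
    and L: "prob_space L" and sets_L: "sets L = sets (PiM J (\<lambda>_. borel))"
    and ch: "\<And>a. (\<lambda>n. LINT x|\<mu> n. iexp (\<Sum>i\<in>J. a i * x i)) \<longlonglongrightarrow> (LINT x|L. iexp (\<Sum>i\<in>J. a i * x i))"
  shows "weakly_converges (product_topology (\<lambda>_. euclideanreal) J) \<mu> L"
  unfolding weakly_converges_def
proof (intro allI impI, elim conjE)
  fix f :: "('i \<Rightarrow> real) \<Rightarrow> real"
  assume f: "continuous_map (product_topology (\<lambda>_. euclideanreal) J) euclideanreal f"
    and bf: "bounded (f ` topspace (product_topology (\<lambda>_. euclideanreal) J))"
  let ?P = "PiM J (\<lambda>_. borel :: real measure)"
  interpret L: prob_space L by fact
  interpret \<mu>: prob_space "\<mu> n" for n by fact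
  note [measurable_cong] = sets_\<mu> sets_L
  have sp: "space (\<mu> n) = PiE J (\<lambda>_. UNIV)" "space L = PiE J (\<lambda>_. UNIV)" for n
    using sets_eq_imp_space_eq[OF sets_\<mu>] sets_eq_imp_space_eq[OF sets_L] by (auto simp: space_PiM)
  have fm[measurable]: "f \<in> borel_measurable ?P"
    by (rule product_continuous_map_borel_measurable[OF J f])
  obtain B where B: "B > 0" "\<And>x. x \<in> PiE J (\<lambda>_. UNIV) \<Longrightarrow> \<bar>f x\<bar> \<le> B"
    using bf unfolding bounded_pos by (auto simp: topspace_product_topology)
  show "(\<lambda>n. LINT x|\<mu> n. f x) \<longlonglongrightarrow> (LINT x|L. f x)"
  proof (rule LIMSEQ_I)
    fix e :: real assume "e > 0"
    \<comment> \<open>Outside of the box the error is at most \<open>2 * B\<close>; integrated it has to stay below \<open>e / 4\<close>.\<close>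
    define e1 where "e1 = e / (8 * B * (real (card J) + 1))"
    have "e1 > 0" using \<open>e > 0\<close> B by (simp add: e1_def)
    have "\<forall>i\<in>J. \<exists>R. R > 0 \<and> measure L {x\<in>space L. \<bar>x i\<bar> > R} < e1 \<and>
             (\<forall>\<^sub>F n in sequentially. measure (\<mu> n) {x\<in>space (\<mu> n). \<bar>x i\<bar> > R} < e1)"
    proof
      fix i assume i: "i \<in> J"
      have [measurable]: "(\<lambda>x. x i) \<in> borel_measurable ?P" using i by measurable
      have rd: "real_distribution (distr P borel (\<lambda>x. x i))" if "prob_space P" "sets P = sets ?P" for P
        using that by (intro prob_space.real_distribution_distr) (auto cong: measurable_cong_sets)
      have c: "char (distr P borel (\<lambda>x. x i)) t = (LINT x|P. iexp (\<Sum>j\<in>J. (if j = i then t else 0) * x j))"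
        if "prob_space P" "sets P = sets ?P" for P t
      proof -
        have [measurable]: "(\<lambda>x. x i) \<in> borel_measurable P" using that by (simp cong: measurable_cong_sets)
        have "(\<Sum>j\<in>J. (if j = i then t else 0) * x j) = t * x i" for x :: "'i \<Rightarrow> real"
          using i J by (simp add: if_distrib[where f="\<lambda>u. u * _"] sum.delta cong: if_cong)
        then show ?thesis unfolding char_def by (subst integral_distr) auto
      qed
      obtain R where R: "R > 0" "measure (distr L borel (\<lambda>x. x i)) {x. \<bar>x\<bar> > R} < e1"
        "\<forall>\<^sub>F n in sequentially. measure (distr (\<mu> n) borel (\<lambda>x. x i)) {x. \<bar>x\<bar> > R} < e1"
      proof (rule char_convergence_imp_tight)
        show "real_distribution (distr (\<mu> n) borel (\<lambda>x. x i))" for n by (rule rd[OF \<mu> sets_\<mu>])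
        show "real_distribution (distr L borel (\<lambda>x. x i))" by (rule rd[OF L sets_L])
        show "(\<lambda>n. char (distr (\<mu> n) borel (\<lambda>x. x i)) t) \<longlonglongrightarrow> char (distr L borel (\<lambda>x. x i)) t" for t
          unfolding c[OF \<mu> sets_\<mu>] c[OF L sets_L] by (rule ch)
        show "e1 > 0" by fact
      qed
      have m: "measure (distr P borel (\<lambda>x. x i)) {x. \<bar>x\<bar> > R} = measure P {x\<in>space P. \<bar>x i\<bar> > R}"
        if "sets P = sets ?P" for P
      proof -
        have [measurable]: "(\<lambda>x. x i) \<in> borel_measurable P" using that by (simp cong: measurable_cong_sets)
        show ?thesis by (subst measure_distr) (auto intro!: arg_cong[where f="measure P"])
      qed
      show "\<exists>R. R > 0 \<and> measure L {x\<in>space L. \<bar>x i\<bar> > R} < e1 \<and>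
             (\<forall>\<^sub>F n in sequentially. measure (\<mu> n) {x\<in>space (\<mu> n). \<bar>x i\<bar> > R} < e1)"
        using R unfolding m[OF sets_\<mu>] m[OF sets_L] by blast
    qed
    from bchoice[OF this] obtain R where R: "\<And>i. i \<in> J \<Longrightarrow> R i > 0" "\<And>i. i \<in> J \<Longrightarrow> measure L {x\<in>space L. \<bar>x i\<bar> > R i} < e1"
      "\<And>i. i \<in> J \<Longrightarrow> \<forall>\<^sub>F n in sequentially. measure (\<mu> n) {x\<in>space (\<mu> n). \<bar>x i\<bar> > R i} < e1"
      by blast
    define K where "K = 1 + (\<Sum>i\<in>J. R i)"
    have RK: "R i \<le> K" if "i \<in> J" for i
      using member_le_sum[OF that, of R] R(1) J by (auto simp: K_def less_imp_le)
    have "K > 0" using R(1) by (simp add: K_def sum_nonneg add_pos_nonneg less_imp_le)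

    have box: "measure P {x\<in>space P. \<exists>i\<in>J. \<bar>x i\<bar> > K} \<le> real (card J) * e1"
      if P: "prob_space P" "sets P = sets ?P" and "\<And>i. i \<in> J \<Longrightarrow> measure P {x\<in>space P. \<bar>x i\<bar> > R i} < e1" for P
    proof -
      interpret P: prob_space P by fact
      have [measurable]: "(\<lambda>x. x i) \<in> borel_measurable P" if "i \<in> J" for i
        using that P(2) by (simp cong: measurable_cong_sets)
      have [measurable]: "i \<in> J \<Longrightarrow> {x\<in>space P. \<bar>x i\<bar> > r} \<in> sets P" for i r by measurable
      have "measure P {x\<in>space P. \<exists>i\<in>J. \<bar>x i\<bar> > K} \<le> measure P (\<Union>i\<in>J. {x\<in>space P. \<bar>x i\<bar> > R i})"
        using RK J by (intro P.finite_measure_mono) (auto intro: le_less_trans)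
      also have "\<dots> \<le> (\<Sum>i\<in>J. measure P {x\<in>space P. \<bar>x i\<bar> > R i})"
        using J by (intro P.finite_measure_subadditive_finite) auto
      also have "\<dots> \<le> (\<Sum>i\<in>J. e1)" by (intro sum_mono) (use that(3) in \<open>auto intro: less_imp_le\<close>)
      finally show ?thesis by simp
    qed
    have evb: "\<forall>\<^sub>F n in sequentially. \<forall>i\<in>J. measure (\<mu> n) {x\<in>space (\<mu> n). \<bar>x i\<bar> > R i} < e1"
      using J R(3) by (simp add: eventually_ball_finite)

    \<comment> \<open>With this frequency the box is mapped into \<open>[- pi / 2, pi / 2]\<close>, where \<open>arcsin\<close> inverts \<open>sin\<close>.\<close>
    define c where "c = pi / (2 * K)"
    have "c > 0" using \<open>K > 0\<close> by (simp add: c_def)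
    define d where "d = card J"
    obtain b where bij: "bij_betw b {..<d} J"
      using ex_bij_betw_nat_finite[OF J] by (auto simp: d_def atLeast0LessThan)
    define b' where "b' = inv_into {..<d} b"
    have b: "b \<in> {..<d} \<rightarrow> J" using bij by (auto simp: bij_betw_def)
    have b': "b' i < d" "b (b' i) = i" if "i \<in> J" for i
      using that bij inv_into_into[of i b "{..<d}"] f_inv_into_f[of i b "{..<d}"] by (auto simp: b'_def bij_betw_def)
    define u :: "('i \<Rightarrow> real) \<Rightarrow> (nat \<Rightarrow> real)" where "u x = (\<lambda>k\<in>{..<d}. sin (c * x (b k)))" for x
    define F :: "(nat \<Rightarrow> real) \<Rightarrow> real" where "F z = f (\<lambda>i\<in>J. arcsin (z (b' i)) / c)" for z
    define S :: "(nat \<Rightarrow> real) set" where "S = PiE {..<d} (\<lambda>_. {-1..1})"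
    have uS: "u x \<in> S" for x by (auto simp: u_def S_def)
    have Fu: "F (u x) = f x" if "x \<in> PiE J (\<lambda>_. UNIV)" "\<And>i. i \<in> J \<Longrightarrow> \<bar>x i\<bar> \<le> K" for x
    proof -
      have "arcsin (sin (c * x i)) / c = x i" if "i \<in> J" for i
      proof -
        have "\<bar>c * x i\<bar> \<le> c * K" using \<open>c > 0\<close> that \<open>\<And>i. i \<in> J \<Longrightarrow> \<bar>x i\<bar> \<le> K\<close> by (simp add: abs_mult)
        also have "c * K = pi / 2" using \<open>K > 0\<close> by (simp add: c_def)
        finally have "\<bar>c * x i\<bar> \<le> pi / 2" .
        then have "arcsin (sin (c * x i)) = c * x i" by (intro arcsin_sin) auto
        then show ?thesis using \<open>c > 0\<close> by simp
      qed
      then have "(\<lambda>i\<in>J. arcsin (u x (b' i)) / c) = x"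
        using that(1) by (auto simp: u_def b' PiE_def extensional_def fun_eq_iff)
      then show ?thesis by (simp add: F_def)
    qed
    have Fb: "\<bar>F z\<bar> \<le> B" for z unfolding F_def by (rule B(2)) auto
    have contF: "continuous_on S F"
    proof -
      have "continuous_map (top_of_set S) (product_topology (\<lambda>_. euclideanreal) J) (\<lambda>z. \<lambda>i\<in>J. arcsin (z (b' i)) / c)"
        unfolding continuous_map_componentwise
      proof (intro conjI ballI)
        fix k assume k: "k \<in> J"
        have ck: "continuous_on S (\<lambda>z. z (b' k))" by (rule continuous_on_subset[OF continuous_on_product_coordinates]) auto
        have "continuous_on S (\<lambda>z. arcsin (z (b' k)) / c)"
          by (intro continuous_intros ck) (use b'[OF k] \<open>c > 0\<close> in \<open>auto simp: S_def PiE_def Pi_def\<close>)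
        then show "continuous_map (top_of_set S) euclideanreal (\<lambda>z. (\<lambda>i\<in>J. arcsin (z (b' i)) / c) k)"
          using k by simp
      qed auto
      from continuous_map_compose[OF this f] have "continuous_map (top_of_set S) euclideanreal F"
        by (simp add: o_def F_def[abs_def])
      then show ?thesis by simp
    qed
    have umeas[measurable]: "(\<lambda>x. F (u x)) \<in> borel_measurable ?P"
    proof -
      have "(\<lambda>x. \<lambda>i\<in>J. arcsin (u x (b' i)) / c) \<in> measurable ?P ?P"
      proof (rule measurable_restrict)
        fix i assume "i \<in> J"
        have *: "(\<lambda>x. arcsin (max (-1) (min 1 (sin (c * x i)))) / c) \<in> borel_measurable ?P"
        proof (rule measurable_compose[where f="\<lambda>x. c * x i" and g="\<lambda>y. arcsin (max (-1) (min 1 (sin y))) / c" and N=borel])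
          show "(\<lambda>x. c * x i) \<in> borel_measurable ?P" using \<open>i \<in> J\<close> by measurable
          show "(\<lambda>y. arcsin (max (-1) (min 1 (sin y))) / c) \<in> borel_measurable borel"
            by (intro borel_measurable_continuous_onI continuous_intros) (use \<open>c > 0\<close> in auto)
        qed
        show "(\<lambda>x. arcsin (u x (b' i)) / c) \<in> borel_measurable ?P"
          using * \<open>i \<in> J\<close> by (simp add: u_def b')
      qed
      from measurable_compose[OF this fm] show ?thesis by (simp add: F_def)
    qed
    have lim: "(\<lambda>n. LINT x|\<mu> n. F (u x)) \<longlonglongrightarrow> (LINT x|L. F (u x))"
      using sin_substitution_convergence[OF J \<mu> sets_\<mu> L sets_L ch b contF[unfolded S_def], of c] umeas
      unfolding u_def by blast
    have close: "\<bar>(LINT x|P. f x) - (LINT x|P. F (u x))\<bar> \<le> e / 4"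
      if P: "prob_space P" "sets P = sets ?P" and out: "measure P {x\<in>space P. \<exists>i\<in>J. \<bar>x i\<bar> > K} \<le> real (card J) * e1" for P
    proof -
      interpret P: prob_space P by fact
      note [measurable_cong] = P(2)
      have spP: "space P = PiE J (\<lambda>_. UNIV)" using sets_eq_imp_space_eq[OF P(2)] by (auto simp: space_PiM)
      have [measurable]: "(\<lambda>x. x i) \<in> borel_measurable P" if "i \<in> J" for i
        using that by measurable
      let ?B = "{x\<in>space P. \<exists>i\<in>J. \<bar>x i\<bar> > K}"
      have [measurable]: "?B \<in> sets P" using countable_finite[OF J] by measurable
      have i1: "integrable P f" by (rule P.integrable_const_bound[where B=B]) (use B in \<open>auto simp: spP\<close>)
      have i2: "integrable P (\<lambda>x. F (u x))" by (rule P.integrable_const_bound[where B=B]) (use Fb in auto)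
      have "\<bar>(LINT x|P. f x) - (LINT x|P. F (u x))\<bar> = \<bar>LINT x|P. f x - F (u x)\<bar>"
        using i1 i2 by simp
      also have "\<dots> \<le> (LINT x|P. \<bar>f x - F (u x)\<bar>)" by (rule integral_abs_bound)
      also have "\<dots> \<le> (LINT x|P. 2 * B * indicator ?B x)"
      proof (intro integral_mono)
        fix x assume x: "x \<in> space P"
        show "\<bar>f x - F (u x)\<bar> \<le> 2 * B * indicator ?B x"
        proof (cases "x \<in> ?B")
          case True
          then show ?thesis using B(2)[of x] Fb[of "u x"] x by (simp add: spP)
        next
          case False
          then have "F (u x) = f x" using x by (intro Fu) (auto simp: spP not_less)
          then show ?thesis using B(1) by simp
        qed
      qed (use i1 i2 in \<open>auto intro!: P.integrable_const_bound[where B=1] simp: indicator_def\<close>)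
      also have "\<dots> = 2 * B * measure P ?B" by simp
      also have "\<dots> \<le> 2 * B * (real (card J) * e1)" using out B(1) by (intro mult_left_mono) auto
      also have "\<dots> \<le> 2 * B * ((real (card J) + 1) * e1)"
        using \<open>e1 > 0\<close> B(1) by (intro mult_left_mono mult_right_mono) auto
      also have "(real (card J) + 1) * e1 = e / (8 * B)"
        unfolding e1_def using B(1) by (simp add: add_nonneg_eq_0_iff)
      also have "2 * B * (e / (8 * B)) = e / 4" using B(1) by simp
      finally show ?thesis .
    qed
    from tendstoD[OF lim, of "e / 4"] \<open>e > 0\<close>
    have "\<forall>\<^sub>F n in sequentially. dist (LINT x|\<mu> n. F (u x)) (LINT x|L. F (u x)) < e / 4" by simp
    with evb have "\<forall>\<^sub>F n in sequentially. norm ((LINT x|\<mu> n. f x) - (LINT x|L. f x)) < e"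
    proof eventually_elim
      case (elim n)
      have "\<bar>(LINT x|\<mu> n. f x) - (LINT x|\<mu> n. F (u x))\<bar> \<le> e / 4"
        by (intro close \<mu> sets_\<mu> box) (use elim in auto)
      moreover have "\<bar>(LINT x|L. f x) - (LINT x|L. F (u x))\<bar> \<le> e / 4"
        by (intro close L sets_L box) (use R in auto)
      ultimately show ?case using elim(2) \<open>e > 0\<close> unfolding dist_real_def real_norm_def by linarith
    qed
    then show "\<exists>no. \<forall>n\<ge>no. norm ((LINT x|\<mu> n. f x) - (LINT x|L. f x)) < e"
      by (simp add: eventually_sequentially)
  qed
qed

lemma PiM_borel_eq_sigma_boxes:
  assumes J: "finite J"
  shows "sets (PiM J (\<lambda>_. borel :: real measure)) =
    sigma_sets (PiE J (\<lambda>_. UNIV)) (range (\<lambda>a. PiE J (\<lambda>i. {..a i})))" (is "?L = sigma_sets ?\<Omega> ?E")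
proof (rule antisym)
  have E: "?E \<subseteq> Pow ?\<Omega>" by (auto simp: PiE_def)
  have Es: "PiE J (\<lambda>i. {..a i}) \<in> sets (sigma ?\<Omega> ?E)" for a
    by (rule in_measure_of[OF E rangeI])
  have "(\<lambda>x. x) \<in> measurable (sigma ?\<Omega> ?E) (PiM J (\<lambda>_. borel))"
  proof (rule measurable_PiM_single')
    fix i assume i: "i \<in> J"
    show "(\<lambda>x. x i) \<in> borel_measurable (sigma ?\<Omega> ?E)"
      unfolding borel_measurable_iff_le
    proof
      fix c
      have "{x \<in> ?\<Omega>. x i \<le> c} = (\<Union>n::nat. PiE J (\<lambda>j. {..if j = i then c else real n}))" (is "?A = ?B")
      proof (rule antisym; rule subsetI)
        fix x assume x: "x \<in> ?A"
        obtain n where n: "(\<Sum>j\<in>J. \<bar>x j\<bar>) \<le> real n" using real_arch_simple by blast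
        have "x j \<le> real n" if "j \<in> J" for j
          using member_le_sum[OF that, of "\<lambda>j. \<bar>x j\<bar>"] J n by auto
        then show "x \<in> ?B" using x by (auto simp: PiE_def Pi_def intro!: exI[of _ n])
      next
        fix x assume "x \<in> ?B"
        then obtain n where n: "x \<in> PiE J (\<lambda>j. {..if j = i then c else real n})" by blast
        have "x i \<in> {..if i = i then c else real n}" using n i by (rule PiE_mem)
        moreover have "x \<in> ?\<Omega>" using n by (auto simp: PiE_def)
        ultimately show "x \<in> ?A" by simp
      qed
      moreover have "?B \<in> sets (sigma ?\<Omega> ?E)"
        by (intro sets.countable_UN image_subsetI Es)
      ultimately show "{w \<in> space (sigma ?\<Omega> ?E). w i \<le> c} \<in> sets (sigma ?\<Omega> ?E)"
        by (simp only: space_measure_of[OF E])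
    qed
  next
    show "(\<lambda>x. x) \<in> space (sigma ?\<Omega> ?E) \<rightarrow> PiE J (\<lambda>i. space borel)"
      by (simp only: space_measure_of[OF E] space_borel) simp
  qed
  note id = this
  show "?L \<subseteq> sigma_sets ?\<Omega> ?E"
  proof
    fix A assume A: "A \<in> ?L"
    have "A \<subseteq> ?\<Omega>" using sets.sets_into_space[OF A] by (simp add: space_PiM)
    then have "(\<lambda>x. x) -` A \<inter> space (sigma ?\<Omega> ?E) = A"
      by (simp only: space_measure_of[OF E]) blast
    with measurable_sets[OF id A] show "A \<in> sigma_sets ?\<Omega> ?E"
      by (simp only: sets_measure_of[OF E])
  qed
  have "?E \<subseteq> ?L"
    by (rule image_subsetI, rule sets_PiM_I_finite[OF J]) simp
  then show "sigma_sets ?\<Omega> ?E \<subseteq> ?L"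
    using sets.sigma_sets_subset[of ?E "PiM J (\<lambda>_. borel)"] by (simp add: space_PiM)
qed

text \<open>Constant sequences converge, so the integrals of all bounded continuous functions agree, and indicators
of the boxes \<open>PiE J (\<lambda>i. {..a i})\<close> are decreasing limits of continuous functions.\<close>

lemma char_eq_imp_measure_eq:
  fixes L1 L2 :: "('i \<Rightarrow> real) measure"
  assumes J: "finite J"
    and L1: "prob_space L1" and sets1: "sets L1 = sets (PiM J (\<lambda>_. borel))"
    and L2: "prob_space L2" and sets2: "sets L2 = sets (PiM J (\<lambda>_. borel))"
    and ch: "\<And>a. (LINT x|L1. iexp (\<Sum>i\<in>J. a i * x i)) = (LINT x|L2. iexp (\<Sum>i\<in>J. a i * x i))"
  shows "L1 = L2"
proof -
  interpret L1: prob_space L1 by fact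
  interpret L2: prob_space L2 by fact
  let ?T = "product_topology (\<lambda>_. euclideanreal) J"
  have "weakly_converges ?T (\<lambda>_. L1) L2"
    by (rule cramer_wold_weak_convergence) (use assms in auto)
  then have eq: "(LINT x|L1. f x) = (LINT x|L2. f x)"
    if "continuous_map ?T euclideanreal f" "bounded (f ` topspace ?T)" for f :: "_ \<Rightarrow> real"
    using that by (auto simp: weakly_converges_def intro: LIMSEQ_unique[OF tendsto_const])
  show ?thesis
  proof (rule measure_eqI_generator_eq[where E="range (\<lambda>a. PiE J (\<lambda>i. {..a i}))" and \<Omega>="PiE J (\<lambda>_. UNIV)"
        and A="\<lambda>n. PiE J (\<lambda>_. {..real n})"])
    show "Int_stable (range (\<lambda>a. PiE J (\<lambda>i. {..a i :: real})))"
    proof (rule Int_stableI, safe)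
      fix a b :: "'i \<Rightarrow> real"
      have "PiE J (\<lambda>i. {..a i}) \<inter> PiE J (\<lambda>i. {..b i}) = PiE J (\<lambda>i. {..min (a i) (b i)})"
        by (auto simp: PiE_def Pi_def)
      then show "PiE J (\<lambda>i. {..a i}) \<inter> PiE J (\<lambda>i. {..b i}) \<in> range (\<lambda>a. PiE J (\<lambda>i. {..a i}))"
        by auto
    qed
    show "sets L1 = sigma_sets (PiE J (\<lambda>_. UNIV)) (range (\<lambda>a. PiE J (\<lambda>i. {..a i})))"
      "sets L2 = sigma_sets (PiE J (\<lambda>_. UNIV)) (range (\<lambda>a. PiE J (\<lambda>i. {..a i})))"
      by (simp_all only: sets1 sets2 PiM_borel_eq_sigma_boxes[OF J])
    show "range (\<lambda>a. PiE J (\<lambda>i. {..a i :: real})) \<subseteq> Pow (PiE J (\<lambda>_. UNIV))"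
      by (auto simp: PiE_def)
    show "range (\<lambda>n. PiE J (\<lambda>_. {..real n})) \<subseteq> range (\<lambda>a. PiE J (\<lambda>i. {..a i}))"
      by (intro image_subsetI) (rule range_eqI[of _ _ "\<lambda>_. real _"], rule refl)
    show "emeasure L1 (PiE J (\<lambda>_. {..real n})) \<noteq> \<infinity>" for n
      by simp
    show "(\<Union>n. PiE J (\<lambda>_. {..real n})) = PiE J (\<lambda>_. UNIV)"
    proof (rule antisym; rule subsetI)
      fix x :: "'i \<Rightarrow> real" assume x: "x \<in> PiE J (\<lambda>_. UNIV)"
      obtain n where n: "(\<Sum>j\<in>J. \<bar>x j\<bar>) \<le> real n" using real_arch_simple by blast
      have "x j \<le> real n" if "j \<in> J" for j
        using member_le_sum[OF that, of "\<lambda>j. \<bar>x j\<bar>"] J n by auto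
      then show "x \<in> (\<Union>n. PiE J (\<lambda>_. {..real n}))" using x by (auto simp: PiE_def Pi_def)
    qed (auto simp: PiE_def)
    fix A assume "A \<in> range (\<lambda>a. PiE J (\<lambda>i. {..a i :: real}))"
    then obtain a where A: "A = PiE J (\<lambda>i. {..a i})" by auto
    define s where "s x = (\<Sum>i\<in>J. max 0 (x i - a i))" for x :: "'i \<Rightarrow> real"
    have s0: "s x \<ge> 0" for x by (auto simp: s_def intro: sum_nonneg)
    have sA: "x \<in> A \<longleftrightarrow> s x = 0" if "x \<in> PiE J (\<lambda>_. UNIV)" for x
      using J that unfolding s_def by (subst sum_nonneg_eq_0_iff) (auto simp: A PiE_def Pi_def max_def)
    define g where "g m x = max 0 (1 - real m * s x)" for m x
    have cg: "continuous_map ?T euclideanreal (g m)" for m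
      unfolding g_def s_def
      by (intro continuous_map_real_max continuous_map_diff continuous_map_real_mult continuous_map_sum J
           continuous_map_product_projection continuous_map_const[THEN iffD2]) auto
    have gb: "0 \<le> g m x" "g m x \<le> 1" for m x using s0[of x] by (auto simp: g_def)
    have lim: "(\<lambda>m. LINT x|P. g m x) \<longlonglongrightarrow> measure P A" if P: "prob_space P" "sets P = sets (PiM J (\<lambda>_. borel))" for P
    proof -
      interpret P: prob_space P by fact
      note [measurable_cong] = P(2)
      have [measurable]: "A \<in> sets P" unfolding A P(2) using J by (auto intro!: sets_PiM_I_finite)
      have [measurable]: "g m \<in> borel_measurable P" for m
        using product_continuous_map_borel_measurable[OF J cg] by measurable
      have "(\<lambda>m. LINT x|P. g m x) \<longlonglongrightarrow> (LINT x|P. indicator A x)"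
      proof (rule integral_dominated_convergence[where w="\<lambda>_. 1"])
        show "AE x in P. (\<lambda>m. g m x) \<longlonglongrightarrow> indicator A x"
        proof (rule AE_I2)
          fix x assume "x \<in> space P"
          then have x: "x \<in> PiE J (\<lambda>_. UNIV)" using sets_eq_imp_space_eq[OF P(2)] by (auto simp: space_PiM)
          show "(\<lambda>m. g m x) \<longlonglongrightarrow> indicator A x"
          proof (cases "s x = 0")
            case True
            then show ?thesis using sA[OF x] by (simp add: g_def)
          next
            case False
            then have "s x > 0" using s0[of x] by simp
            obtain m0 where m0: "1 < real m0 * s x" using ex_less_of_nat_mult[OF \<open>s x > 0\<close>] by blast
            have "g m x = 0" if "m \<ge> m0" for m
            proof -
              have "1 < real m * s x" using m0 that \<open>s x > 0\<close> by (meson less_le_trans mult_right_mono of_nat_mono less_imp_le)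
              then show ?thesis by (simp add: g_def)
            qed
            then show ?thesis using sA[OF x] False
              by (intro tendsto_eventually) (auto simp: eventually_sequentially)
          qed
        qed
      qed (use gb in auto)
      then show ?thesis by simp
    qed
    have "(LINT x|L1. g m x) = (LINT x|L2. g m x)" for m
      by (rule eq[OF cg]) (use gb in \<open>auto simp: bounded_iff intro!: exI[of _ 1]\<close>)
    then have "measure L1 A = measure L2 A"
      using LIMSEQ_unique[OF lim[OF L1 sets1]] lim[OF L2 sets2] by simp
    then show "emeasure L1 A = emeasure L2 A"
      by (simp add: L1.emeasure_eq_measure L2.emeasure_eq_measure)
  qed
qed

section \<open>Gaussian processes with a given covariance\<close>

text \<open>Cholesky factorisation by induction on the index set: splitting off the index \<open>l\<close> leaves the Schur
complement \<open>C i j - C i l * C j l / C l l\<close>, which is again positive semidefinite. If \<open>C l l = 0\<close> then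
the whole column vanishes, and the convention \<open>x / 0 = 0\<close> makes the same formulas valid.\<close>

lemma psd_factorization:
  fixes C :: "'i \<Rightarrow> 'i \<Rightarrow> real"
  assumes "finite J" and "\<And>i j. i \<in> J \<Longrightarrow> j \<in> J \<Longrightarrow> C i j = C j i"
    and "\<And>a. 0 \<le> (\<Sum>i\<in>J. \<Sum>j\<in>J. a i * a j * C i j)"
  shows "\<exists>A. \<forall>i\<in>J. \<forall>j\<in>J. C i j = (\<Sum>k\<in>J. A i k * A j k)"
  using assms
proof (induction J arbitrary: C rule: finite_induct)
  case empty
  then show ?case by simp
next
  case (insert l J)
  define d where "d = C l l"
  have sym: "C l j = C j l" if "j \<in> J" for j using insert.prems(1)[of l j] that by simp
  have quad: "(\<Sum>i\<in>insert l J. \<Sum>j\<in>insert l J. a i * a j * C i j) =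
      (a l)\<^sup>2 * d + 2 * a l * (\<Sum>j\<in>J. a j * C j l) + (\<Sum>i\<in>J. \<Sum>j\<in>J. a i * a j * C i j)" for a
  proof -
    have "(\<Sum>j\<in>J. a l * a j * C l j) = a l * (\<Sum>j\<in>J. a j * C j l)"
      by (simp add: sum_distrib_left sym mult.assoc)
    moreover have "(\<Sum>i\<in>J. a i * a l * C i l) = a l * (\<Sum>j\<in>J. a j * C j l)"
      by (simp add: sum_distrib_left mult_ac)
    ultimately show ?thesis
      using insert.hyps by (simp add: sum.distrib d_def power2_eq_square)
  qed
  have d0: "d \<ge> 0"
  proof -
    have z: "(\<Sum>j\<in>J. (if j = l then 1 else 0) * C j l) = 0"
      "(\<Sum>i\<in>J. \<Sum>j\<in>J. (if i = l then 1 else 0) * (if j = l then 1 else 0) * C i j) = 0"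
      using insert.hyps(2) by (auto intro!: sum.neutral)
    show ?thesis using insert.prems(2)[of "\<lambda>i. if i = l then 1 else 0"]
      unfolding quad[of "\<lambda>i. if i = l then 1 else 0"] z by simp
  qed
  have zero: "C j l = 0" if "d = 0" "j \<in> J" for j
  proof (rule ccontr)
    assume ne: "C j l \<noteq> 0"
    \<comment> \<open>The quadratic form at \<open>t\<close> in direction \<open>l\<close> plus \<open>1\<close> in direction \<open>j\<close> is then \<open>-1\<close>.\<close>
    define t where "t = - (C j j + 1) / (2 * C j l)"
    have jl: "j \<noteq> l" using that(2) insert.hyps(2) by auto
    let ?a = "\<lambda>i. if i = l then t else if i = j then 1 else 0"
    have "(\<Sum>i\<in>J. ?a i * C i l) = (\<Sum>i\<in>J. if i = j then C i l else 0)"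
      using insert.hyps(2) by (intro sum.cong) auto
    then have z1: "(\<Sum>i\<in>J. ?a i * C i l) = C j l" using that(2) insert.hyps(1) by simp
    have "(\<Sum>i\<in>J. \<Sum>k\<in>J. ?a i * ?a k * C i k) = (\<Sum>i\<in>J. if i = j then \<Sum>k\<in>J. if k = j then C i k else 0 else 0)"
      using insert.hyps(2) by (intro sum.cong refl) (auto intro!: sum.cong sum.neutral)
    then have z2: "(\<Sum>i\<in>J. \<Sum>k\<in>J. ?a i * ?a k * C i k) = C j j" using that(2) insert.hyps(1) by simp
    have "0 \<le> 2 * t * C j l + C j j"
      using insert.prems(2)[of ?a] unfolding quad[of ?a] z1 z2 using that(1) by simp
    also have "\<dots> = -1" using ne by (simp add: t_def field_simps)
    finally show False by simp
  qed
  define C' where "C' i j = C i j - C i l * C j l / d" for i j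
  have "\<exists>A. \<forall>i\<in>J. \<forall>j\<in>J. C' i j = (\<Sum>k\<in>J. A i k * A j k)"
  proof (rule insert.IH)
    show "C' i j = C' j i" if "i \<in> J" "j \<in> J" for i j
      using insert.prems(1)[of i j] that by (simp add: C'_def mult.commute)
    fix a :: "'i \<Rightarrow> real"
    define s where "s = (\<Sum>j\<in>J. a j * C j l)"
    \<comment> \<open>The value at \<open>l\<close> that minimises the quadratic form.\<close>
    define a' where "a' = a(l := - s / d)"
    have a'J: "a' j = a j" if "j \<in> J" for j using that insert.hyps(2) by (auto simp: a'_def)
    have "0 \<le> (a' l)\<^sup>2 * d + 2 * a' l * s + (\<Sum>i\<in>J. \<Sum>j\<in>J. a i * a j * C i j)"
      using insert.prems(2)[of a'] unfolding quad by (simp add: a'J s_def)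
    also have "(a' l)\<^sup>2 * d + 2 * a' l * s = - (s * s / d)"
      by (cases "d = 0") (simp_all add: a'_def power2_eq_square field_simps)
    also have "s * s / d = (\<Sum>i\<in>J. \<Sum>j\<in>J. a i * a j * (C i l * C j l / d))"
      unfolding s_def sum_product sum_divide_distrib by (intro sum.cong refl) (simp add: field_simps)
    also have "- (\<Sum>i\<in>J. \<Sum>j\<in>J. a i * a j * (C i l * C j l / d)) + (\<Sum>i\<in>J. \<Sum>j\<in>J. a i * a j * C i j) =
        (\<Sum>i\<in>J. \<Sum>j\<in>J. a i * a j * C' i j)"
      by (simp add: C'_def right_diff_distrib sum_subtractf)
    finally show "0 \<le> (\<Sum>i\<in>J. \<Sum>j\<in>J. a i * a j * C' i j)" .
  qed
  then obtain A where A: "\<And>i j. i \<in> J \<Longrightarrow> j \<in> J \<Longrightarrow> C' i j = (\<Sum>k\<in>J. A i k * A j k)" by blast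
  define A' where "A' i k = (if k = l then C i l / sqrt d else if i = l then 0 else A i k)" for i k
  have A'J: "A' i k = A i k" if "i \<in> J" "k \<in> J" for i k using that insert.hyps(2) by (auto simp: A'_def)
  have A'l: "A' l k = 0" if "k \<in> J" for k using that insert.hyps(2) by (auto simp: A'_def)
  have sd: "C i l / sqrt d * (C j l / sqrt d) = C i l * C j l / d" for i j
    using d0 by (simp add: real_sqrt_mult_self)
  have eqJ: "C i j = (\<Sum>k\<in>insert l J. A' i k * A' j k)" if "i \<in> J" "j \<in> J" for i j
    using insert.hyps A[OF that] that by (simp add: A'J C'_def) (simp add: A'_def sd d0)
  have eql: "C i l = (\<Sum>k\<in>insert l J. A' i k * A' l k)" if "i \<in> insert l J" for i
    using insert.hyps zero[of i] that d0 by (cases "d = 0") (auto simp: A'l, auto simp: A'_def d_def sd)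
  show ?case
  proof (intro exI[of _ A'] ballI)
    fix i j assume ij: "i \<in> insert l J" "j \<in> insert l J"
    show "C i j = (\<Sum>k\<in>insert l J. A' i k * A' j k)"
    proof (cases "j = l")
      case True
      then show ?thesis using eql[OF ij(1)] by simp
    next
      case jl: False
      show ?thesis
      proof (cases "i = l")
        case True
        then show ?thesis using eql[OF ij(2)] insert.prems(1)[OF ij] by (simp only: mult.commute)
      next
        case False
        then show ?thesis using jl ij eqJ by blast
      qed
    qed
  qed
qed

text \<open>The image form covers the degenerate case \<open>V = 0\<close> as well.\<close>

definition gauss :: "real \<Rightarrow> real measure" where
  "gauss V = distr std_normal_distribution borel (\<lambda>x. sqrt V * x)"

lemma real_distribution_gauss: "real_distribution (gauss V)"
proof -
  interpret real_distribution std_normal_distribution by (rule real_dist_normal_dist)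
  show ?thesis unfolding gauss_def by (rule real_distribution_distr) simp
qed

lemma sets_gauss[simp, measurable_cong]: "sets (gauss V) = sets borel"
  by (simp add: gauss_def)

lemma char_gauss: "V \<ge> 0 \<Longrightarrow> char (gauss V) t = exp (- (t\<^sup>2 * V / 2))"
proof -
  assume "V \<ge> 0"
  have "char (gauss V) t = char std_normal_distribution (t * sqrt V)"
    unfolding gauss_def char_def by (subst integral_distr) (auto simp: mult.assoc)
  also have "\<dots> = exp (- (t\<^sup>2 * V / 2))"
    using \<open>V \<ge> 0\<close> by (simp add: char_std_normal_distribution power_mult_distrib)
  finally show ?thesis .
qed

lemma gauss_mean: "(LINT x|gauss V. x) = 0"
  unfolding gauss_def using integral_std_normal_distribution_moment_odd[of 1] by (subst integral_distr) auto

lemma gauss_integrable_square: "integrable (gauss V) (\<lambda>x. x\<^sup>2)"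
  unfolding gauss_def using integrable_std_normal_distribution_moment[of 2]
  by (subst integrable_distr_eq) (auto simp: power_mult_distrib)

lemma gauss_second_moment: "V \<ge> 0 \<Longrightarrow> (LINT x|gauss V. x\<^sup>2) = V"
  unfolding gauss_def using std_normal_distribution_even_moments[of 1]
  by (subst integral_distr) (auto simp: power_mult_distrib has_bochner_integral_integral_eq)

lemma gauss_0: "gauss 0 = return borel 0"
proof -
  interpret real_distribution std_normal_distribution by (rule real_dist_normal_dist)
  show ?thesis unfolding gauss_def real_sqrt_zero mult_zero_left by (rule distr_const) simp
qed

lemma gauss_density: "V > 0 \<Longrightarrow> gauss V = density lborel (normal_density 0 (sqrt V))"
proof -
  assume "V > 0"
  interpret real_distribution std_normal_distribution by (rule real_dist_normal_dist)
  have "distributed std_normal_distribution lborel (\<lambda>x. x) std_normal_density"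
    unfolding distributed_def by (auto simp: distr_id2)
  from normal_density_affine[OF this, of "sqrt V" 0] \<open>V > 0\<close>
  have "distributed std_normal_distribution lborel (\<lambda>x. sqrt V * x) (normal_density 0 (sqrt V))"
    by simp
  then show ?thesis unfolding gauss_def by (metis distributed_distr_eq_density distr_cong sets_lborel)
qed

lemma normal_law_gauss: "V \<ge> 0 \<Longrightarrow> normal_law (gauss V)"
  unfolding normal_law_def using gauss_0 gauss_density[of V] real_sqrt_gt_zero[of V]
  by (cases "V = 0") (blast, metis less_eq_real_def)

lemma gaussian_vector_exists:
  fixes C :: "'i \<Rightarrow> 'i \<Rightarrow> real"
  assumes J: "finite J" and sym: "\<And>i j. i \<in> J \<Longrightarrow> j \<in> J \<Longrightarrow> C i j = C j i"
    and psd: "\<And>a. 0 \<le> (\<Sum>i\<in>J. \<Sum>j\<in>J. a i * a j * C i j)"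
  shows "\<exists>G. prob_space G \<and> sets G = sets (PiM J (\<lambda>_. borel)) \<and>
    (\<forall>a. (LINT x|G. iexp (\<Sum>i\<in>J. a i * x i)) = exp (- ((\<Sum>i\<in>J. \<Sum>j\<in>J. a i * a j * C i j) / 2)))"
proof -
  obtain A where A: "\<And>i j. i \<in> J \<Longrightarrow> j \<in> J \<Longrightarrow> C i j = (\<Sum>k\<in>J. A i k * A j k)"
    using psd_factorization[OF J sym psd] by blast
  interpret sn: real_distribution std_normal_distribution by (rule real_dist_normal_dist)
  interpret product_sigma_finite "\<lambda>_::'i. std_normal_distribution" ..
  let ?N = "PiM J (\<lambda>_. std_normal_distribution)"
  interpret N: prob_space ?N by (intro prob_space_PiM) unfold_locales
  define T where "T \<omega> = (\<lambda>i\<in>J. \<Sum>k\<in>J. A i k * \<omega> k)" for \<omega> :: "'i \<Rightarrow> real"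
  have T[measurable]: "T \<in> measurable ?N (PiM J (\<lambda>_. borel))"
  proof -
    have [measurable]: "(\<lambda>\<omega>. \<omega> k) \<in> borel_measurable ?N" if "k \<in> J" for k
      using measurable_component_singleton[OF that, of "\<lambda>_. std_normal_distribution"] by simp
    show ?thesis unfolding T_def by measurable
  qed
  show ?thesis
  proof (intro exI[of _ "distr ?N (PiM J (\<lambda>_. borel)) T"] conjI allI)
    show "prob_space (distr ?N (PiM J (\<lambda>_. borel)) T)" by (rule N.prob_space_distr) (rule T)
    fix a :: "'i \<Rightarrow> real"
    define b where "b k = (\<Sum>i\<in>J. a i * A i k)" for k
    have lin: "(\<Sum>i\<in>J. a i * T \<omega> i) = (\<Sum>k\<in>J. b k * \<omega> k)" for \<omega>
      unfolding T_def b_def sum_distrib_right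
      by (subst sum.swap) (auto intro!: sum.cong simp: sum_distrib_left mult.assoc)
    have "(LINT x|distr ?N (PiM J (\<lambda>_. borel)) T. iexp (\<Sum>i\<in>J. a i * x i)) = (LINT \<omega>|?N. iexp (\<Sum>i\<in>J. a i * T \<omega> i))"
      by (subst integral_distr) auto
    also have "\<dots> = (LINT \<omega>|?N. (\<Prod>k\<in>J. iexp (b k * \<omega> k)))"
      unfolding lin by (simp add: sum_distrib_left exp_sum[OF J])
    also have "\<dots> = (\<Prod>k\<in>J. LINT x|std_normal_distribution. iexp (b k * x))"
      using J by (intro product_integral_prod sn.integrable_iexp) auto
    also have "\<dots> = (\<Prod>k\<in>J. exp (- ((b k)\<^sup>2 / 2)))"
      using char_std_normal_distribution unfolding char_def by (simp add: fun_eq_iff)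
    also have "\<dots> = exp (- ((\<Sum>k\<in>J. b k * b k) / 2))"
      by (simp add: exp_sum[OF J, symmetric] sum_negf sum_divide_distrib power2_eq_square)
    also have "(\<Sum>k\<in>J. b k * b k) = (\<Sum>i\<in>J. \<Sum>j\<in>J. a i * a j * C i j)"
    proof -
      have "(\<Sum>k\<in>J. b k * b k) = (\<Sum>k\<in>J. \<Sum>i\<in>J. \<Sum>j\<in>J. a i * a j * (A i k * A j k))"
        unfolding b_def sum_product by (intro sum.cong refl) (simp add: mult_ac)
      also have "\<dots> = (\<Sum>i\<in>J. \<Sum>j\<in>J. \<Sum>k\<in>J. a i * a j * (A i k * A j k))"
        by (subst sum.swap) (rule sum.cong[OF refl], rule sum.swap)
      also have "\<dots> = (\<Sum>i\<in>J. \<Sum>j\<in>J. a i * a j * C i j)"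
        by (simp add: A sum_distrib_left)
      finally show ?thesis .
    qed
    finally show "(LINT x|distr ?N (PiM J (\<lambda>_. borel)) T. iexp (\<Sum>i\<in>J. a i * x i)) =
      exp (- ((\<Sum>i\<in>J. \<Sum>j\<in>J. a i * a j * C i j) / 2))" .
  qed simp
qed

text \<open>The finite-dimensional laws are consistent because restricting the index set amounts to testing with
weights that vanish outside of it, and characteristic functions determine laws; Kolmogorov's extension theorem
then provides the measure.\<close>

theorem gaussian_family_exists:
  fixes C :: "'i \<Rightarrow> 'i \<Rightarrow> real"
  assumes sym: "\<And>i j. i \<in> T \<Longrightarrow> j \<in> T \<Longrightarrow> C i j = C j i"
    and psd: "\<And>J a. finite J \<Longrightarrow> J \<subseteq> T \<Longrightarrow> 0 \<le> (\<Sum>i\<in>J. \<Sum>j\<in>J. a i * a j * C i j)"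
  shows "\<exists>N :: ('i \<Rightarrow> real) measure. prob_space N \<and> (\<forall>i\<in>T. (\<lambda>\<omega>. \<omega> i) \<in> borel_measurable N) \<and>
    (\<forall>J a. finite J \<and> J \<subseteq> T \<longrightarrow>
       (LINT \<omega>|N. iexp (\<Sum>i\<in>J. a i * \<omega> i)) = exp (- ((\<Sum>i\<in>J. \<Sum>j\<in>J. a i * a j * C i j) / 2)))"
proof -
  define good where "good J G \<longleftrightarrow> prob_space G \<and> sets G = sets (PiM J (\<lambda>_. borel)) \<and>
    (\<forall>a. (LINT x|G. iexp (\<Sum>i\<in>J. a i * x i)) = exp (- ((\<Sum>i\<in>J. \<Sum>j\<in>J. a i * a j * C i j) / 2)))"
    for J and G :: "('i \<Rightarrow> real) measure"
  define P where "P J = (SOME G. good J G)" for J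
  have good: "good J (P J)" if "finite J" "J \<subseteq> T" for J
  proof -
    have "\<exists>G. good J G" unfolding good_def
      by (rule gaussian_vector_exists) (use that psd in \<open>auto intro: sym\<close>)
    then show ?thesis unfolding P_def by (rule someI_ex)
  qed
  have pP: "prob_space (P J)" and sP: "sets (P J) = sets (PiM J (\<lambda>_. borel))"
    and cP: "(LINT x|P J. iexp (\<Sum>i\<in>J. a i * x i)) = exp (- ((\<Sum>i\<in>J. \<Sum>j\<in>J. a i * a j * C i j) / 2))"
    if "finite J" "J \<subseteq> T" for J a
    using good[OF that] by (simp_all add: good_def)
  have proj: "P J = distr (P H) (PiM J (\<lambda>_. borel)) (\<lambda>f. restrict f J)"
    if JH: "J \<subseteq> H" and H: "finite H" "H \<subseteq> T" for J H
  proof (rule char_eq_imp_measure_eq)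
    have J: "finite J" "J \<subseteq> T" using JH H by (auto intro: finite_subset)
    interpret H: prob_space "P H" by (rule pP[OF H])
    note [measurable_cong] = sP[OF H]
    have r[measurable]: "(\<lambda>f. restrict f J) \<in> measurable (P H) (PiM J (\<lambda>_. borel))"
      unfolding measurable_cong_sets[OF sP[OF H] refl] by (rule measurable_restrict_subset[OF JH])
    show "finite J" "prob_space (P J)" "sets (P J) = sets (PiM J (\<lambda>_. borel))"
      using J pP sP by auto
    show "prob_space (distr (P H) (PiM J (\<lambda>_. borel)) (\<lambda>f. restrict f J))"
      by (rule H.prob_space_distr[OF r])
    fix a :: "'i \<Rightarrow> real"
    define b where "b i = (if i \<in> J then a i else 0)" for i
    have ext: "(\<Sum>i\<in>H. b i * g i) = (\<Sum>i\<in>J. a i * g i)" for g :: "'i \<Rightarrow> real"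
      unfolding b_def using JH H(1) by (intro sum.mono_neutral_cong_right) auto
    have "(LINT x|distr (P H) (PiM J (\<lambda>_. borel)) (\<lambda>f. restrict f J). iexp (\<Sum>i\<in>J. a i * x i)) =
        (LINT x|P H. iexp (\<Sum>i\<in>J. a i * x i))"
      by (subst integral_distr) (auto cong: sum.cong)
    also have "\<dots> = (LINT x|P H. iexp (\<Sum>i\<in>H. b i * x i))"
      by (simp only: ext)
    also have "\<dots> = exp (- ((\<Sum>i\<in>H. \<Sum>j\<in>H. b i * b j * C i j) / 2))"
      by (rule cP[OF H])
    also have "(\<Sum>i\<in>H. \<Sum>j\<in>H. b i * b j * C i j) = (\<Sum>i\<in>J. \<Sum>j\<in>J. a i * a j * C i j)"
      by (simp only: mult.assoc sum_distrib_left[symmetric] ext)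
    also have "exp (- ((\<Sum>i\<in>J. \<Sum>j\<in>J. a i * a j * C i j) / 2)) = (LINT x|P J. iexp (\<Sum>i\<in>J. a i * x i))"
      by (rule cP[OF J, symmetric])
    finally have E: "(LINT x|distr (P H) (PiM J (\<lambda>_. borel)) (\<lambda>f. restrict f J). iexp (\<Sum>i\<in>J. a i * x i)) =
      (LINT x|P J. iexp (\<Sum>i\<in>J. a i * x i))" .
    show "(LINT x|P J. iexp (\<Sum>i\<in>J. a i * x i)) =
       (LINT x|distr (P H) (PiM J (\<lambda>_. borel)) (\<lambda>f. restrict f J). iexp (\<Sum>i\<in>J. a i * x i))"
      by (rule E[symmetric])
  qed simp
  interpret PF: polish_projective T P
    unfolding polish_projective_def projective_family_def using proj pP by blast
  interpret L: prob_space PF.lim by unfold_locales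
  have rm: "(\<lambda>f. restrict f J) \<in> measurable PF.lim (PiM J (\<lambda>_. borel))" if "J \<subseteq> T" for J
    unfolding measurable_cong_sets[OF PF.sets_lim refl] by (rule measurable_restrict_subset[OF that])
  have marg: "distr PF.lim (PiM J (\<lambda>_. borel)) (\<lambda>f. restrict f J) = P J" if J: "finite J" "J \<subseteq> T" for J
  proof (rule measure_eqI)
    fix A assume "A \<in> sets (distr PF.lim (PiM J (\<lambda>_. borel)) (\<lambda>f. restrict f J))"
    then have A: "A \<in> sets (PiM J (\<lambda>_. borel))" by simp
    have "emeasure (distr PF.lim (PiM J (\<lambda>_. borel)) (\<lambda>f. restrict f J)) A =
        emeasure PF.lim ((\<lambda>f. restrict f J) -` A \<inter> space PF.lim)"
      by (rule emeasure_distr[OF rm[OF J(2)] A])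
    also have "(\<lambda>f. restrict f J) -` A \<inter> space PF.lim = prod_emb T (\<lambda>_. borel) J A"
      by (simp add: prod_emb_def space_PiM)
    also note PF.emeasure_lim_emb[OF J(2,1) A]
    finally show "emeasure (distr PF.lim (PiM J (\<lambda>_. borel)) (\<lambda>f. restrict f J)) A = emeasure (P J) A" .
  qed (simp add: sP[OF J])
  have chl: "(LINT \<omega>|PF.lim. iexp (\<Sum>i\<in>J. a i * \<omega> i)) = exp (- ((\<Sum>i\<in>J. \<Sum>j\<in>J. a i * a j * C i j) / 2))"
    if J: "finite J" "J \<subseteq> T" for J a
  proof -
    have "(LINT x|distr PF.lim (PiM J (\<lambda>_. borel)) (\<lambda>f. restrict f J). iexp (\<Sum>i\<in>J. a i * x i)) =
        (LINT \<omega>|PF.lim. iexp (\<Sum>i\<in>J. a i * \<omega> i))"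
      using rm[OF J(2)] by (subst integral_distr) (auto cong: sum.cong)
    then show ?thesis unfolding marg[OF J] cP[OF J] by simp
  qed
  show ?thesis
  proof (intro exI[of _ PF.lim] conjI allI impI ballI)
    show "prob_space PF.lim" by unfold_locales
    show "(\<lambda>\<omega>. \<omega> i) \<in> borel_measurable PF.lim" if "i \<in> T" for i
      unfolding measurable_cong_sets[OF PF.sets_lim refl] by (rule measurable_component_singleton[OF that])
  qed (use chl in auto)
qed

lemma gaussian_family_linear_combination:
  fixes N :: "('i \<Rightarrow> real) measure"
  assumes N: "prob_space N" and meas: "\<And>i. i \<in> J \<Longrightarrow> (\<lambda>\<omega>. \<omega> i) \<in> borel_measurable N"
    and ch: "\<And>a. (LINT \<omega>|N. iexp (\<Sum>i\<in>J. a i * \<omega> i)) = exp (- ((\<Sum>i\<in>J. \<Sum>j\<in>J. a i * a j * C i j) / 2))"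
    and psd: "0 \<le> (\<Sum>i\<in>J. \<Sum>j\<in>J. a i * a j * C i j)"
  shows "distr N borel (\<lambda>\<omega>. \<Sum>i\<in>J. a i * \<omega> i) = gauss (\<Sum>i\<in>J. \<Sum>j\<in>J. a i * a j * C i j)"
proof (rule Levy_uniqueness)
  interpret N: prob_space N by fact
  have [measurable]: "(\<lambda>\<omega>. \<Sum>i\<in>J. a i * \<omega> i) \<in> borel_measurable N"
    by (intro borel_measurable_sum borel_measurable_times borel_measurable_const meas)
  show "real_distribution (distr N borel (\<lambda>\<omega>. \<Sum>i\<in>J. a i * \<omega> i))"
    by (rule N.real_distribution_distr) simp
  show "real_distribution (gauss (\<Sum>i\<in>J. \<Sum>j\<in>J. a i * a j * C i j))"
    by (rule real_distribution_gauss)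
  show "char (distr N borel (\<lambda>\<omega>. \<Sum>i\<in>J. a i * \<omega> i)) = char (gauss (\<Sum>i\<in>J. \<Sum>j\<in>J. a i * a j * C i j))"
  proof
    fix t
    have "char (distr N borel (\<lambda>\<omega>. \<Sum>i\<in>J. a i * \<omega> i)) t = (LINT \<omega>|N. iexp (t * (\<Sum>i\<in>J. a i * \<omega> i)))"
      unfolding char_def by (subst integral_distr) auto
    also have "\<dots> = (LINT \<omega>|N. iexp (\<Sum>i\<in>J. (t * a i) * \<omega> i))"
      by (simp only: sum_distrib_left mult.assoc)
    also have "\<dots> = exp (- ((\<Sum>i\<in>J. \<Sum>j\<in>J. (t * a i) * (t * a j) * C i j) / 2))"
      by (rule ch)
    also have "(\<Sum>i\<in>J. \<Sum>j\<in>J. (t * a i) * (t * a j) * C i j) = t\<^sup>2 * (\<Sum>i\<in>J. \<Sum>j\<in>J. a i * a j * C i j)"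
      by (simp add: sum_distrib_left power2_eq_square mult_ac)
    finally show "char (distr N borel (\<lambda>\<omega>. \<Sum>i\<in>J. a i * \<omega> i)) t = char (gauss (\<Sum>i\<in>J. \<Sum>j\<in>J. a i * a j * C i j)) t"
      using char_gauss[OF psd] by simp
  qed
qed

text \<open>The law of each linear combination is read off from its characteristic function, and the covariances follow
by polarisation from the second moments of \<open>\<omega> i + \<omega> j\<close> and \<open>\<omega> i - \<omega> j\<close>.\<close>

theorem gaussian_process_exists:
  fixes C :: "'i \<Rightarrow> 'i \<Rightarrow> real"
  assumes sym: "\<And>i j. i \<in> T \<Longrightarrow> j \<in> T \<Longrightarrow> C i j = C j i"
    and psd: "\<And>J a. finite J \<Longrightarrow> J \<subseteq> T \<Longrightarrow> 0 \<le> (\<Sum>i\<in>J. \<Sum>j\<in>J. a i * a j * C i j)"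
  obtains N :: "('i \<Rightarrow> real) measure" where
    "gaussian_process N T (\<lambda>i \<omega>. \<omega> i)"
    "\<And>i. i \<in> T \<Longrightarrow> (LINT \<omega>|N. \<omega> i) = 0"
    "\<And>i j. i \<in> T \<Longrightarrow> j \<in> T \<Longrightarrow> (LINT \<omega>|N. \<omega> i * \<omega> j) = C i j"
    "\<And>J a. finite J \<Longrightarrow> J \<subseteq> T \<Longrightarrow>
       (LINT \<omega>|N. iexp (\<Sum>i\<in>J. a i * \<omega> i)) = exp (- ((\<Sum>i\<in>J. \<Sum>j\<in>J. a i * a j * C i j) / 2))"
proof -
  have "\<exists>N :: ('i \<Rightarrow> real) measure. prob_space N \<and> (\<forall>i\<in>T. (\<lambda>\<omega>. \<omega> i) \<in> borel_measurable N) \<and>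
    (\<forall>J a. finite J \<and> J \<subseteq> T \<longrightarrow>
       (LINT \<omega>|N. iexp (\<Sum>i\<in>J. a i * \<omega> i)) = exp (- ((\<Sum>i\<in>J. \<Sum>j\<in>J. a i * a j * C i j) / 2)))"
    by (rule gaussian_family_exists[OF sym psd])
  then obtain N :: "('i \<Rightarrow> real) measure" where N0: "prob_space N \<and> (\<forall>i\<in>T. (\<lambda>\<omega>. \<omega> i) \<in> borel_measurable N) \<and>
    (\<forall>J a. finite J \<and> J \<subseteq> T \<longrightarrow>
       (LINT \<omega>|N. iexp (\<Sum>i\<in>J. a i * \<omega> i)) = exp (- ((\<Sum>i\<in>J. \<Sum>j\<in>J. a i * a j * C i j) / 2)))"
    by (erule exE)
  note N = conjunct1[OF N0]
  note m = bspec[OF conjunct1[OF conjunct2[OF N0]]]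
  have ch: "(LINT \<omega>|N. iexp (\<Sum>i\<in>J. a i * \<omega> i)) = exp (- ((\<Sum>i\<in>J. \<Sum>j\<in>J. a i * a j * C i j) / 2))"
    if "finite J" "J \<subseteq> T" for J a
    by (rule conjunct2[OF conjunct2[OF N0], rule_format]) (rule conjI[OF that])
  have law: "distr N borel (\<lambda>\<omega>. \<Sum>i\<in>J. a i * \<omega> i) = gauss (\<Sum>i\<in>J. \<Sum>j\<in>J. a i * a j * C i j)"
    if "finite J" "J \<subseteq> T" for J a
    by (rule gaussian_family_linear_combination[OF N _ ch[OF that] psd[OF that]]) (use m that in auto)
  have sq: "integrable N (\<lambda>\<omega>. (\<Sum>i\<in>J. a i * \<omega> i)\<^sup>2)"
    "(LINT \<omega>|N. (\<Sum>i\<in>J. a i * \<omega> i)\<^sup>2) = (\<Sum>i\<in>J. \<Sum>j\<in>J. a i * a j * C i j)"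
    "(LINT \<omega>|N. (\<Sum>i\<in>J. a i * \<omega> i)) = 0"
    if J: "finite J" "J \<subseteq> T" for J a
  proof -
    have [measurable]: "(\<lambda>\<omega>. \<Sum>i\<in>J. a i * \<omega> i) \<in> borel_measurable N"
      using J by (intro borel_measurable_sum borel_measurable_times borel_measurable_const m) auto
    show "integrable N (\<lambda>\<omega>. (\<Sum>i\<in>J. a i * \<omega> i)\<^sup>2)"
      using gauss_integrable_square[of "\<Sum>i\<in>J. \<Sum>j\<in>J. a i * a j * C i j"]
      unfolding law[OF J, symmetric] by (subst (asm) integrable_distr_eq) auto
    show "(LINT \<omega>|N. (\<Sum>i\<in>J. a i * \<omega> i)\<^sup>2) = (\<Sum>i\<in>J. \<Sum>j\<in>J. a i * a j * C i j)"
      using gauss_second_moment[OF psd[OF J, of a]]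
      unfolding law[OF J, symmetric] by (subst (asm) integral_distr) auto
    show "(LINT \<omega>|N. (\<Sum>i\<in>J. a i * \<omega> i)) = 0"
      using gauss_mean[of "\<Sum>i\<in>J. \<Sum>j\<in>J. a i * a j * C i j"]
      unfolding law[OF J, symmetric] by (subst (asm) integral_distr) auto
  qed
  show thesis
  proof (rule that)
    show "gaussian_process N T (\<lambda>i \<omega>. \<omega> i)"
      unfolding gaussian_process_def using N m law psd by (auto intro!: normal_law_gauss)
    show "(LINT \<omega>|N. \<omega> i) = 0" if "i \<in> T" for i
      using sq(3)[of "{i}" "\<lambda>_. 1"] that by simp
    show "(LINT \<omega>|N. \<omega> i * \<omega> j) = C i j" if ij: "i \<in> T" "j \<in> T" for i j
    proof (cases "i = j")
      case True
      then show ?thesis using sq(2)[of "{i}" "\<lambda>_. 1"] ij by (simp add: power2_eq_square)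
    next
      case False
      have p: "integrable N (\<lambda>\<omega>. (\<omega> i + \<omega> j)\<^sup>2)" "(LINT \<omega>|N. (\<omega> i + \<omega> j)\<^sup>2) = C i i + 2 * C i j + C j j"
        using sq(1,2)[of "{i, j}" "\<lambda>_. 1"] ij False sym[OF ij] by auto
      have q: "integrable N (\<lambda>\<omega>. (\<omega> i - \<omega> j)\<^sup>2)" "(LINT \<omega>|N. (\<omega> i - \<omega> j)\<^sup>2) = C i i - 2 * C i j + C j j"
        using sq(1,2)[of "{i, j}" "\<lambda>k. if k = i then 1 else -1"] ij False sym[OF ij] by auto
      have "(LINT \<omega>|N. \<omega> i * \<omega> j) = (LINT \<omega>|N. ((\<omega> i + \<omega> j)\<^sup>2 - (\<omega> i - \<omega> j)\<^sup>2) / 4)"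
        by (intro Bochner_Integration.integral_cong) (auto simp: power2_eq_square algebra_simps)
      also have "\<dots> = C i j" using p q by simp
      finally show ?thesis .
    qed
  qed (rule ch)
qed

section \<open>Expected positive parts in the central limit theorem\<close>

text \<open>Write the integrand as \<open>x * \<phi> x - y * \<phi> x\<close> on the half-line above \<open>y\<close>. The first part has the
antiderivative \<open>- V * \<phi> x\<close>, the second is a Gaussian tail probability.\<close>

lemma pos_part_integral_gauss:
  assumes "V \<ge> 0"
  shows "(LINT x|gauss V. max 0 (x - y)) = Psi V y"
proof (cases "V = 0")
  case True
  then show ?thesis by (simp add: gauss_0 integral_return Psi_def)
next
  case False
  define \<sigma> where "\<sigma> = sqrt V"
  have V: "V > 0" and \<sigma>: "\<sigma> > 0" "\<sigma>\<^sup>2 = V" using assms False by (auto simp: \<sigma>_def)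
  let ?\<phi> = "normal_density 0 \<sigma>"
  have int0: "integrable lborel ?\<phi>" using \<sigma> by simp
  have int1: "integrable lborel (\<lambda>x. x * ?\<phi> x)"
    using integrable_normal_moment_nz_1[OF \<sigma>(1), of 0] by (simp add: mult.commute)
  have cd: "(?\<phi> has_real_derivative (- x / V * ?\<phi> x)) (at x)" for x
    unfolding normal_density_def using \<sigma>(1) unfolding \<sigma>(2)[symmetric] by (auto intro!: derivative_eq_intros simp: power2_eq_square field_simps)
  have lim: "(?\<phi> \<longlongrightarrow> 0) at_top"
    unfolding normal_density_def using V unfolding \<sigma>(2)
    by (real_asymp)
  have ftc: "(LBINT x=ereal y..\<infinity>. x * ?\<phi> x) = 0 - (- V * ?\<phi> y)"
  proof (rule interval_integral_FTC_integrable[where F="\<lambda>x. - V * ?\<phi> x"])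
    show "((\<lambda>x. - V * ?\<phi> x) has_vector_derivative x * ?\<phi> x) (at x)" for x
      unfolding has_real_derivative_iff_has_vector_derivative[symmetric]
      by (rule derivative_eq_intros cd refl)+ (use V in simp)
    show "isCont (\<lambda>x. x * ?\<phi> x) x" for x
      using DERIV_isCont[OF cd] by (intro continuous_intros)
    show "set_integrable lborel (einterval (ereal y) \<infinity>) (\<lambda>x. x * ?\<phi> x)"
      unfolding set_integrable_def by (intro integrable_mult_indicator int1) simp
    show "(((\<lambda>x. - V * ?\<phi> x) \<circ> real_of_ereal) \<longlongrightarrow> - V * ?\<phi> y) (at_right (ereal y))"
    proof -
      have "isCont (\<lambda>x. - V * ?\<phi> x) y" using DERIV_isCont[OF cd] by (intro continuous_intros)
      then have "((\<lambda>x. - V * ?\<phi> x) \<longlongrightarrow> - V * ?\<phi> y) (at_right y)"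
        by (auto simp: isCont_def filterlim_at_split)
      then show ?thesis by (simp add: ereal_tendsto_simps)
    qed
    show "(((\<lambda>x. - V * ?\<phi> x) \<circ> real_of_ereal) \<longlongrightarrow> 0) (at_left \<infinity>)"
      using tendsto_mult[OF tendsto_const lim, of "- V"] by (simp add: ereal_tendsto_simps)
  qed simp
  have m1: "(LINT x|lborel. indicator {y<..} x * (x * ?\<phi> x)) = V * ?\<phi> y"
    using ftc by (simp add: interval_lebesgue_integral_def set_lebesgue_integral_def einterval_eq)
  have m0: "(LINT x|lborel. indicator {y<..} x * ?\<phi> x) = 1 - Phi V y"
  proof -
    have "1 = (LINT x|lborel. ?\<phi> x)" using \<sigma> by simp
    also have "\<dots> = (LINT x|lborel. indicator {..y} x * ?\<phi> x + indicator {y<..} x * ?\<phi> x)"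
      by (intro Bochner_Integration.integral_cong) (auto simp: indicator_def)
    also have "\<dots> = (LINT x|lborel. indicator {..y} x * ?\<phi> x) + (LINT x|lborel. indicator {y<..} x * ?\<phi> x)"
      using integrable_mult_indicator[OF _ int0, of "{..y}"] integrable_mult_indicator[OF _ int0, of "{y<..}"]
      by (intro Bochner_Integration.integral_add) auto
    finally show ?thesis by (simp add: Phi_def set_lebesgue_integral_def \<sigma>_def)
  qed
  have "(LINT x|gauss V. max 0 (x - y)) = (LINT x|lborel. ?\<phi> x * max 0 (x - y))"
    unfolding gauss_density[OF V] \<sigma>_def[symmetric]
    by (subst integral_density) (use \<sigma> in auto)
  also have "\<dots> = (LINT x|lborel. indicator {y<..} x * (x * ?\<phi> x) - y * (indicator {y<..} x * ?\<phi> x))"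
    by (intro Bochner_Integration.integral_cong) (auto simp: indicator_def max_def algebra_simps)
  also have "\<dots> = V * ?\<phi> y - y * (1 - Phi V y)"
    using integrable_mult_indicator[OF _ int1, of "{y<..}"] integrable_mult_indicator[OF _ int0, of "{y<..}"]
    by (subst Bochner_Integration.integral_diff) (auto simp: m0 m1)
  finally show ?thesis using False by (simp add: Psi_def \<sigma>_def)
qed

text \<open>The positive part is unbounded; truncating it at \<open>R\<close> costs at most the second moment divided by \<open>R\<close>.\<close>

lemma weak_conv_pos_part:
  fixes \<mu> :: "nat \<Rightarrow> real measure"
  assumes \<mu>: "\<And>n. real_distribution (\<mu> n)" and L: "real_distribution L"
    and ch: "\<And>t. (\<lambda>n. char (\<mu> n) t) \<longlonglongrightarrow> char L t"
    and i\<mu>: "\<And>n. integrable (\<mu> n) (\<lambda>x. x\<^sup>2)" and b\<mu>: "\<And>n. (LINT x|\<mu> n. x\<^sup>2) \<le> K"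
    and iL: "integrable L (\<lambda>x. x\<^sup>2)" and bL: "(LINT x|L. x\<^sup>2) \<le> K"
  shows "(\<lambda>n. LINT x|\<mu> n. max 0 x) \<longlonglongrightarrow> (LINT x|L. max 0 x)"
proof (rule LIMSEQ_I)
  fix e :: real assume e: "e > 0"
  have wc: "weak_conv_m \<mu> L" by (rule levy_continuity[OF \<mu> L ch])
  have K: "K \<ge> 0" by (rule order_trans[OF Bochner_Integration.integral_nonneg b\<mu>[of 0]]) simp
  \<comment> \<open>The truncation error \<open>K / R\<close> is then at most \<open>e / 4\<close>.\<close>
  define R where "R = 4 * (K + 1) / e"
  have R: "R > 0" using K e by (simp add: R_def)
  define f where "f x = min R (max 0 x)" for x
  have close: "\<bar>(LINT x|P. max 0 x) - (LINT x|P. f x)\<bar> \<le> e / 4"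
    if P: "real_distribution P" and i: "integrable P (\<lambda>x. x\<^sup>2)" and b: "(LINT x|P. x\<^sup>2) \<le> K" for P
  proof -
    interpret P: real_distribution P by fact
    have i1: "integrable P (\<lambda>x. max 0 x)"
    proof (rule Bochner_Integration.integrable_bound)
      show "integrable P (\<lambda>x. 1 + x\<^sup>2)" using i by simp
      have "\<bar>max 0 x\<bar> \<le> \<bar>1 + x\<^sup>2\<bar>" for x :: real
        using sum_power2_ge_zero[of "x - 1" 0] by (auto simp: max_def power2_eq_square algebra_simps)
      then show "AE x in P. norm (max 0 x) \<le> norm (1 + x\<^sup>2)" by simp
    qed simp
    have [measurable]: "f \<in> borel_measurable borel" unfolding f_def by measurable
    have i2: "integrable P f"
      by (rule P.integrable_const_bound[where B=R]) (use R in \<open>auto simp: f_def\<close>)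
    have "\<bar>(LINT x|P. max 0 x) - (LINT x|P. f x)\<bar> = \<bar>LINT x|P. max 0 x - f x\<bar>" using i1 i2 by simp
    also have "\<dots> \<le> (LINT x|P. \<bar>max 0 x - f x\<bar>)" by (rule integral_abs_bound)
    also have "\<dots> \<le> (LINT x|P. x\<^sup>2 / R)"
    proof (rule integral_mono)
      fix x :: real
      show "\<bar>max 0 x - f x\<bar> \<le> x\<^sup>2 / R"
      proof (cases "x > R")
        case True
        then have "x * R \<le> x * x" using R by (intro mult_left_mono) auto
        then have "x \<le> x\<^sup>2 / R" using R by (simp add: field_simps power2_eq_square)
        then show ?thesis using True R by (simp add: f_def)
      next
        case False
        then have "max 0 x - f x = 0" using R by (auto simp: f_def max_def min_def)
        then show ?thesis using R by simp
      qed
    qed (use i1 i2 i in auto)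
    also have "\<dots> = (LINT x|P. x\<^sup>2) / R" by simp
    also have "\<dots> \<le> (K + 1) / R" using b R by (intro divide_right_mono) auto
    also have "\<dots> = e / 4"
    proof -
      have "K + 1 \<noteq> 0" using K by linarith
      then show ?thesis using e unfolding R_def by (simp add: divide_simps)
    qed
    finally show ?thesis .
  qed
  have cont: "isCont f x" for x unfolding f_def by (intro continuous_intros)
  have "(\<lambda>n. LINT x|\<mu> n. f x) \<longlonglongrightarrow> (LINT x|L. f x)"
    by (rule weak_conv_imp_integral_bdd_continuous_conv[OF \<mu> L wc, where B=R]) (rule cont, use R in \<open>auto simp: f_def\<close>)
  from LIMSEQ_D[OF this, of "e / 4"] e obtain no where
    no: "\<And>n. n \<ge> no \<Longrightarrow> \<bar>(LINT x|\<mu> n. f x) - (LINT x|L. f x)\<bar> < e / 4" by auto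
  have "norm ((LINT x|\<mu> n. max 0 x) - (LINT x|L. max 0 x)) < e" if "n \<ge> no" for n
    using no[OF that] close[OF \<mu> i\<mu> b\<mu>, of n] close[OF L iL bL] e unfolding real_norm_def by linarith
  then show "\<exists>no. \<forall>n\<ge>no. norm ((LINT x|\<mu> n. max 0 x) - (LINT x|L. max 0 x)) < e" by blast
qed

text \<open>The drift \<open>\<beta> n\<close> is kept apart from the centred variable \<open>D n\<close>, since only the latter depends on
chance: its rescaled limit \<open>\<rho>\<close> shifts the Gaussian.\<close>

lemma pos_part_clt:
  fixes D :: "nat \<Rightarrow> 'b \<Rightarrow> real"
  assumes P: "\<And>n. prob_space (P n)" and Dm[measurable]: "\<And>n. D n \<in> borel_measurable (P n)"
    and sq: "\<And>n. integrable (P n) (\<lambda>\<omega>. (D n \<omega>)\<^sup>2)" and sqb: "\<And>n. (LINT \<omega>|P n. (D n \<omega>)\<^sup>2) \<le> K * real n"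
    and ch: "\<And>\<theta>. (\<lambda>n. LINT \<omega>|P n. iexp (\<theta> / sqrt (real n) * D n \<omega>)) \<longlonglongrightarrow> exp (- (\<theta>\<^sup>2 * V / 2))"
    and V: "V \<ge> 0" and \<beta>: "(\<lambda>n. \<beta> n / sqrt (real n)) \<longlonglongrightarrow> \<rho>"
  shows "(\<lambda>n. (LINT \<omega>|P n. max 0 (\<beta> n + D n \<omega>)) / sqrt (real n)) \<longlonglongrightarrow> Psi V (- \<rho>)"
proof -
  interpret P: prob_space "P n" for n by fact
  define Y where "Y n \<omega> = (\<beta> n + D n \<omega>) / sqrt (real n)" for n \<omega>
  have Ym[measurable]: "Y n \<in> borel_measurable (P n)" for n unfolding Y_def by measurable
  interpret G: real_distribution "gauss V" by (rule real_distribution_gauss)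
  let ?L = "distr (gauss V) borel (\<lambda>x. x + \<rho>)"
  obtain B where B: "\<And>n. norm (\<beta> n / sqrt (real n)) \<le> B"
    using convergent_imp_Bseq[OF convergentI[OF \<beta>]] by (auto simp: Bseq_def)
  have \<rho>B: "\<bar>\<rho>\<bar> \<le> B" using LIMSEQ_le_const2[OF tendsto_rabs[OF \<beta>], of B] B by auto
  have B0: "B \<ge> 0" using B[of 0] by simp
  have K: "0 \<le> K * real n" for n
    by (rule order_trans[OF Bochner_Integration.integral_nonneg sqb]) simp
  have K0: "K \<ge> 0" using K[of 1] by simp
  \<comment> \<open>One bound for the second moments of all rescaled variables and of the shifted Gaussian.\<close>
  define K' where "K' = 2 * B\<^sup>2 + 2 * K + 2 * V"
  have two: "(a + b)\<^sup>2 \<le> 2 * a\<^sup>2 + 2 * b\<^sup>2" for a b :: real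
    using zero_le_power2[of "a - b"] by (simp add: power2_sum power2_diff)
  have Y2: "(Y n \<omega>)\<^sup>2 \<le> 2 * B\<^sup>2 + 2 * (D n \<omega>)\<^sup>2 / real n" for n \<omega>
  proof -
    have "(Y n \<omega>)\<^sup>2 \<le> 2 * (\<beta> n / sqrt (real n))\<^sup>2 + 2 * (D n \<omega> / sqrt (real n))\<^sup>2"
      unfolding Y_def add_divide_distrib by (rule two)
    also have "(\<beta> n / sqrt (real n))\<^sup>2 \<le> B\<^sup>2" using B[of n] B0 by (simp add: abs_le_square_iff[symmetric])
    finally show ?thesis by (simp add: power_divide)
  qed
  have iY: "integrable (P n) (\<lambda>\<omega>. (Y n \<omega>)\<^sup>2)" for n
    by (rule Bochner_Integration.integrable_bound[where f="\<lambda>\<omega>. 2 * B\<^sup>2 + 2 * (D n \<omega>)\<^sup>2 / real n"])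
       (use sq Y2 in \<open>auto intro!: order_trans[OF Y2]\<close>)
  have bY: "(LINT \<omega>|P n. (Y n \<omega>)\<^sup>2) \<le> K'" for n
  proof -
    have "(LINT \<omega>|P n. (Y n \<omega>)\<^sup>2) \<le> (LINT \<omega>|P n. 2 * B\<^sup>2 + 2 * (D n \<omega>)\<^sup>2 / real n)"
      using sq iY Y2 by (intro integral_mono) auto
    also have "\<dots> = 2 * B\<^sup>2 + 2 * (LINT \<omega>|P n. (D n \<omega>)\<^sup>2) / real n"
      using sq by (simp add: P.prob_space)
    also have "\<dots> \<le> 2 * B\<^sup>2 + 2 * (K * real n) / real n"
      using sqb[of n] by (intro add_left_mono divide_right_mono) auto
    also have "\<dots> \<le> K'" using K0 V by (cases "n = 0") (auto simp: K'_def)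
    finally show ?thesis .
  qed
  have lim: "(\<lambda>n. LINT x|distr (P n) borel (Y n). max 0 x) \<longlonglongrightarrow> (LINT x|?L. max 0 x)"
  proof (rule weak_conv_pos_part[where K=K'])
    show "real_distribution (distr (P n) borel (Y n))" for n by (rule P.real_distribution_distr) simp
    show "real_distribution ?L" by (rule G.real_distribution_distr) simp
    show "integrable (distr (P n) borel (Y n)) (\<lambda>x. x\<^sup>2)" for n
      using iY by (subst integrable_distr_eq) auto
    show "(LINT x|distr (P n) borel (Y n). x\<^sup>2) \<le> K'" for n
      using bY by (subst integral_distr) auto
    have ig: "integrable (gauss V) (\<lambda>x. (x + \<rho>)\<^sup>2)"
      by (rule Bochner_Integration.integrable_bound[where f="\<lambda>x. 2 * x\<^sup>2 + 2 * \<rho>\<^sup>2"])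
         (use gauss_integrable_square[of V] two in \<open>auto intro!: order_trans[OF two]\<close>)
    then show "integrable ?L (\<lambda>x. x\<^sup>2)" by (subst integrable_distr_eq) auto
    have "(LINT x|?L. x\<^sup>2) = (LINT x|gauss V. (x + \<rho>)\<^sup>2)" by (subst integral_distr) auto
    also have "\<dots> \<le> (LINT x|gauss V. 2 * x\<^sup>2 + 2 * \<rho>\<^sup>2)"
      using ig gauss_integrable_square[of V] two by (intro integral_mono) auto
    also have "\<dots> = 2 * V + 2 * \<rho>\<^sup>2"
      using gauss_integrable_square[of V] gauss_second_moment[OF V] G.prob_space by simp
    also have "\<dots> \<le> K'"
    proof -
      have "\<rho>\<^sup>2 \<le> B\<^sup>2" using \<rho>B B0 by (simp add: abs_le_square_iff[symmetric])
      then show ?thesis using K0 by (simp add: K'_def)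
    qed
    finally show "(LINT x|?L. x\<^sup>2) \<le> K'" .
    fix t
    have 1: "char (distr (P n) borel (Y n)) t = iexp (t * (\<beta> n / sqrt (real n))) * (LINT \<omega>|P n. iexp (t / sqrt (real n) * D n \<omega>))" for n
    proof -
      have "char (distr (P n) borel (Y n)) t = (LINT \<omega>|P n. iexp (t * Y n \<omega>))"
        unfolding char_def by (subst integral_distr) auto
      also have "\<dots> = (LINT \<omega>|P n. iexp (t * (\<beta> n / sqrt (real n))) * iexp (t / sqrt (real n) * D n \<omega>))"
        by (intro Bochner_Integration.integral_cong refl)
           (simp add: Y_def exp_add[symmetric] distrib_left add_divide_distrib)
      finally show ?thesis by simp
    qed
    have 2: "char ?L t = iexp (t * \<rho>) * exp (- (t\<^sup>2 * V / 2))"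
    proof -
      have "char ?L t = (LINT x|gauss V. iexp (t * (x + \<rho>)))"
        unfolding char_def by (subst integral_distr) auto
      also have "\<dots> = (LINT x|gauss V. iexp (t * \<rho>) * iexp (t * x))"
        by (intro Bochner_Integration.integral_cong refl)
           (simp add: exp_add[symmetric] distrib_left add.commute)
      also have "\<dots> = iexp (t * \<rho>) * char (gauss V) t" by (simp add: char_def)
      finally show ?thesis using char_gauss[OF V, of t] by simp
    qed
    have c: "(\<lambda>n. iexp (t * (\<beta> n / sqrt (real n)))) \<longlonglongrightarrow> iexp (t * \<rho>)"
      by (intro isCont_tendsto_compose[OF isCont_iexp] tendsto_mult tendsto_const \<beta>)
    show "(\<lambda>n. char (distr (P n) borel (Y n)) t) \<longlonglongrightarrow> char ?L t"
      unfolding 1 2 by (rule tendsto_mult[OF c ch])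
  qed
  have "(LINT x|?L. max 0 x) = (LINT x|gauss V. max 0 (x - (- \<rho>)))"
    by (subst integral_distr) auto
  also have "\<dots> = Psi V (- \<rho>)" by (rule pos_part_integral_gauss[OF V])
  finally have "(LINT x|?L. max 0 x) = Psi V (- \<rho>)" .
  moreover have "(LINT x|distr (P n) borel (Y n). max 0 x) = (LINT \<omega>|P n. max 0 (\<beta> n + D n \<omega>)) / sqrt (real n)" for n
  proof -
    have "(LINT x|distr (P n) borel (Y n). max 0 x) = (LINT \<omega>|P n. max 0 (Y n \<omega>))"
      by (subst integral_distr) auto
    also have "\<dots> = (LINT \<omega>|P n. max 0 (\<beta> n + D n \<omega>) / sqrt (real n))"
      by (intro Bochner_Integration.integral_cong refl) (simp add: Y_def max_divide_distrib_right)
    finally show ?thesis by simp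
  qed
  ultimately show ?thesis using lim by simp
qed

section \<open>Random walks with finitely supported steps\<close>

lemma expectation_pair_pmf_finite:
  fixes f :: "_ \<Rightarrow> 'c::{banach, second_countable_topology}"
  assumes p: "finite (set_pmf p)" and q: "finite (set_pmf q)"
  shows "measure_pmf.expectation (pair_pmf p q) f =
    measure_pmf.expectation p (\<lambda>x. measure_pmf.expectation q (\<lambda>y. f (x, y)))"
proof -
  have "measure_pmf.expectation (pair_pmf p q) f =
      (\<Sum>z\<in>set_pmf p \<times> set_pmf q. pmf (pair_pmf p q) z *\<^sub>R f z)"
    using p q by (intro integral_measure_pmf) auto
  also have "\<dots> = (\<Sum>x\<in>set_pmf p. \<Sum>y\<in>set_pmf q. (pmf p x * pmf q y) *\<^sub>R f (x, y))"
    unfolding sum.cartesian_product by (intro sum.cong refl) (auto simp: pmf_pair)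
  also have "\<dots> = (\<Sum>x\<in>set_pmf p. pmf p x *\<^sub>R (\<Sum>y\<in>set_pmf q. pmf q y *\<^sub>R f (x, y)))"
    by (simp add: scaleR_sum_right)
  also have "\<dots> = measure_pmf.expectation p (\<lambda>x. \<Sum>y\<in>set_pmf q. pmf q y *\<^sub>R f (x, y))"
    using p by (intro integral_measure_pmf[symmetric]) auto
  also have "(\<lambda>x. \<Sum>y\<in>set_pmf q. pmf q y *\<^sub>R f (x, y)) = (\<lambda>x. measure_pmf.expectation q (\<lambda>y. f (x, y)))"
    using q by (intro ext integral_measure_pmf[symmetric]) auto
  finally show ?thesis .
qed

text \<open>The first \<open>K\<close> steps of the walk. The support is finite, so that every function of the steps is integrable.\<close>

definition steps :: "int pmf \<Rightarrow> nat \<Rightarrow> (nat \<Rightarrow> int) pmf" where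
  "steps p K = Pi_pmf {..<K} 0 (\<lambda>_. p)"

lemma finite_set_pmf_steps: "finite (set_pmf p) \<Longrightarrow> finite (set_pmf (steps p K))"
  unfolding steps_def by (subst set_Pi_pmf) (auto intro!: finite_PiE_dflt)

lemma expectation_prod_steps:
  fixes f :: "nat \<Rightarrow> int \<Rightarrow> 'b::{real_normed_field, banach, second_countable_topology}"
  assumes p: "finite (set_pmf p)" and B: "B \<subseteq> {..<K}"
  shows "measure_pmf.expectation (steps p K) (\<lambda>\<xi>. \<Prod>l\<in>B. f l (\<xi> l)) = (\<Prod>l\<in>B. measure_pmf.expectation p (f l))"
proof -
  have fin: "finite B" using B finite_subset by blast
  have "prob_space.indep_vars (measure_pmf (steps p K)) (\<lambda>_. count_space UNIV) (\<lambda>l \<xi>. \<xi> l) B"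
    unfolding steps_def
    by (rule prob_space.indep_vars_subset[OF measure_pmf.prob_space_axioms  indep_vars_Pi_pmf B]) simp
  then have "prob_space.indep_vars (measure_pmf (steps p K)) (\<lambda>_. borel) (\<lambda>l \<xi>. f l (\<xi> l)) B"
    by (rule prob_space.indep_vars_compose2[OF measure_pmf.prob_space_axioms]) simp
  then have "measure_pmf.expectation (steps p K) (\<lambda>\<xi>. \<Prod>l\<in>B. f l (\<xi> l)) =
      (\<Prod>l\<in>B. measure_pmf.expectation (steps p K) (\<lambda>\<xi>. f l (\<xi> l)))"
    using fin by (intro prob_space.indep_vars_lebesgue_integral[OF measure_pmf.prob_space_axioms])
      (auto intro!: integrable_measure_pmf_finite finite_set_pmf_steps p)
  also have "\<dots> = (\<Prod>l\<in>B. measure_pmf.expectation p (f l))"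
  proof (rule prod.cong[OF refl])
    fix l assume l: "l \<in> B"
    have "measure_pmf.expectation (steps p K) (\<lambda>\<xi>. f l (\<xi> l)) =
        measure_pmf.expectation (map_pmf (\<lambda>\<xi>. \<xi> l) (steps p K)) (f l)" by simp
    also have "map_pmf (\<lambda>\<xi>. \<xi> l) (steps p K) = p"
      unfolding steps_def using l B by (subst Pi_pmf_component) auto
    finally show "measure_pmf.expectation (steps p K) (\<lambda>\<xi>. f l (\<xi> l)) = measure_pmf.expectation p (f l)" .
  qed
  finally show ?thesis .
qed

locale finite_steps =
  fixes p :: "int pmf" and v s2 :: real
  assumes finite_p: "finite (set_pmf p)"
    and mean_p: "measure_pmf.expectation p (\<lambda>x. real_of_int x - v) = 0"
    and var_p: "measure_pmf.expectation p (\<lambda>x. (real_of_int x - v)\<^sup>2) = s2"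
begin

lemma s2_nonneg: "s2 \<ge> 0"
  unfolding var_p[symmetric] by (rule Bochner_Integration.integral_nonneg) simp

lemma integrable_p[simp]: "integrable (measure_pmf p) f" for f :: "int \<Rightarrow> 'c::{banach, second_countable_topology}"
  by (rule integrable_measure_pmf_finite[OF finite_p])

lemma integrable_steps[simp]: "integrable (measure_pmf (steps p K)) f"
  for f :: "(nat \<Rightarrow> int) \<Rightarrow> 'c::{banach, second_countable_topology}"
  by (intro integrable_measure_pmf_finite finite_set_pmf_steps finite_p)

definition \<phi> :: "real \<Rightarrow> complex" where
  "\<phi> \<theta> = measure_pmf.expectation p (\<lambda>x. iexp (\<theta> * (real_of_int x - v)))"

definition csum :: "nat set \<Rightarrow> (nat \<Rightarrow> int) \<Rightarrow> real" where
  "csum B \<xi> = (\<Sum>l\<in>B. real_of_int (\<xi> l) - v)"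

lemma char_csum:
  assumes B: "B \<subseteq> {..<K}"
  shows "measure_pmf.expectation (steps p K) (\<lambda>\<xi>. iexp (\<theta> * csum B \<xi>)) = \<phi> \<theta> ^ card B"
proof -
  have fin: "finite B" using B finite_subset by blast
  have "measure_pmf.expectation (steps p K) (\<lambda>\<xi>. iexp (\<theta> * csum B \<xi>)) =
      measure_pmf.expectation (steps p K) (\<lambda>\<xi>. \<Prod>l\<in>B. iexp (\<theta> * (real_of_int (\<xi> l) - v)))"
    by (simp add: csum_def sum_distrib_left exp_sum[OF fin])
  also have "\<dots> = (\<Prod>l\<in>B. \<phi> \<theta>)"
    unfolding \<phi>_def by (rule expectation_prod_steps[OF finite_p B])
  finally show ?thesis by simp
qed

lemma second_moment_csum:
  assumes B: "B \<subseteq> {..<K}"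
  shows "measure_pmf.expectation (steps p K) (\<lambda>\<xi>. (csum B \<xi>)\<^sup>2) = s2 * real (card B)"
proof -
  have fin: "finite B" using B finite_subset by blast
  have e: "measure_pmf.expectation (steps p K) (\<lambda>\<xi>. (real_of_int (\<xi> l) - v) * (real_of_int (\<xi> m) - v)) =
      (if l = m then s2 else 0)" if "l \<in> B" "m \<in> B" for l m
  proof (cases "l = m")
    case True
    then show ?thesis
      using expectation_prod_steps[OF finite_p, of "{l}" K "\<lambda>_ x. (real_of_int x - v)\<^sup>2"] that B var_p
      by (auto simp: power2_eq_square)
  next
    case False
    then show ?thesis
      using expectation_prod_steps[OF finite_p, of "{l, m}" K "\<lambda>_ x. real_of_int x - v"] that B mean_p by auto
  qed
  have "measure_pmf.expectation (steps p K) (\<lambda>\<xi>. (csum B \<xi>)\<^sup>2) =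
     (\<Sum>l\<in>B. \<Sum>m\<in>B. measure_pmf.expectation (steps p K) (\<lambda>\<xi>. (real_of_int (\<xi> l) - v) * (real_of_int (\<xi> m) - v)))"
    unfolding csum_def power2_eq_square sum_product by (simp add: Bochner_Integration.integral_sum)
  also have "\<dots> = (\<Sum>l\<in>B. \<Sum>m\<in>B. if l = m then s2 else 0)"
    by (intro sum.cong refl) (simp add: e)
  also have "\<dots> = s2 * real (card B)" using fin by (simp add: sum.delta)
  finally show ?thesis .
qed

lemma norm_\<phi>: "norm (\<phi> \<theta>) \<le> 1"
proof -
  have "norm (\<phi> \<theta>) \<le> measure_pmf.expectation p (\<lambda>x. norm (iexp (\<theta> * (real_of_int x - v))))"
    unfolding \<phi>_def by (rule integral_norm_bound)
  then show ?thesis by simp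
qed

text \<open>Taylor expansion of order two; the linear term vanishes because the steps are centred.\<close>

lemma \<phi>_approx:
  "norm (\<phi> \<theta> - (1 - complex_of_real (\<theta>\<^sup>2 * s2 / 2))) \<le> \<bar>\<theta>\<bar> ^ 3 * measure_pmf.expectation p (\<lambda>x. \<bar>real_of_int x - v\<bar> ^ 3)"
proof -
  let ?y = "\<lambda>x. real_of_int x - v"
  have 1: "measure_pmf.expectation p (\<lambda>x. 1 + \<i> * of_real \<theta> * of_real (?y x) - of_real (\<theta>\<^sup>2 / 2) * of_real ((?y x)\<^sup>2))
     = 1 - of_real (\<theta>\<^sup>2 * s2 / 2)"
  proof -
    have "measure_pmf.expectation p (\<lambda>x. 1 + \<i> * of_real \<theta> * of_real (?y x) - of_real (\<theta>\<^sup>2 / 2) * of_real ((?y x)\<^sup>2))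
      = measure_pmf.expectation p (\<lambda>x. 1 + \<i> * of_real \<theta> * of_real (?y x)) - of_real (\<theta>\<^sup>2 / 2) * of_real (measure_pmf.expectation p (\<lambda>x. (?y x)\<^sup>2))"
      by (subst Bochner_Integration.integral_diff) (simp_all only: integrable_p integral_mult_right_zero integral_complex_of_real)
    also have "measure_pmf.expectation p (\<lambda>x. 1 + \<i> * of_real \<theta> * of_real (?y x)) =
        1 + \<i> * of_real \<theta> * of_real (measure_pmf.expectation p ?y)"
      by (subst Bochner_Integration.integral_add) (simp_all only: integrable_p integral_mult_right_zero integral_complex_of_real, simp)
    finally show ?thesis by (simp add: mean_p var_p)
  qed
  have "norm (\<phi> \<theta> - (1 - complex_of_real (\<theta>\<^sup>2 * s2 / 2))) = norm (measure_pmf.expectation p (\<lambda>x. iexp (\<theta> * ?y x) -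
      (1 + \<i> * of_real \<theta> * of_real (?y x) - of_real (\<theta>\<^sup>2 / 2) * of_real ((?y x)\<^sup>2))))"
    unfolding \<phi>_def 1[symmetric]
    by (rule arg_cong[where f=norm], rule Bochner_Integration.integral_diff[symmetric]) simp_all
  also have "\<dots> \<le> measure_pmf.expectation p (\<lambda>x. norm (iexp (\<theta> * ?y x) -
      (1 + \<i> * of_real \<theta> * of_real (?y x) - of_real (\<theta>\<^sup>2 / 2) * of_real ((?y x)\<^sup>2))))"
    by (rule integral_norm_bound)
  also have "\<dots> \<le> measure_pmf.expectation p (\<lambda>x. \<bar>\<theta>\<bar> ^ 3 * \<bar>?y x\<bar> ^ 3)"
  proof (rule integral_mono)
    fix x
    have S: "(\<Sum>k\<le>2. (\<i> * complex_of_real (\<theta> * ?y x)) ^ k / fact k) =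
        1 + \<i> * of_real \<theta> * of_real (?y x) - of_real (\<theta>\<^sup>2 / 2) * of_real ((?y x)\<^sup>2)"
    proof -
      have "{..2::nat} = {0, 1, 2}" by auto
      then have "(\<Sum>k\<le>2. (\<i> * complex_of_real w) ^ k / fact k) = 1 + \<i> * of_real w - of_real (w\<^sup>2) / 2" for w
        by (simp add: power_mult_distrib fact_numeral)
      from this[of "\<theta> * ?y x"] show ?thesis unfolding of_real_mult power_mult_distrib by simp
    qed
    have "norm (iexp (\<theta> * ?y x) - (1 + \<i> * of_real \<theta> * of_real (?y x) - of_real (\<theta>\<^sup>2 / 2) * of_real ((?y x)\<^sup>2)))
       \<le> \<bar>\<theta> * ?y x\<bar> ^ Suc 2 / fact (Suc 2)"
      using iexp_approx1[of "\<theta> * ?y x" 2] unfolding S .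
    also have "\<dots> \<le> \<bar>\<theta> * ?y x\<bar> ^ 3 / 1"
    proof (rule frac_le)
      show "\<bar>\<theta> * ?y x\<bar> ^ Suc 2 \<le> \<bar>\<theta> * ?y x\<bar> ^ 3" by (simp only: eval_nat_numeral order_refl)
      show "(1::real) \<le> fact (Suc 2)" by (rule fact_ge_1)
    qed simp_all
    finally show "norm (iexp (\<theta> * ?y x) - (1 + \<i> * of_real \<theta> * of_real (?y x) - of_real (\<theta>\<^sup>2 / 2) * of_real ((?y x)\<^sup>2)))
      \<le> \<bar>\<theta>\<bar> ^ 3 * \<bar>?y x\<bar> ^ 3"
      by (simp add: abs_mult power_mult_distrib)
  qed simp_all
  finally show ?thesis by simp
qed

text \<open>Compare \<open>\<phi> (\<theta> / sqrt n)\<close> with \<open>exp (- \<theta>\<^sup>2 * s2 / (2 * n))\<close>: they differ by \<open>O (n powr (-3/2))\<close>, and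
taking powers of numbers in the unit disc multiplies the difference at most by the exponent, which is \<open>O n\<close>.\<close>

lemma \<phi>_power_limit:
  assumes m: "(\<lambda>n. real (m n) / real n) \<longlonglongrightarrow> t"
  shows "(\<lambda>n. \<phi> (\<theta> / sqrt (real n)) ^ m n) \<longlonglongrightarrow> exp (- (\<theta>\<^sup>2 * (s2 * t) / 2))"
proof -
  define c where "c = measure_pmf.expectation p (\<lambda>x. \<bar>real_of_int x - v\<bar> ^ 3)"
  define u where "u n = \<theta>\<^sup>2 * s2 / 2 / real n" for n
  have u0: "u n \<ge> 0" for n using s2_nonneg by (simp add: u_def)
  have eu: "\<bar>exp (- u n) - (1 - u n)\<bar> \<le> (u n)\<^sup>2" for n
  proof -
    \<comment> \<open>The product is \<open>1 + (u n) ^ 3\<close>, so that the quadratic bounds \<open>1 / (1 + u n)\<close> from above.\<close>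
    have "1 * 1 \<le> (1 - u n + (u n)\<^sup>2) * (1 + u n)"
      using u0[of n] by (simp add: power2_eq_square algebra_simps)
    also have "\<dots> \<le> (1 - u n + (u n)\<^sup>2) * exp (u n)"
    proof (rule mult_left_mono[OF exp_ge_add_one_self])
      have "0 \<le> (1 - u n)\<^sup>2 + u n" using u0[of n] by simp
      then show "0 \<le> 1 - u n + (u n)\<^sup>2" by (simp add: power2_eq_square algebra_simps)
    qed
    finally have "exp (- u n) \<le> 1 - u n + (u n)\<^sup>2" by (simp add: exp_minus field_simps)
    moreover have "exp (- u n) \<ge> 1 - u n" using exp_ge_add_one_self[of "- u n"] by simp
    ultimately show ?thesis by simp
  qed
  have bound: "norm (\<phi> (\<theta> / sqrt (real n)) ^ m n - of_real (exp (- u n)) ^ m n) \<le>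
     (real (m n) / real n) * (\<bar>\<theta>\<bar> ^ 3 * c / sqrt (real n) + (\<theta>\<^sup>2 * s2 / 2)\<^sup>2 / real n)" if "n > 0" for n
  proof -
    have "norm (\<phi> (\<theta> / sqrt (real n)) - of_real (exp (- u n))) \<le>
        norm (\<phi> (\<theta> / sqrt (real n)) - (1 - of_real (u n))) + norm (complex_of_real (exp (- u n)) - (1 - of_real (u n)))"
      by (metis norm_minus_commute norm_triangle_ineq diff_add_cancel add_diff_eq)
    also have "norm (\<phi> (\<theta> / sqrt (real n)) - (1 - of_real (u n))) \<le> \<bar>\<theta> / sqrt (real n)\<bar> ^ 3 * c"
    proof -
      have "(\<theta> / sqrt (real n))\<^sup>2 * s2 / 2 = u n" using that by (simp add: u_def power_divide)
      then show ?thesis using \<phi>_approx[of "\<theta> / sqrt (real n)"] by (simp add: c_def)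
    qed
    also have "\<bar>\<theta> / sqrt (real n)\<bar> ^ 3 * c = \<bar>\<theta>\<bar> ^ 3 * c / sqrt (real n) / real n"
      using that by (simp add: power_divide power3_eq_cube)
    also have "norm (complex_of_real (exp (- u n)) - (1 - of_real (u n))) \<le> (u n)\<^sup>2"
      using eu[of n] by (metis norm_of_real of_real_1 of_real_diff)
    also have "(u n)\<^sup>2 = (\<theta>\<^sup>2 * s2 / 2)\<^sup>2 / real n / real n"
      by (simp add: u_def power_divide power2_eq_square)
    finally have 1: "norm (\<phi> (\<theta> / sqrt (real n)) - of_real (exp (- u n))) \<le>
       (\<bar>\<theta>\<bar> ^ 3 * c / sqrt (real n) + (\<theta>\<^sup>2 * s2 / 2)\<^sup>2 / real n) / real n"
      by (simp add: add_divide_distrib)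
    have "norm (\<phi> (\<theta> / sqrt (real n)) ^ m n - of_real (exp (- u n)) ^ m n) \<le>
        real (m n) * norm (\<phi> (\<theta> / sqrt (real n)) - of_real (exp (- u n)))"
      by (rule norm_power_diff) (use norm_\<phi> u0[of n] in auto)
    also have "\<dots> \<le> real (m n) * ((\<bar>\<theta>\<bar> ^ 3 * c / sqrt (real n) + (\<theta>\<^sup>2 * s2 / 2)\<^sup>2 / real n) / real n)"
      by (rule mult_left_mono[OF 1]) simp
    finally show ?thesis by simp
  qed
  have "(\<lambda>n. (real (m n) / real n) * (\<bar>\<theta>\<bar> ^ 3 * c / sqrt (real n) + (\<theta>\<^sup>2 * s2 / 2)\<^sup>2 / real n)) \<longlonglongrightarrow> t * (0 + 0)"
    by (intro tendsto_mult tendsto_add m) real_asymp+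
  then have "(\<lambda>n. (real (m n) / real n) * (\<bar>\<theta>\<bar> ^ 3 * c / sqrt (real n) + (\<theta>\<^sup>2 * s2 / 2)\<^sup>2 / real n)) \<longlonglongrightarrow> 0" by simp
  then have d0: "(\<lambda>n. \<phi> (\<theta> / sqrt (real n)) ^ m n - of_real (exp (- u n)) ^ m n) \<longlonglongrightarrow> 0"
    by (rule Lim_null_comparison[rotated]) (rule eventually_mono[OF eventually_gt_at_top[of 0] bound])
  have "(\<lambda>n. complex_of_real (exp (- (\<theta>\<^sup>2 * s2 / 2 * (real (m n) / real n))))) \<longlonglongrightarrow> of_real (exp (- (\<theta>\<^sup>2 * s2 / 2 * t)))"
    by (intro tendsto_of_real tendsto_exp tendsto_minus tendsto_mult tendsto_const m)
  moreover have "of_real (exp (- (\<theta>\<^sup>2 * s2 / 2 * (real (m n) / real n)))) = complex_of_real (exp (- u n)) ^ m n" for n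
    by (simp add: u_def exp_of_nat_mult[symmetric] of_real_power[symmetric] field_simps del: of_real_power)
  ultimately have "(\<lambda>n. complex_of_real (exp (- u n)) ^ m n) \<longlonglongrightarrow> of_real (exp (- (\<theta>\<^sup>2 * s2 / 2 * t)))"
    by simp
  from tendsto_add[OF d0 this] show ?thesis by (simp add: mult.assoc)
qed

end

text \<open>\<open>ptime t n\<close> is the number of steps at macroscopic time \<open>t\<close>, and \<open>plevel v (t, r) n\<close> is the integer level such
that a walk is at most at the observation point \<open>(t, r)\<close> iff it is at most at this level (\<open>le_plevel_iff\<close>).\<close>

definition ptime :: "real \<Rightarrow> nat \<Rightarrow> nat" where "ptime t n = nat \<lfloor>real n * t\<rfloor>"

definition plevel :: "real \<Rightarrow> real \<times> real \<Rightarrow> nat \<Rightarrow> int" where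
  "plevel v = (\<lambda>(t, r) n. \<lfloor>real n * t * v\<rfloor> + \<lfloor>r * sqrt (real n)\<rfloor>)"

lemma ptime_le: "t \<ge> 0 \<Longrightarrow> real (ptime t n) \<le> t * real n"
  unfolding ptime_def by (simp add: mult.commute of_nat_floor)

lemma ptime_ge: "t \<ge> 0 \<Longrightarrow> t * real n - 1 \<le> real (ptime t n)"
  unfolding ptime_def by (simp add: mult.commute)

lemma ptime_mono: "0 \<le> s \<Longrightarrow> s \<le> t \<Longrightarrow> ptime s n \<le> ptime t n"
  unfolding ptime_def by (intro nat_mono floor_mono mult_left_mono) auto

lemma ptime_lim:
  assumes "t \<ge> 0" shows "(\<lambda>n. real (ptime t n) / real n) \<longlonglongrightarrow> t"
proof (rule tendsto_sandwich[where f="\<lambda>n. t - 1 / real n" and h="\<lambda>_. t"])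
  show "\<forall>\<^sub>F n in sequentially. t - 1 / real n \<le> real (ptime t n) / real n"
    using eventually_gt_at_top[of 0]
  proof eventually_elim
    case (elim n)
    have "(t * real n - 1) / real n \<le> real (ptime t n) / real n"
      by (intro divide_right_mono ptime_ge[OF assms]) simp
    then show ?case using elim by (simp add: diff_divide_distrib)
  qed
  show "\<forall>\<^sub>F n in sequentially. real (ptime t n) / real n \<le> t"
    using eventually_gt_at_top[of 0] by eventually_elim (use ptime_le[OF assms] in \<open>auto simp: field_simps\<close>)
  show "(\<lambda>n. t - 1 / real n) \<longlonglongrightarrow> t" by real_asymp
qed simp

lemma plevel_centered_lim:
  assumes "t \<ge> 0"
  shows "(\<lambda>n. (real_of_int (plevel v (t, r) n) - v * real (ptime t n)) / sqrt (real n)) \<longlonglongrightarrow> r"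
proof (rule Lim_transform2)
  show "(\<lambda>n::nat. r * (sqrt (real n) / sqrt (real n))) \<longlonglongrightarrow> r" by real_asymp
  show "(\<lambda>n. r * (sqrt (real n) / sqrt (real n)) - (real_of_int (plevel v (t, r) n) - v * real (ptime t n)) / sqrt (real n)) \<longlonglongrightarrow> 0"
  proof (rule Lim_null_comparison)
    show "(\<lambda>n::nat. (2 + \<bar>v\<bar>) / sqrt (real n)) \<longlonglongrightarrow> 0" by real_asymp
    show "\<forall>\<^sub>F n in sequentially. norm (r * (sqrt (real n) / sqrt (real n)) - (real_of_int (plevel v (t, r) n) - v * real (ptime t n)) / sqrt (real n)) \<le> (2 + \<bar>v\<bar>) / sqrt (real n)"
    proof (intro always_eventually allI)
      fix n
      have "\<bar>v * (t * real n - real (ptime t n))\<bar> \<le> \<bar>v\<bar> * 1"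
        unfolding abs_mult using ptime_le[OF assms, of n] ptime_ge[OF assms, of n] by (intro mult_left_mono) auto
      moreover have "v * (t * real n - real (ptime t n)) = real n * t * v - v * real (ptime t n)"
        by (simp add: algebra_simps)
      moreover have "\<bar>real n * t * v - real_of_int \<lfloor>real n * t * v\<rfloor>\<bar> \<le> 1" by linarith
      moreover have "\<bar>r * sqrt (real n) - real_of_int \<lfloor>r * sqrt (real n)\<rfloor>\<bar> \<le> 1" by linarith
      ultimately have "\<bar>r * sqrt (real n) - (real_of_int (plevel v (t, r) n) - v * real (ptime t n))\<bar> \<le> 2 + \<bar>v\<bar>"
        unfolding plevel_def by (simp add: abs_le_iff) linarith
      then have "\<bar>r * sqrt (real n) - (real_of_int (plevel v (t, r) n) - v * real (ptime t n))\<bar> / sqrt (real n) \<le> (2 + \<bar>v\<bar>) / sqrt (real n)"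
        by (rule divide_right_mono) simp
      then show "norm (r * (sqrt (real n) / sqrt (real n)) - (real_of_int (plevel v (t, r) n) - v * real (ptime t n)) / sqrt (real n)) \<le> (2 + \<bar>v\<bar>) / sqrt (real n)"
        unfolding times_divide_eq_right diff_divide_distrib[symmetric] real_norm_def abs_divide by simp
    qed
  qed
qed

lemma le_plevel_iff:
  "real_of_int y \<le> real_of_int \<lfloor>real n * t * v\<rfloor> + r * sqrt (real n) \<longleftrightarrow> y \<le> plevel v (t, r) n"
proof -
  have "real_of_int y \<le> real_of_int \<lfloor>real n * t * v\<rfloor> + r * sqrt (real n) \<longleftrightarrow>
      real_of_int (y - \<lfloor>real n * t * v\<rfloor>) \<le> r * sqrt (real n)" by auto
  also have "\<dots> \<longleftrightarrow> y - \<lfloor>real n * t * v\<rfloor> \<le> \<lfloor>r * sqrt (real n)\<rfloor>" by (rule le_floor_iff[symmetric])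
  finally show ?thesis by (auto simp: plevel_def)
qed

context finite_steps
begin

text \<open>The sign \<open>\<sigma>\<close> and the set \<open>B n\<close> of steps allow one statement to serve the walk, its reflection, and the
increment of the walk between two times in either order.\<close>

lemma signed_pos_part_limit:
  assumes B: "\<And>n. B n \<subseteq> {..<K n}" and card: "(\<lambda>n. real (card (B n)) / real n) \<longlonglongrightarrow> \<tau>"
    and C: "\<And>n. real (card (B n)) \<le> C * real n" and \<sigma>: "\<sigma>\<^sup>2 = 1"
    and \<beta>: "(\<lambda>n. \<beta> n / sqrt (real n)) \<longlonglongrightarrow> \<rho>" and \<tau>: "\<tau> \<ge> 0"
  shows "(\<lambda>n. measure_pmf.expectation (steps p (K n)) (\<lambda>\<xi>. max 0 (\<beta> n + \<sigma> * csum (B n) \<xi>)) / sqrt (real n))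
    \<longlonglongrightarrow> Psi (s2 * \<tau>) (- \<rho>)"
proof (rule pos_part_clt[where D="\<lambda>n \<xi>. \<sigma> * csum (B n) \<xi>" and K="s2 * C"])
  show "prob_space (measure_pmf (steps p (K n)))" for n by (rule measure_pmf.prob_space_axioms)
  show "measure_pmf.expectation (steps p (K n)) (\<lambda>\<xi>. (\<sigma> * csum (B n) \<xi>)\<^sup>2) \<le> s2 * C * real n" for n
    using mult_left_mono[OF C[of n] s2_nonneg]
    by (simp add: power_mult_distrib \<sigma> second_moment_csum[OF B] mult.assoc)
  show "(\<lambda>n. measure_pmf.expectation (steps p (K n)) (\<lambda>\<xi>. iexp (\<theta> / sqrt (real n) * (\<sigma> * csum (B n) \<xi>))))
      \<longlonglongrightarrow> exp (- (\<theta>\<^sup>2 * (s2 * \<tau>) / 2))" for \<theta>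
  proof -
    have "measure_pmf.expectation (steps p (K n)) (\<lambda>\<xi>. iexp (\<theta> / sqrt (real n) * (\<sigma> * csum (B n) \<xi>))) =
        \<phi> (\<theta> * \<sigma> / sqrt (real n)) ^ card (B n)" for n
      using char_csum[OF B, where \<theta>="\<theta> * \<sigma> / sqrt (real n)"] by (simp only: mult.assoc times_divide_eq_left)
    moreover have "(\<lambda>n. \<phi> (\<theta> * \<sigma> / sqrt (real n)) ^ card (B n)) \<longlonglongrightarrow> exp (- ((\<theta> * \<sigma>)\<^sup>2 * (s2 * \<tau>) / 2))"
      by (rule \<phi>_power_limit[OF card])
    ultimately show ?thesis by (simp add: power_mult_distrib \<sigma>)
  qed
qed (use s2_nonneg \<tau> \<beta> in auto)

text \<open>A walk started at \<open>x\<close> with steps \<open>\<xi>\<close> is at most at level \<open>plevel v i n\<close> iff \<open>x \<le> excess i n \<xi>\<close>.\<close>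

definition excess :: "real \<times> real \<Rightarrow> nat \<Rightarrow> (nat \<Rightarrow> int) \<Rightarrow> int" where
  "excess i n \<xi> = plevel v i n - (\<Sum>l<ptime (fst i) n. \<xi> l)"

lemma excess_eq: "real_of_int (excess i n \<xi>) = (real_of_int (plevel v i n) - v * real (ptime (fst i) n)) - csum {..<ptime (fst i) n} \<xi>"
  by (simp add: excess_def csum_def sum_subtractf)

lemma excess_pos_limit:
  assumes "fst i \<ge> 0" and K: "\<And>n. ptime (fst i) n \<le> K n"
  shows "(\<lambda>n. measure_pmf.expectation (steps p (K n)) (\<lambda>\<xi>. max 0 (real_of_int (excess i n \<xi>))) / sqrt (real n))
     \<longlonglongrightarrow> Psi (s2 * fst i) (- snd i)"
  using signed_pos_part_limit[where B="\<lambda>n. {..<ptime (fst i) n}" and K=K and C="fst i" and \<sigma>="-1", OF _ _ _ _ plevel_centered_lim[OF assms(1), of v "snd i"]]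
    ptime_lim[OF assms(1)] ptime_le[OF assms(1)] assms
  by (simp add: excess_eq)

lemma excess_neg_limit:
  assumes "fst i \<ge> 0" and K: "\<And>n. ptime (fst i) n \<le> K n"
  shows "(\<lambda>n. measure_pmf.expectation (steps p (K n)) (\<lambda>\<xi>. max 0 (- real_of_int (excess i n \<xi>))) / sqrt (real n))
     \<longlonglongrightarrow> Psi (s2 * fst i) (snd i)"
proof -
  define \<beta> where "\<beta> n = - (real_of_int (plevel v i n) - v * real (ptime (fst i) n))" for n
  have e: "- real_of_int (excess i n \<xi>) = \<beta> n + 1 * csum {..<ptime (fst i) n} \<xi>" for n \<xi>
    by (simp add: excess_eq \<beta>_def)
  have \<beta>: "(\<lambda>n. \<beta> n / sqrt (real n)) \<longlonglongrightarrow> - snd i"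
    using tendsto_minus[OF plevel_centered_lim[OF assms(1), of v "snd i"]] by (simp only: \<beta>_def minus_divide_left prod.collapse)
  have "(\<lambda>n. measure_pmf.expectation (steps p (K n)) (\<lambda>\<xi>. max 0 (\<beta> n + 1 * csum {..<ptime (fst i) n} \<xi>)) / sqrt (real n))
     \<longlonglongrightarrow> Psi (s2 * fst i) (- (- snd i))"
    by (rule signed_pos_part_limit[where C="fst i", OF _ _ _ _ \<beta>])
       (use ptime_lim[OF assms(1)] ptime_le[OF assms(1)] assms in auto)
  then show ?thesis unfolding e by simp
qed

lemma csum_diff: "m \<le> k \<Longrightarrow> csum {..<k} \<xi> - csum {..<m} \<xi> = csum {m..<k} \<xi>"
  unfolding csum_def by (subst sum.atLeastLessThan_concat[of 0 m k, symmetric, simplified atLeast0LessThan]) auto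

text \<open>The steps up to the earlier time cancel, which leaves about \<open>\<bar>fst j - fst i\<bar> * n\<close> steps.\<close>

lemma excess_same_limit:
  assumes i: "fst i \<ge> 0" and j: "fst j \<ge> 0" and Ki: "\<And>n. ptime (fst i) n \<le> K n" and Kj: "\<And>n. ptime (fst j) n \<le> K n"
  shows "(\<lambda>n. measure_pmf.expectation (steps p (K n)) (\<lambda>\<xi>. max 0 (real_of_int (excess i n \<xi>) - real_of_int (excess j n \<xi>))) / sqrt (real n))
     \<longlonglongrightarrow> Psi (s2 * \<bar>fst j - fst i\<bar>) (snd j - snd i)"
proof -
  define \<beta> where "\<beta> n = (real_of_int (plevel v i n) - v * real (ptime (fst i) n)) - (real_of_int (plevel v j n) - v * real (ptime (fst j) n))" for n
  have \<beta>: "(\<lambda>n. \<beta> n / sqrt (real n)) \<longlonglongrightarrow> snd i - snd j"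
    unfolding \<beta>_def diff_divide_distrib[of "real_of_int (plevel v i _) - _"]
    using plevel_centered_lim[OF i, of v "snd i"] plevel_centered_lim[OF j, of v "snd j"] by (intro tendsto_diff) simp_all
  have key: "(\<lambda>n. real (card {ptime s n..<ptime t n}) / real n) \<longlonglongrightarrow> t - s"
    "real (card {ptime s n..<ptime t n}) \<le> t * real n" if "0 \<le> s" "s \<le> t" for s t n
  proof -
    have "(\<lambda>n. real (ptime t n) / real n - real (ptime s n) / real n) \<longlonglongrightarrow> t - s"
      using that by (intro tendsto_diff ptime_lim) auto
    then show "(\<lambda>n. real (card {ptime s n..<ptime t n}) / real n) \<longlonglongrightarrow> t - s"
      using ptime_mono[OF that] by (simp add: of_nat_diff diff_divide_distrib)
    show "real (card {ptime s n..<ptime t n}) \<le> t * real n"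
      using ptime_le[of t n] ptime_mono[OF that, of n] that by (simp add: of_nat_diff)
  qed
  show ?thesis
  proof (cases "fst i \<le> fst j")
    case True
    have e: "real_of_int (excess i n \<xi>) - real_of_int (excess j n \<xi>) = \<beta> n + 1 * csum {ptime (fst i) n..<ptime (fst j) n} \<xi>" for n \<xi>
      using csum_diff[OF ptime_mono[OF i True], of n \<xi>] by (simp add: excess_eq \<beta>_def)
    show ?thesis unfolding e
      using signed_pos_part_limit[where B="\<lambda>n. {ptime (fst i) n..<ptime (fst j) n}" and K=K and C="fst j" and \<sigma>=1, OF _ key(1)[OF i True] key(2)[OF i True] _ \<beta>]
        True Kj by (force simp: subset_iff intro: less_le_trans)
  next
    case False
    then have ji: "fst j \<le> fst i" by simp
    have e: "real_of_int (excess i n \<xi>) - real_of_int (excess j n \<xi>) = \<beta> n + (-1) * csum {ptime (fst j) n..<ptime (fst i) n} \<xi>" for n \<xi>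
      using csum_diff[OF ptime_mono[OF j ji], of n \<xi>] by (simp add: excess_eq \<beta>_def)
    show ?thesis unfolding e
      using signed_pos_part_limit[where B="\<lambda>n. {ptime (fst j) n..<ptime (fst i) n}" and K=K and C="fst i" and \<sigma>="-1", OF _ key(1)[OF j ji] key(2)[OF j ji] _ \<beta>]
        ji Ki by (force simp: subset_iff intro: less_le_trans)
  qed
qed

text \<open>For independent copies nothing cancels, the characteristic function is the product of those of both walks,
and the variances add up.\<close>

lemma excess_independent_limit:
  assumes i: "fst i \<ge> 0" and j: "fst j \<ge> 0" and Ki: "\<And>n. ptime (fst i) n \<le> K n" and Kj: "\<And>n. ptime (fst j) n \<le> K n"
  shows "(\<lambda>n. measure_pmf.expectation (pair_pmf (steps p (K n)) (steps p (K n)))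
        (\<lambda>(\<xi>, \<xi>'). max 0 (real_of_int (excess i n \<xi>) - real_of_int (excess j n \<xi>'))) / sqrt (real n))
     \<longlonglongrightarrow> Psi (s2 * (fst j + fst i)) (snd j - snd i)"
proof -
  let ?P = "\<lambda>n. measure_pmf (pair_pmf (steps p (K n)) (steps p (K n)))"
  define \<beta> where "\<beta> n = (real_of_int (plevel v i n) - v * real (ptime (fst i) n)) - (real_of_int (plevel v j n) - v * real (ptime (fst j) n))" for n
  have \<beta>: "(\<lambda>n. \<beta> n / sqrt (real n)) \<longlonglongrightarrow> snd i - snd j"
    unfolding \<beta>_def diff_divide_distrib[of "real_of_int (plevel v i _) - _"]
    using plevel_centered_lim[OF i, of v "snd i"] plevel_centered_lim[OF j, of v "snd j"] by (intro tendsto_diff) simp_all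
  define D where "D n = (\<lambda>(\<xi>, \<xi>'). csum {..<ptime (fst j) n} \<xi>' - csum {..<ptime (fst i) n} \<xi>)" for n
  have fin: "finite (set_pmf (steps p k))" for k by (rule finite_set_pmf_steps[OF finite_p])
  have int[simp]: "integrable (?P n) f" for n and f :: "_ \<Rightarrow> 'c::{banach, second_countable_topology}"
    by (rule integrable_measure_pmf_finite) (simp add: fin)
  note E = expectation_pair_pmf_finite[OF fin fin]
  have "(\<lambda>n. (LINT z|?P n. max 0 (\<beta> n + D n z)) / sqrt (real n)) \<longlonglongrightarrow> Psi (s2 * (fst j + fst i)) (- (snd i - snd j))"
  proof (rule pos_part_clt[where K="2 * (s2 * fst j) + 2 * (s2 * fst i)"])
    show "prob_space (?P n)" for n by (rule measure_pmf.prob_space_axioms)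
    show "(LINT z|?P n. (D n z)\<^sup>2) \<le> (2 * (s2 * fst j) + 2 * (s2 * fst i)) * real n" for n
    proof -
      have "(LINT z|?P n. (D n z)\<^sup>2) \<le> (LINT z|?P n. 2 * (csum {..<ptime (fst j) n} (snd z))\<^sup>2 + 2 * (csum {..<ptime (fst i) n} (fst z))\<^sup>2)"
      proof (rule integral_mono)
        fix z :: "(nat \<Rightarrow> int) \<times> (nat \<Rightarrow> int)"
        have "(a - b)\<^sup>2 \<le> 2 * a\<^sup>2 + 2 * b\<^sup>2" for a b :: real
          using zero_le_power2[of "a + b"] by (simp add: power2_sum power2_diff)
        then show "(D n z)\<^sup>2 \<le> 2 * (csum {..<ptime (fst j) n} (snd z))\<^sup>2 + 2 * (csum {..<ptime (fst i) n} (fst z))\<^sup>2"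
          by (simp add: D_def split_beta)
      qed simp_all
      also have "\<dots> = 2 * (s2 * real (ptime (fst j) n)) + 2 * (s2 * real (ptime (fst i) n))"
        using second_moment_csum[of "{..<ptime (fst j) n}" "K n"] second_moment_csum[of "{..<ptime (fst i) n}" "K n"] Ki[of n] Kj[of n]
        by (subst Bochner_Integration.integral_add) (simp_all add: E)
      also have "\<dots> \<le> 2 * (s2 * (fst j * real n)) + 2 * (s2 * (fst i * real n))"
        using s2_nonneg ptime_le[OF i] ptime_le[OF j] by (intro add_mono mult_left_mono) auto
      finally show ?thesis by (simp add: algebra_simps)
    qed
    show "(\<lambda>n. LINT z|?P n. iexp (\<theta> / sqrt (real n) * D n z)) \<longlonglongrightarrow> exp (- (\<theta>\<^sup>2 * (s2 * (fst j + fst i)) / 2))" for \<theta>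
    proof -
      have "(LINT z|?P n. iexp (\<theta> / sqrt (real n) * D n z)) =
          \<phi> ((- \<theta>) / sqrt (real n)) ^ ptime (fst i) n * \<phi> (\<theta> / sqrt (real n)) ^ ptime (fst j) n" for n
      proof -
        have "iexp (\<theta> / sqrt (real n) * D n (\<xi>, \<xi>')) =
            iexp ((- \<theta>) / sqrt (real n) * csum {..<ptime (fst i) n} \<xi>) * iexp (\<theta> / sqrt (real n) * csum {..<ptime (fst j) n} \<xi>')" for \<xi> \<xi>'
          unfolding exp_add[symmetric] D_def by (simp add: algebra_simps)
        then show ?thesis
          using char_csum[of "{..<ptime (fst i) n}" "K n" "- \<theta> / sqrt (real n)"]
            char_csum[of "{..<ptime (fst j) n}" "K n" "\<theta> / sqrt (real n)"] Ki[of n] Kj[of n]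
          unfolding E by simp
      qed
      moreover have "(\<lambda>n. \<phi> ((- \<theta>) / sqrt (real n)) ^ ptime (fst i) n * \<phi> (\<theta> / sqrt (real n)) ^ ptime (fst j) n)
          \<longlonglongrightarrow> of_real (exp (- ((- \<theta>)\<^sup>2 * (s2 * fst i) / 2))) * of_real (exp (- (\<theta>\<^sup>2 * (s2 * fst j) / 2)))"
        by (intro tendsto_mult \<phi>_power_limit ptime_lim i j)
      moreover have "complex_of_real (exp (- ((- \<theta>)\<^sup>2 * (s2 * fst i) / 2))) * of_real (exp (- (\<theta>\<^sup>2 * (s2 * fst j) / 2))) =
          of_real (exp (- (\<theta>\<^sup>2 * (s2 * (fst j + fst i)) / 2)))"
        unfolding of_real_mult[symmetric] exp_add[symmetric] by (simp add: field_simps)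
      ultimately show ?thesis by simp
    qed
  qed (use \<beta> i j s2_nonneg in auto)
  moreover have "\<beta> n + D n z = (\<lambda>(\<xi>, \<xi>'). real_of_int (excess i n \<xi>) - real_of_int (excess j n \<xi>')) z" for n z
    by (simp add: D_def \<beta>_def excess_eq split_beta)
  ultimately show ?thesis by (simp add: split_beta')
qed

end

section \<open>Expansion of the contribution of one site\<close>

text \<open>Each bound follows by induction from the previous one, because the remainder of order \<open>k + 1\<close> at \<open>Suc h\<close>
exceeds the one at \<open>h\<close> by \<open>\<delta>\<close> times the remainder of order \<open>k\<close>; that \<open>1 + \<delta>\<close> lies in the unit disc
starts the chain.\<close>

lemma power_expansion_bounds:
  fixes \<delta> :: complex
  assumes m: "norm (1 + \<delta>) \<le> 1"
  shows "norm ((1 + \<delta>) ^ h - 1 - of_nat h * \<delta>) \<le> (real h)\<^sup>2 / 2 * (norm \<delta>)\<^sup>2"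
    and "norm ((1 + \<delta>) ^ h - 1 - of_nat h * \<delta> - of_real (real h * (real h - 1) / 2) * \<delta>\<^sup>2) \<le> (real h) ^ 3 * norm \<delta> ^ 3"
proof -
  have a: "norm ((1 + \<delta>) ^ h - 1) \<le> real h * norm \<delta>" for h
  proof (induction h)
    case (Suc h)
    have "(1 + \<delta>) ^ Suc h - 1 = ((1 + \<delta>) ^ h - 1) + (1 + \<delta>) ^ h * \<delta>" by (simp add: algebra_simps)
    then have "norm ((1 + \<delta>) ^ Suc h - 1) \<le> norm ((1 + \<delta>) ^ h - 1) + norm ((1 + \<delta>) ^ h * \<delta>)"
      by (metis norm_triangle_ineq)
    moreover have "norm ((1 + \<delta>) ^ h * \<delta>) \<le> 1 * norm \<delta>"
      unfolding norm_mult norm_power by (intro mult_right_mono power_le_one m) auto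
    ultimately show ?case using Suc by (simp add: algebra_simps)
  qed simp
  have b: "norm ((1 + \<delta>) ^ h - 1 - of_nat h * \<delta>) \<le> (real h)\<^sup>2 / 2 * (norm \<delta>)\<^sup>2" for h
  proof (induction h)
    case (Suc h)
    have "(1 + \<delta>) ^ Suc h - 1 - of_nat (Suc h) * \<delta> = ((1 + \<delta>) ^ h - 1 - of_nat h * \<delta>) + ((1 + \<delta>) ^ h - 1) * \<delta>"
      by (simp add: algebra_simps)
    then have "norm ((1 + \<delta>) ^ Suc h - 1 - of_nat (Suc h) * \<delta>) \<le>
        norm ((1 + \<delta>) ^ h - 1 - of_nat h * \<delta>) + norm (((1 + \<delta>) ^ h - 1) * \<delta>)"
      by (metis norm_triangle_ineq)
    also have "\<dots> \<le> (real h)\<^sup>2 / 2 * (norm \<delta>)\<^sup>2 + real h * norm \<delta> * norm \<delta>"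
      unfolding norm_mult by (intro add_mono Suc.IH mult_right_mono a) auto
    also have "\<dots> \<le> (real (Suc h))\<^sup>2 / 2 * (norm \<delta>)\<^sup>2"
      by (simp add: power2_eq_square field_simps)
    finally show ?case .
  qed simp
  have c: "norm ((1 + \<delta>) ^ h - 1 - of_nat h * \<delta> - of_real (real h * (real h - 1) / 2) * \<delta>\<^sup>2) \<le> (real h) ^ 3 * norm \<delta> ^ 3" for h
  proof (induction h)
    case (Suc h)
    let ?T = "\<lambda>h. (1 + \<delta>) ^ h - 1 - of_nat h * \<delta> - of_real (real h * (real h - 1) / 2) * \<delta>\<^sup>2"
    have r: "real (Suc h) * (real (Suc h) - 1) / 2 = real h * (real h - 1) / 2 + real h" by (simp add: field_simps)
    have "?T (Suc h) = ?T h + ((1 + \<delta>) ^ h - 1 - of_nat h * \<delta>) * \<delta>"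
      unfolding r of_real_add by (simp add: algebra_simps power2_eq_square)
    then have "norm (?T (Suc h)) \<le> norm (?T h) + norm (((1 + \<delta>) ^ h - 1 - of_nat h * \<delta>) * \<delta>)"
      by (metis norm_triangle_ineq)
    also have "\<dots> \<le> (real h) ^ 3 * norm \<delta> ^ 3 + (real h)\<^sup>2 / 2 * (norm \<delta>)\<^sup>2 * norm \<delta>"
      unfolding norm_mult by (intro add_mono Suc.IH mult_right_mono b) auto
    also have "\<dots> = ((real h) ^ 3 + (real h)\<^sup>2 / 2) * norm \<delta> ^ 3"
      by (simp add: power3_eq_cube power2_eq_square algebra_simps)
    also have "\<dots> \<le> (real (Suc h)) ^ 3 * norm \<delta> ^ 3"
      by (intro mult_right_mono) (auto simp: power3_eq_cube power2_eq_square algebra_simps)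
    finally show ?case .
  qed simp
  show "norm ((1 + \<delta>) ^ h - 1 - of_nat h * \<delta>) \<le> (real h)\<^sup>2 / 2 * (norm \<delta>)\<^sup>2"
    "norm ((1 + \<delta>) ^ h - 1 - of_nat h * \<delta> - of_real (real h * (real h - 1) / 2) * \<delta>\<^sup>2) \<le> (real h) ^ 3 * norm \<delta> ^ 3"
    by (rule b c)+
qed

text \<open>The law of the occupation variables is represented by one of them, \<open>\<eta>0\<close>, with mean \<open>m0\<close>, variance \<open>v0\<close> and
probability generating function \<open>pgf\<close>.\<close>

locale occupation = prob_space M for M :: "'a measure" +
  fixes \<eta>0 :: "'a \<Rightarrow> nat"
  assumes \<eta>0[measurable]: "\<eta>0 \<in> measurable M (count_space UNIV)"
    and int1: "integrable M (\<lambda>\<omega>. real (\<eta>0 \<omega>))"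
    and int2: "integrable M (\<lambda>\<omega>. (real (\<eta>0 \<omega>))\<^sup>2)"
begin

definition m0 :: real where "m0 = expectation (\<lambda>\<omega>. real (\<eta>0 \<omega>))"
definition v0 :: real where "v0 = expectation (\<lambda>\<omega>. (real (\<eta>0 \<omega>) - m0)\<^sup>2)"
definition pgf :: "complex \<Rightarrow> complex" where "pgf z = (LINT \<omega>|M. z ^ \<eta>0 \<omega>)"
definition remainder :: "real \<Rightarrow> real" where
  "remainder \<tau> = expectation (\<lambda>\<omega>. min (real (\<eta>0 \<omega>) ^ 3 * \<tau>) ((real (\<eta>0 \<omega>))\<^sup>2))"

lemma m0_nonneg: "m0 \<ge> 0" unfolding m0_def by (rule Bochner_Integration.integral_nonneg) simp
lemma v0_nonneg: "v0 \<ge> 0" unfolding v0_def by (rule Bochner_Integration.integral_nonneg) simp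

lemma second_moment: "expectation (\<lambda>\<omega>. (real (\<eta>0 \<omega>))\<^sup>2) = v0 + m0\<^sup>2"
proof -
  have "v0 = expectation (\<lambda>\<omega>. (real (\<eta>0 \<omega>))\<^sup>2 - 2 * m0 * real (\<eta>0 \<omega>) + m0\<^sup>2)"
    unfolding v0_def by (intro Bochner_Integration.integral_cong) (auto simp: power2_diff)
  also have "\<dots> = expectation (\<lambda>\<omega>. (real (\<eta>0 \<omega>))\<^sup>2) - 2 * m0 * m0 + m0\<^sup>2"
    using int1 int2 by (simp add: m0_def prob_space)
  finally show ?thesis by (simp add: power2_eq_square)
qed

lemma integrable_pgf: "norm z \<le> 1 \<Longrightarrow> integrable M (\<lambda>\<omega>. z ^ \<eta>0 \<omega>)" for z :: complex
  by (rule integrable_const_bound[where B=1]) (auto simp: norm_power power_le_one)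

lemma norm_pgf_le_1: "norm z \<le> 1 \<Longrightarrow> norm (pgf z) \<le> 1"
proof -
  assume "norm z \<le> 1"
  then have "norm (pgf z) \<le> (LINT \<omega>|M. 1)"
    unfolding pgf_def
    by (intro order_trans[OF integral_norm_bound] integral_mono integrable_norm integrable_pgf)
       (auto simp: norm_power power_le_one)
  then show ?thesis by (simp add: prob_space)
qed

lemma integrable_remainder: "\<tau> \<ge> 0 \<Longrightarrow> integrable M (\<lambda>\<omega>. min (real (\<eta>0 \<omega>) ^ 3 * \<tau>) ((real (\<eta>0 \<omega>))\<^sup>2))"
  by (rule Bochner_Integration.integrable_bound[OF int2]) auto

text \<open>Third moments may be infinite. The minimum with the square keeps the integrand dominated, and it tends to
zero pointwise.\<close>

lemma remainder_tendsto:
  assumes "\<tau> \<longlonglongrightarrow> 0" "\<And>n. \<tau> n \<ge> 0"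
  shows "(\<lambda>n. remainder (\<tau> n)) \<longlonglongrightarrow> 0"
proof -
  have "(\<lambda>n. remainder (\<tau> n)) \<longlonglongrightarrow> expectation (\<lambda>\<omega>. 0)"
    unfolding remainder_def
  proof (rule integral_dominated_convergence[OF _ _ int2])
    show "AE \<omega> in M. (\<lambda>n. min (real (\<eta>0 \<omega>) ^ 3 * \<tau> n) ((real (\<eta>0 \<omega>))\<^sup>2)) \<longlonglongrightarrow> 0"
    proof (rule AE_I2)
      fix \<omega>
      have "(\<lambda>n. min (real (\<eta>0 \<omega>) ^ 3 * \<tau> n) ((real (\<eta>0 \<omega>))\<^sup>2)) \<longlonglongrightarrow> min (real (\<eta>0 \<omega>) ^ 3 * 0) ((real (\<eta>0 \<omega>))\<^sup>2)"
        by (intro tendsto_intros assms)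
      then show "(\<lambda>n. min (real (\<eta>0 \<omega>) ^ 3 * \<tau> n) ((real (\<eta>0 \<omega>))\<^sup>2)) \<longlonglongrightarrow> 0" by simp
    qed
  qed (use assms in auto)
  then show ?thesis by simp
qed

text \<open>The two bounds on the remainder of \<open>(1 + \<delta>) ^ h\<close> of second order, cubic and quadratic in \<open>h\<close>, are averaged
over \<open>h = \<eta>0 \<omega>\<close>; the smaller of them defines \<open>remainder\<close>.\<close>

lemma pgf_expansion:
  assumes m: "norm (1 + \<delta>) \<le> 1" and \<tau>: "norm \<delta> \<le> \<tau>"
  shows "norm (pgf (1 + \<delta>) - (1 + of_real m0 * \<delta> + of_real ((v0 + m0\<^sup>2 - m0) / 2) * \<delta>\<^sup>2)) \<le> (norm \<delta>)\<^sup>2 * remainder \<tau>"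
proof -
  have \<tau>0: "\<tau> \<ge> 0" using \<tau> norm_ge_zero order_trans by blast
  let ?h = "\<lambda>\<omega>. real (\<eta>0 \<omega>)"
  let ?q = "\<lambda>\<omega>. 1 + of_real (?h \<omega>) * \<delta> + of_real (((?h \<omega>)\<^sup>2 - ?h \<omega>) / 2) * \<delta>\<^sup>2"
  have i: "integrable M (\<lambda>\<omega>. of_real (?h \<omega>) * \<delta>)" "integrable M (\<lambda>\<omega>. of_real (((?h \<omega>)\<^sup>2 - ?h \<omega>) / 2) * \<delta>\<^sup>2)"
    by (intro integrable_mult_left integrable_of_real Bochner_Integration.integrable_diff integrable_divide int1 int2)+
  have iq: "integrable M ?q" using i by simp
  have q: "(LINT \<omega>|M. ?q \<omega>) = 1 + of_real m0 * \<delta> + of_real ((v0 + m0\<^sup>2 - m0) / 2) * \<delta>\<^sup>2"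
  proof -
    have "(LINT \<omega>|M. ?q \<omega>) = (LINT \<omega>|M. 1 + of_real (?h \<omega>) * \<delta>) + (LINT \<omega>|M. of_real (((?h \<omega>)\<^sup>2 - ?h \<omega>) / 2) * \<delta>\<^sup>2)"
      by (rule Bochner_Integration.integral_add) (use i in auto)
    also have "(LINT \<omega>|M. 1 + of_real (?h \<omega>) * \<delta>) = 1 + of_real m0 * \<delta>"
    proof -
      have "(LINT \<omega>|M. 1 + of_real (?h \<omega>) * \<delta>) = (LINT \<omega>|M. 1) + (LINT \<omega>|M. of_real (?h \<omega>) * \<delta>)"
        by (rule Bochner_Integration.integral_add) (use i in auto)
      also have "(LINT \<omega>|M. of_real (?h \<omega>) * \<delta>) = of_real m0 * \<delta>"
        by (simp only: integral_mult_left_zero integral_complex_of_real m0_def)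
      finally show ?thesis by (simp add: prob_space)
    qed
    also have "(LINT \<omega>|M. of_real (((?h \<omega>)\<^sup>2 - ?h \<omega>) / 2) * \<delta>\<^sup>2) = of_real ((v0 + m0\<^sup>2 - m0) / 2) * \<delta>\<^sup>2"
    proof -
      have "(LINT \<omega>|M. of_real (((?h \<omega>)\<^sup>2 - ?h \<omega>) / 2) * \<delta>\<^sup>2) = of_real (LINT \<omega>|M. ((?h \<omega>)\<^sup>2 - ?h \<omega>) / 2) * \<delta>\<^sup>2"
        by (simp only: integral_mult_left_zero integral_complex_of_real)
      also have "(LINT \<omega>|M. ((?h \<omega>)\<^sup>2 - ?h \<omega>) / 2) = (v0 + m0\<^sup>2 - m0) / 2"
        using int1 int2 second_moment by (simp add: m0_def)
      finally show ?thesis .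
    qed
    finally show ?thesis .
  qed
  have "norm (pgf (1 + \<delta>) - (1 + of_real m0 * \<delta> + of_real ((v0 + m0\<^sup>2 - m0) / 2) * \<delta>\<^sup>2)) =
      norm (LINT \<omega>|M. (1 + \<delta>) ^ \<eta>0 \<omega> - ?q \<omega>)"
    unfolding pgf_def q[symmetric] using integrable_pgf[OF m] iq by simp
  also have "\<dots> \<le> (LINT \<omega>|M. norm ((1 + \<delta>) ^ \<eta>0 \<omega> - ?q \<omega>))" by (rule integral_norm_bound)
  also have "\<dots> \<le> (LINT \<omega>|M. (norm \<delta>)\<^sup>2 * min (?h \<omega> ^ 3 * \<tau>) ((?h \<omega>)\<^sup>2))"
  proof (rule integral_mono)
    show "integrable M (\<lambda>\<omega>. norm ((1 + \<delta>) ^ \<eta>0 \<omega> - ?q \<omega>))" using integrable_pgf[OF m] iq by simp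
    show "integrable M (\<lambda>\<omega>. (norm \<delta>)\<^sup>2 * min (?h \<omega> ^ 3 * \<tau>) ((?h \<omega>)\<^sup>2))"
      using integrable_remainder[OF \<tau>0] by simp
    fix \<omega>
    define h where "h = \<eta>0 \<omega>"
    have eq: "(1 + \<delta>) ^ \<eta>0 \<omega> - ?q \<omega> = (1 + \<delta>) ^ h - 1 - of_nat h * \<delta> - of_real (real h * (real h - 1) / 2) * \<delta>\<^sup>2"
      by (simp add: h_def power2_eq_square algebra_simps)
    have hh: "real h * (real h - 1) / 2 \<ge> 0" by (cases h) auto
    have "norm ((1 + \<delta>) ^ \<eta>0 \<omega> - ?q \<omega>) \<le> (real h) ^ 3 * norm \<delta> ^ 3"
      unfolding eq by (rule power_expansion_bounds(2)[OF m])
    also have "\<dots> = (norm \<delta>)\<^sup>2 * (real h ^ 3 * norm \<delta>)" by (simp add: power3_eq_cube power2_eq_square)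
    also have "\<dots> \<le> (norm \<delta>)\<^sup>2 * (real h ^ 3 * \<tau>)" using \<tau> by (intro mult_left_mono) auto
    finally have 1: "norm ((1 + \<delta>) ^ \<eta>0 \<omega> - ?q \<omega>) \<le> (norm \<delta>)\<^sup>2 * (real h ^ 3 * \<tau>)" .
    have "norm ((1 + \<delta>) ^ \<eta>0 \<omega> - ?q \<omega>) \<le> norm ((1 + \<delta>) ^ h - 1 - of_nat h * \<delta>) + norm (of_real (real h * (real h - 1) / 2) * \<delta>\<^sup>2)"
      unfolding eq by (rule norm_triangle_ineq4)
    also have "\<dots> \<le> (real h)\<^sup>2 / 2 * (norm \<delta>)\<^sup>2 + (real h * (real h - 1) / 2) * (norm \<delta>)\<^sup>2"
      using power_expansion_bounds(1)[OF m, of h] hh unfolding norm_mult norm_of_real norm_power by simp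
    also have "\<dots> \<le> (norm \<delta>)\<^sup>2 * (real h)\<^sup>2"
    proof -
      have "real h * (real h - 1) / 2 \<le> (real h)\<^sup>2 / 2" by (simp add: power2_eq_square field_simps)
      from mult_right_mono[OF this, of "(norm \<delta>)\<^sup>2"]
      have "real h * (real h - 1) / 2 * (norm \<delta>)\<^sup>2 \<le> (real h)\<^sup>2 / 2 * (norm \<delta>)\<^sup>2" by simp
      moreover have "(norm \<delta>)\<^sup>2 * (real h)\<^sup>2 = (real h)\<^sup>2 / 2 * (norm \<delta>)\<^sup>2 + (real h)\<^sup>2 / 2 * (norm \<delta>)\<^sup>2" by simp
      ultimately show ?thesis by linarith
    qed
    finally have 2: "norm ((1 + \<delta>) ^ \<eta>0 \<omega> - ?q \<omega>) \<le> (norm \<delta>)\<^sup>2 * (real h)\<^sup>2" .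
    show "norm ((1 + \<delta>) ^ \<eta>0 \<omega> - ?q \<omega>) \<le> (norm \<delta>)\<^sup>2 * min (?h \<omega> ^ 3 * \<tau>) ((?h \<omega>)\<^sup>2)"
      using 1 2 by (simp add: h_def min_def)
  qed
  also have "\<dots> = (norm \<delta>)\<^sup>2 * remainder \<tau>" by (simp add: remainder_def)
  finally show ?thesis .
qed

end

text \<open>All expansions carry the factor \<open>\<pi>\<close>, the probability that the particle contributes at all, because the
expanded functions vanish where \<open>g\<close> does. This factor is what makes the errors summable over the sites.\<close>

lemma bounded_site_expansion:
  fixes g :: "'b \<Rightarrow> real"
  assumes fin: "finite (set_pmf Q)" and g: "\<And>y. \<bar>g y\<bar> \<le> A"
    and \<tau>_def: "\<tau> = \<bar>\<theta>\<bar> * A" and \<pi>_def: "\<pi> = measure_pmf.expectation Q (\<lambda>y. of_bool (g y \<noteq> 0))"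
    and \<alpha>_def: "\<alpha> = measure_pmf.expectation Q g" and \<beta>_def: "\<beta> = measure_pmf.expectation Q (\<lambda>y. (g y)\<^sup>2)"
    and \<delta>_def: "\<delta> = measure_pmf.expectation Q (\<lambda>y. iexp (\<theta> * g y)) - 1"
  shows "norm (1 + \<delta>) \<le> 1" "0 \<le> \<pi>" "\<pi> \<le> 1" "norm \<delta> \<le> \<tau> * \<pi>" "norm (\<delta> - \<i> * of_real (\<theta> * \<alpha>)) \<le> \<tau>\<^sup>2 * \<pi>"
    "norm (\<delta> - (\<i> * of_real (\<theta> * \<alpha>) - of_real (\<theta>\<^sup>2 * \<beta> / 2))) \<le> \<tau> ^ 3 * \<pi>"
    "\<bar>\<alpha>\<bar> \<le> A * \<pi>" "\<beta> \<le> A\<^sup>2 * \<pi>" "\<alpha>\<^sup>2 \<le> \<beta>"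
proof -
  have int[simp]: "integrable (measure_pmf Q) f" for f :: "'b \<Rightarrow> 'c::{banach, second_countable_topology}"
    by (rule integrable_measure_pmf_finite[OF fin])
  let ?E = "measure_pmf.expectation Q"
  have A: "A \<ge> 0" using g[of undefined] by linarith
  have \<tau>0: "\<tau> \<ge> 0" using A by (simp add: \<tau>_def)
  have "norm (?E (\<lambda>y. iexp (\<theta> * g y))) \<le> ?E (\<lambda>y. norm (iexp (\<theta> * g y)))" by (rule integral_norm_bound)
  then show "norm (1 + \<delta>) \<le> 1" by (simp add: \<delta>_def)
  show p0: "0 \<le> \<pi>" unfolding \<pi>_def by (rule Bochner_Integration.integral_nonneg) simp
  have "\<pi> \<le> ?E (\<lambda>y. 1)" unfolding \<pi>_def by (rule integral_mono) auto
  then show p1: "\<pi> \<le> 1" by simp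
  have pw: "\<bar>\<theta> * g y\<bar> ^ k \<le> \<tau> ^ k * of_bool (g y \<noteq> 0)" if "k > 0" for k y
  proof (cases "g y = 0")
    case True
    then show ?thesis using that by (simp add: power_0_left)
  next
    case False
    have "\<bar>\<theta> * g y\<bar> \<le> \<tau>" unfolding \<tau>_def abs_mult by (rule mult_left_mono[OF g]) simp
    then show ?thesis using False by (simp add: power_mono)
  qed
  have gen: "norm (?E F) \<le> \<tau> ^ k * \<pi>" if "k > 0" "\<And>y. norm (F y) \<le> \<bar>\<theta> * g y\<bar> ^ k" for F :: "'b \<Rightarrow> complex" and k
  proof -
    have "norm (?E F) \<le> ?E (\<lambda>y. norm (F y))" by (rule integral_norm_bound)
    also have "\<dots> \<le> ?E (\<lambda>y. \<tau> ^ k * of_bool (g y \<noteq> 0))"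
      by (intro integral_mono) (use order_trans[OF that(2) pw[OF that(1)]] in auto)
    finally show ?thesis by (simp add: \<pi>_def)
  qed
  have ap: "norm (iexp x - (\<Sum>k\<le>n. (\<i> * complex_of_real x) ^ k / fact k)) \<le> \<bar>x\<bar> ^ Suc n" for x n
  proof -
    have "\<bar>x\<bar> ^ Suc n / fact (Suc n) \<le> \<bar>x\<bar> ^ Suc n / 1"
      by (rule frac_le) (use fact_ge_1[of "Suc n", where 'a=real] in auto)
    then show ?thesis using iexp_approx1[of x n] by simp
  qed
  have "norm (?E (\<lambda>y. iexp (\<theta> * g y) - 1)) \<le> \<tau> ^ 1 * \<pi>"
  proof (rule gen)
    show "norm (iexp (\<theta> * g y) - 1) \<le> \<bar>\<theta> * g y\<bar> ^ 1" for y
      using ap[of "\<theta> * g y" 0] by simp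
  qed simp
  moreover have "?E (\<lambda>y. iexp (\<theta> * g y) - 1) = \<delta>" unfolding \<delta>_def by (subst Bochner_Integration.integral_diff) simp_all
  ultimately show "norm \<delta> \<le> \<tau> * \<pi>" by simp
  have Ei: "?E (\<lambda>y. \<i> * of_real (\<theta> * g y)) = \<i> * of_real (\<theta> * \<alpha>)"
    unfolding \<alpha>_def integral_mult_right_zero integral_complex_of_real by simp
  have Es: "?E (\<lambda>y. of_real ((\<theta> * g y)\<^sup>2 / 2)) = complex_of_real (\<theta>\<^sup>2 * \<beta> / 2)"
    unfolding \<beta>_def integral_complex_of_real by (simp add: power_mult_distrib)
  have "norm (?E (\<lambda>y. iexp (\<theta> * g y) - 1 - \<i> * of_real (\<theta> * g y))) \<le> \<tau> ^ 2 * \<pi>"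
  proof (rule gen)
    show "norm (iexp (\<theta> * g y) - 1 - \<i> * of_real (\<theta> * g y)) \<le> \<bar>\<theta> * g y\<bar> ^ 2" for y
      using ap[of "\<theta> * g y" 1] by (simp add: numeral_2_eq_2 diff_diff_eq)
  qed simp
  moreover have e1: "?E (\<lambda>y. iexp (\<theta> * g y) - 1 - \<i> * of_real (\<theta> * g y)) = \<delta> - \<i> * of_real (\<theta> * \<alpha>)"
    unfolding \<delta>_def Ei[symmetric] by (subst Bochner_Integration.integral_diff, simp, simp, subst Bochner_Integration.integral_diff) simp_all
  ultimately show "norm (\<delta> - \<i> * of_real (\<theta> * \<alpha>)) \<le> \<tau>\<^sup>2 * \<pi>" by (simp only:)
  have "norm (?E (\<lambda>y. (iexp (\<theta> * g y) - 1 - \<i> * of_real (\<theta> * g y)) + of_real ((\<theta> * g y)\<^sup>2 / 2))) \<le> \<tau> ^ 3 * \<pi>"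
  proof (rule gen)
    fix y
    have "{..2::nat} = {0, 1, 2}" by auto
    then have "(\<Sum>k\<le>2. (\<i> * complex_of_real x) ^ k / fact k) = 1 + \<i> * of_real x - of_real (x\<^sup>2 / 2)" for x
      by (simp add: power_mult_distrib fact_numeral)
    with ap[of "\<theta> * g y" 2] show "norm ((iexp (\<theta> * g y) - 1 - \<i> * of_real (\<theta> * g y)) + of_real ((\<theta> * g y)\<^sup>2 / 2)) \<le> \<bar>\<theta> * g y\<bar> ^ 3"
      by (simp only: diff_diff_eq diff_diff_eq2 eval_nat_numeral) (simp add: algebra_simps)
  qed simp
  moreover have "?E (\<lambda>y. (iexp (\<theta> * g y) - 1 - \<i> * of_real (\<theta> * g y)) + of_real ((\<theta> * g y)\<^sup>2 / 2)) =
      \<delta> - (\<i> * of_real (\<theta> * \<alpha>) - of_real (\<theta>\<^sup>2 * \<beta> / 2))"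
  proof -
    have "?E (\<lambda>y. (iexp (\<theta> * g y) - 1 - \<i> * of_real (\<theta> * g y)) + of_real ((\<theta> * g y)\<^sup>2 / 2)) =
        ?E (\<lambda>y. iexp (\<theta> * g y) - 1 - \<i> * of_real (\<theta> * g y)) + ?E (\<lambda>y. of_real ((\<theta> * g y)\<^sup>2 / 2))"
      by (rule Bochner_Integration.integral_add) simp_all
    then show ?thesis unfolding e1 Es by (simp only: diff_diff_eq2 diff_add_eq)
  qed
  ultimately show "norm (\<delta> - (\<i> * of_real (\<theta> * \<alpha>) - of_real (\<theta>\<^sup>2 * \<beta> / 2))) \<le> \<tau> ^ 3 * \<pi>" by (simp only:)
  have gA: "\<bar>g y\<bar> ^ k \<le> A ^ k * of_bool (g y \<noteq> 0)" if "k > 0" for k y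
    using that g[of y] by (cases "g y = 0") (auto intro: power_mono simp: power_0_left)
  have "\<bar>\<alpha>\<bar> \<le> ?E (\<lambda>y. \<bar>g y\<bar>)" unfolding \<alpha>_def by (rule integral_abs_bound)
  also have "\<dots> \<le> ?E (\<lambda>y. A * of_bool (g y \<noteq> 0))"
    by (intro integral_mono) (use gA[of 1] in auto)
  finally show "\<bar>\<alpha>\<bar> \<le> A * \<pi>" by (simp add: \<pi>_def)
  have "\<beta> \<le> ?E (\<lambda>y. A\<^sup>2 * of_bool (g y \<noteq> 0))"
    unfolding \<beta>_def by (intro integral_mono) (use gA[of 2] in auto)
  then show "\<beta> \<le> A\<^sup>2 * \<pi>" by (simp add: \<pi>_def)
  have "0 \<le> ?E (\<lambda>y. (g y - \<alpha>)\<^sup>2)" by (rule Bochner_Integration.integral_nonneg) simp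
  also have "\<dots> = ?E (\<lambda>y. (g y)\<^sup>2 - 2 * \<alpha> * g y + \<alpha>\<^sup>2)"
    by (intro Bochner_Integration.integral_cong) (auto simp: power2_diff)
  also have "\<dots> = \<beta> - 2 * \<alpha> * \<alpha> + \<alpha>\<^sup>2" by (simp add: \<alpha>_def \<beta>_def)
  finally show "\<alpha>\<^sup>2 \<le> \<beta>" by (simp add: power2_eq_square)
qed

context occupation
begin

text \<open>The variance of a sum of \<open>\<eta>0\<close> independent copies of a variable with mean \<open>\<alpha>\<close> and second moment \<open>\<beta>\<close>.\<close>

definition site_variance :: "real \<Rightarrow> real \<Rightarrow> real" where
  "site_variance \<alpha> \<beta> = m0 * (\<beta> - \<alpha>\<^sup>2) + v0 * \<alpha>\<^sup>2"

definition error_const :: real where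
  "error_const = m0 + 2 * \<bar>(v0 + m0\<^sup>2 - m0) / 2\<bar> + exp ((m0 + v0) / 2) * (m0 + (m0 + v0) / 2) ^ 3
     + (m0 + v0) / 2 * (2 * m0 + (m0 + v0) / 2)"

text \<open>Both numbers are compared with the second-order polynomial \<open>T\<close>. On the side of the generating function
the quadratic coefficient is half the factorial moment \<open>v0 + m0\<^sup>2 - m0\<close>; on the side of the exponential the
square of the imaginary part \<open>\<theta> * m0 * \<alpha>\<close> contributes \<open>m0\<^sup>2\<close>. The two agree by the definition of
\<open>site_variance\<close>.\<close>

lemma site_estimate:
  fixes g :: "'b \<Rightarrow> real"
  assumes fin: "finite (set_pmf Q)" and g: "\<And>y. \<bar>g y\<bar> \<le> A"
    and \<tau>_def: "\<tau> = \<bar>\<theta>\<bar> * A" and \<tau>1: "\<tau> \<le> 1" and \<pi>_def: "\<pi> = measure_pmf.expectation Q (\<lambda>y. of_bool (g y \<noteq> 0))"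
    and \<alpha>_def: "\<alpha> = measure_pmf.expectation Q g" and \<beta>_def: "\<beta> = measure_pmf.expectation Q (\<lambda>y. (g y)\<^sup>2)"
  shows "norm (pgf (measure_pmf.expectation Q (\<lambda>y. iexp (\<theta> * g y))) -
      exp (\<i> * of_real (\<theta> * m0 * \<alpha>) - of_real (\<theta>\<^sup>2 * site_variance \<alpha> \<beta> / 2))) \<le>
    \<pi> * \<tau>\<^sup>2 * (remainder \<tau> + error_const * \<tau>)"
proof -
  define \<delta> where "\<delta> = measure_pmf.expectation Q (\<lambda>y. iexp (\<theta> * g y)) - 1"
  note B = bounded_site_expansion[OF fin g \<tau>_def \<pi>_def \<alpha>_def \<beta>_def \<delta>_def]
  have A: "A \<ge> 0" using g[of undefined] by linarith
  have \<tau>0: "\<tau> \<ge> 0" using A by (simp add: \<tau>_def)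
  note m = m0_nonneg and v = v0_nonneg
  define c2 where "c2 = (v0 + m0\<^sup>2 - m0) / 2"
  define w where "w = site_variance \<alpha> \<beta>"
  define W where "W = (m0 + v0) / 2"
  have W: "W \<ge> 0" using m v by (simp add: W_def)
  have \<pi>2: "\<pi>\<^sup>2 \<le> \<pi>" using B(2,3) by (simp add: power2_eq_square mult_left_le_one_le)
  have \<tau>A: "\<bar>\<theta>\<bar> * (A * x) = \<tau> * x" "\<theta>\<^sup>2 * (A\<^sup>2 * x) = \<tau>\<^sup>2 * x" for x
    by (simp_all add: \<tau>_def power_mult_distrib)
  have t3: "\<tau>\<^sup>2 * \<tau> = \<tau> ^ 3" "\<tau> * \<tau>\<^sup>2 = \<tau> ^ 3" "\<tau> * \<tau> = \<tau>\<^sup>2" by (simp_all add: power2_eq_square power3_eq_cube)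
  have \<theta>\<alpha>: "\<bar>\<theta> * \<alpha>\<bar> \<le> \<tau> * \<pi>"
    unfolding abs_mult \<tau>A(1)[symmetric] by (intro mult_left_mono B) simp
  have \<delta>2: "(norm \<delta>)\<^sup>2 \<le> \<tau>\<^sup>2 * \<pi>"
  proof -
    have "(norm \<delta>)\<^sup>2 \<le> (\<tau> * \<pi>)\<^sup>2" by (intro power_mono B) simp
    also have "\<dots> \<le> \<tau>\<^sup>2 * \<pi>" unfolding power_mult_distrib by (intro mult_left_mono \<pi>2) simp
    finally show ?thesis .
  qed
  have n\<delta>: "norm \<delta> \<le> \<tau>"
    using B(4) mult_left_mono[OF B(3) \<tau>0] by simp
  \<comment> \<open>The common second-order approximation.\<close>
  define T where "T = 1 + of_real m0 * (\<i> * of_real (\<theta> * \<alpha>) - of_real (\<theta>\<^sup>2 * \<beta> / 2)) - of_real (c2 * (\<theta> * \<alpha>)\<^sup>2)"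
  have r0: "remainder \<tau> \<ge> 0"
    unfolding remainder_def by (rule Bochner_Integration.integral_nonneg) (use \<tau>0 in auto)
  have 1: "norm (pgf (1 + \<delta>) - (1 + of_real m0 * \<delta> + of_real c2 * \<delta>\<^sup>2)) \<le> \<tau>\<^sup>2 * \<pi> * remainder \<tau>"
    using pgf_expansion[OF B(1) n\<delta>] mult_right_mono[OF \<delta>2 r0] unfolding c2_def by linarith
  have 2: "norm ((1 + of_real m0 * \<delta> + of_real c2 * \<delta>\<^sup>2) - T) \<le> m0 * (\<tau> ^ 3 * \<pi>) + 2 * \<bar>c2\<bar> * (\<tau> ^ 3 * \<pi>)"
  proof -
    have ii: "\<i> * of_real (\<theta> * \<alpha>) * (\<i> * of_real (\<theta> * \<alpha>)) = - of_real ((\<theta> * \<alpha>)\<^sup>2)"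
      by (simp add: complex_eq_iff power2_eq_square)
    have "(1 + of_real m0 * \<delta> + of_real c2 * \<delta>\<^sup>2) - T = of_real m0 * (\<delta> - (\<i> * of_real (\<theta> * \<alpha>) - of_real (\<theta>\<^sup>2 * \<beta> / 2)))
        + of_real c2 * ((\<delta> - \<i> * of_real (\<theta> * \<alpha>)) * (\<delta> + \<i> * of_real (\<theta> * \<alpha>)))"
      unfolding T_def using ii by (simp add: algebra_simps power2_eq_square)
    then have "norm ((1 + of_real m0 * \<delta> + of_real c2 * \<delta>\<^sup>2) - T) \<le>
        m0 * norm (\<delta> - (\<i> * of_real (\<theta> * \<alpha>) - of_real (\<theta>\<^sup>2 * \<beta> / 2))) + \<bar>c2\<bar> * (norm (\<delta> - \<i> * of_real (\<theta> * \<alpha>)) * norm (\<delta> + \<i> * of_real (\<theta> * \<alpha>)))"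
      using m by (simp only:) (rule order_trans[OF norm_triangle_ineq], simp add: norm_mult)
    also have "\<dots> \<le> m0 * (\<tau> ^ 3 * \<pi>) + \<bar>c2\<bar> * ((\<tau>\<^sup>2 * \<pi>) * (2 * \<tau>))"
    proof (intro add_mono mult_left_mono mult_mono B m)
      have "norm (\<delta> + \<i> * of_real (\<theta> * \<alpha>)) \<le> norm \<delta> + norm (\<i> * complex_of_real (\<theta> * \<alpha>))" by (rule norm_triangle_ineq)
      also have "norm (\<i> * complex_of_real (\<theta> * \<alpha>)) = \<bar>\<theta> * \<alpha>\<bar>" by (simp only: norm_mult norm_ii norm_of_real mult_1)
      finally show "norm (\<delta> + \<i> * of_real (\<theta> * \<alpha>)) \<le> 2 * \<tau>" using n\<delta> \<theta>\<alpha> mult_left_mono[OF B(3) \<tau>0] by simp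
    qed (use \<tau>0 B(2) in auto)
    also have "\<dots> = m0 * (\<tau> ^ 3 * \<pi>) + 2 * \<bar>c2\<bar> * (\<tau> ^ 3 * \<pi>)" by (simp add: t3(1)[symmetric])
    finally show ?thesis .
  qed
  have \<alpha>A: "\<alpha>\<^sup>2 \<le> A\<^sup>2 * \<pi>" using B(8,9) by linarith
  have w0: "w \<ge> 0" unfolding w_def site_variance_def using m v B(9) by simp
  have wA: "w \<le> 2 * W * (A\<^sup>2 * \<pi>)"
  proof -
    have "w \<le> m0 * (A\<^sup>2 * \<pi>) + v0 * (A\<^sup>2 * \<pi>)"
      unfolding w_def site_variance_def using m v B(8) \<alpha>A zero_le_power2[of \<alpha>] by (intro add_mono mult_left_mono) linarith+
    then show ?thesis by (simp add: W_def algebra_simps)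
  qed
  define z where "z = \<i> * of_real (m0 * (\<theta> * \<alpha>)) - of_real (\<theta>\<^sup>2 * w / 2)"
  have tw: "\<theta>\<^sup>2 * w / 2 \<le> W * (\<tau>\<^sup>2 * \<pi>)"
  proof -
    have "\<theta>\<^sup>2 * w \<le> \<theta>\<^sup>2 * (2 * W * (A\<^sup>2 * \<pi>))" by (rule mult_left_mono[OF wA]) simp
    also have "\<dots> = 2 * (W * (\<tau>\<^sup>2 * \<pi>))" unfolding \<tau>A(2)[symmetric] by simp
    finally show ?thesis by simp
  qed
  have tw0: "\<theta>\<^sup>2 * w / 2 \<ge> 0" using w0 by simp
  have \<tau>2\<pi>: "\<tau>\<^sup>2 * \<pi> \<le> 1"
    using \<tau>0 \<tau>1 B(2,3) by (intro mult_le_one power_le_one) auto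
  have \<tau>\<tau>: "\<tau>\<^sup>2 \<le> \<tau>" using \<tau>0 \<tau>1 by (simp add: power2_eq_square mult_left_le_one_le)
  have nz: "norm z \<le> (m0 + W) * (\<tau> * \<pi>)"
  proof -
    have "norm z \<le> norm (\<i> * complex_of_real (m0 * (\<theta> * \<alpha>))) + norm (complex_of_real (\<theta>\<^sup>2 * w / 2))"
      unfolding z_def by (rule norm_triangle_ineq4)
    also have "norm (\<i> * complex_of_real (m0 * (\<theta> * \<alpha>))) = m0 * \<bar>\<theta> * \<alpha>\<bar>"
      using m by (simp only: norm_mult norm_ii norm_of_real mult_1 abs_mult abs_of_nonneg)
    also have "norm (complex_of_real (\<theta>\<^sup>2 * w / 2)) = \<theta>\<^sup>2 * w / 2" using tw0 by (simp only: norm_of_real abs_of_nonneg)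
    also have "m0 * \<bar>\<theta> * \<alpha>\<bar> + \<theta>\<^sup>2 * w / 2 \<le> m0 * (\<tau> * \<pi>) + W * (\<tau> * \<pi>)"
    proof (intro add_mono mult_left_mono m \<theta>\<alpha>)
      show "\<theta>\<^sup>2 * w / 2 \<le> W * (\<tau> * \<pi>)"
        by (rule order_trans[OF tw]) (intro mult_left_mono mult_right_mono \<tau>\<tau> B W)
    qed
    finally show ?thesis by (simp add: algebra_simps)
  qed
  have Rez: "\<bar>Re z\<bar> \<le> W"
  proof -
    have "\<bar>Re z\<bar> = \<theta>\<^sup>2 * w / 2" using tw0 by (simp add: z_def)
    also have "\<dots> \<le> W * 1" by (rule order_trans[OF tw]) (intro mult_left_mono \<tau>2\<pi> W)
    finally show ?thesis by simp
  qed
  have \<pi>3: "\<pi> ^ 3 \<le> \<pi>" using \<pi>2 B(2,3) mult_right_mono[OF \<pi>2 B(2)] by (simp add: power3_eq_cube power2_eq_square)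
  have 3: "norm (exp z - (1 + z + z\<^sup>2 / 2)) \<le> exp W * (m0 + W) ^ 3 * (\<tau> ^ 3 * \<pi>)"
  proof -
    have "{..2::nat} = {0, 1, 2}" by auto
    then have s: "(\<Sum>i\<le>2. z ^ i / fact i) = 1 + z + z\<^sup>2 / 2" by (simp add: fact_numeral)
    have "norm (exp z - (1 + z + z\<^sup>2 / 2)) \<le> exp \<bar>Re z\<bar> * (norm z) ^ Suc 2 / fact 2"
      using Taylor_exp[of z 2] unfolding s .
    also have "\<dots> \<le> exp \<bar>Re z\<bar> * (norm z) ^ Suc 2 / 1"
      by (rule divide_left_mono) auto
    also have "\<dots> = exp \<bar>Re z\<bar> * (norm z) ^ 3" by (simp add: eval_nat_numeral)
    also have "\<dots> \<le> exp W * ((m0 + W) * (\<tau> * \<pi>)) ^ 3"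
      using Rez nz by (intro mult_mono power_mono) auto
    also have "\<dots> = (exp W * (m0 + W) ^ 3 * \<tau> ^ 3) * \<pi> ^ 3" by (simp add: power_mult_distrib)
    also have "\<dots> \<le> (exp W * (m0 + W) ^ 3 * \<tau> ^ 3) * \<pi>"
      using \<pi>3 m W \<tau>0 by (intro mult_left_mono) auto
    finally show ?thesis by (simp add: mult.assoc)
  qed
  have 4: "norm (T - (1 + z + z\<^sup>2 / 2)) \<le> W * (2 * m0 + W) * (\<tau> ^ 3 * \<pi>)"
  proof -
    define a where "a = \<i> * complex_of_real (m0 * (\<theta> * \<alpha>))"
    define b where "b = complex_of_real (\<theta>\<^sup>2 * w / 2)"
    have aa: "a * a = - of_real ((m0 * (\<theta> * \<alpha>))\<^sup>2)" by (simp add: a_def complex_eq_iff power2_eq_square)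
    have real: "m0 * (\<theta>\<^sup>2 * \<beta> / 2) + c2 * (\<theta> * \<alpha>)\<^sup>2 = \<theta>\<^sup>2 * w / 2 + (m0 * (\<theta> * \<alpha>))\<^sup>2 / 2"
      unfolding w_def site_variance_def c2_def by (simp add: power2_eq_square field_simps)
    have "T = 1 + a - of_real (m0 * (\<theta>\<^sup>2 * \<beta> / 2) + c2 * (\<theta> * \<alpha>)\<^sup>2)"
      unfolding T_def a_def of_real_add of_real_mult by (simp add: algebra_simps)
    also have "\<dots> = 1 + a - b + (a * a) / 2"
      unfolding real aa b_def by simp
    finally have Teq: "T = 1 + a - b + (a * a) / 2" .
    have zz: "z = a - b" by (simp add: z_def a_def b_def)
    have Tz: "T - (1 + z + z\<^sup>2 / 2) = b * (2 * a - b) / 2"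
      unfolding Teq zz by (simp add: power2_eq_square diff_divide_distrib add_divide_distrib algebra_simps)
    have nb: "norm b \<le> W * (\<tau>\<^sup>2 * \<pi>)" using tw tw0 unfolding b_def norm_of_real by simp
    have na: "norm (2 * a - b) \<le> 2 * (2 * m0 + W) * \<tau>"
    proof -
      have "norm (2 * a) \<le> 2 * m0 * \<tau>"
      proof -
        have "norm (2 * a) = 2 * (m0 * \<bar>\<theta> * \<alpha>\<bar>)"
          unfolding a_def using m by (simp add: norm_mult abs_mult)
        also have "\<dots> \<le> 2 * (m0 * (\<tau> * 1))"
          using \<theta>\<alpha> mult_left_mono[OF B(3) \<tau>0] m by (intro mult_left_mono) auto
        finally show ?thesis by simp
      qed
      moreover have "norm b \<le> W * \<tau>"
      proof (rule order_trans[OF nb], intro mult_left_mono W)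
        show "\<tau>\<^sup>2 * \<pi> \<le> \<tau>" using \<tau>\<tau> mult_left_mono[OF B(3), of "\<tau>\<^sup>2"] by simp
      qed
      ultimately have "norm (2 * a - b) \<le> 2 * m0 * \<tau> + W * \<tau>" using norm_triangle_ineq4[of "2 * a" b] by linarith
      also have "\<dots> \<le> 2 * (2 * m0 + W) * \<tau>" using m W \<tau>0 by (simp add: algebra_simps)
      finally show ?thesis .
    qed
    have "norm (T - (1 + z + z\<^sup>2 / 2)) = norm b * norm (2 * a - b) / 2"
      unfolding Tz by (simp add: norm_mult norm_divide)
    also have "\<dots> \<le> (W * (\<tau>\<^sup>2 * \<pi>)) * (2 * (2 * m0 + W) * \<tau>) / 2"
      using W \<tau>0 B(2) by (intro divide_right_mono mult_mono nb na) auto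
    also have "\<dots> = W * (2 * m0 + W) * (\<tau> ^ 3 * \<pi>)" by (simp add: t3(1)[symmetric])
    finally show ?thesis .
  qed
  have tri: "norm (p - e) \<le> norm (p - q) + norm (q - t) + norm (t - u) + norm (e - u)" for p q t u e :: complex
    using norm_triangle_ineq[of "p - q" "q - t"] norm_triangle_ineq[of "p - t" "t - u"]
      norm_triangle_ineq[of "p - u" "u - e"] norm_minus_commute[of u e] by simp
  have "norm (pgf (1 + \<delta>) - exp z) \<le> norm (pgf (1 + \<delta>) - (1 + of_real m0 * \<delta> + of_real c2 * \<delta>\<^sup>2)) +
      norm ((1 + of_real m0 * \<delta> + of_real c2 * \<delta>\<^sup>2) - T) + norm (T - (1 + z + z\<^sup>2 / 2)) + norm (exp z - (1 + z + z\<^sup>2 / 2))"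
    by (rule tri)
  also have "\<dots> \<le> \<tau>\<^sup>2 * \<pi> * remainder \<tau> + (m0 * (\<tau> ^ 3 * \<pi>) + 2 * \<bar>c2\<bar> * (\<tau> ^ 3 * \<pi>)) + W * (2 * m0 + W) * (\<tau> ^ 3 * \<pi>) + exp W * (m0 + W) ^ 3 * (\<tau> ^ 3 * \<pi>)"
    by (intro add_mono 1 2 3 4)
  also have "\<dots> = \<pi> * \<tau>\<^sup>2 * (remainder \<tau> + error_const * \<tau>)"
    unfolding error_const_def c2_def[symmetric] W_def[symmetric] t3(1)[symmetric] by (simp add: algebra_simps)
  finally show ?thesis by (simp add: \<delta>_def z_def w_def mult.assoc mult.left_commute)
qed

text \<open>All factors lie in the unit disc, so that products differ by at most the sum of the differences of the
factors. The product of the exponentials is explicit: its phases cancel against the centring factor.\<close>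

theorem triangular_product_limit:
  fixes g :: "nat \<Rightarrow> 'x \<Rightarrow> 'b \<Rightarrow> real"
  assumes finF: "\<And>n. finite (F n)" and finQ: "\<And>n. finite (set_pmf (Q n))"
    and g: "\<And>n x y. \<bar>g n x y\<bar> \<le> A" and \<theta>: "\<theta> \<longlonglongrightarrow> 0"
    and \<pi>: "\<And>n. (\<theta> n)\<^sup>2 * (\<Sum>x\<in>F n. measure_pmf.expectation (Q n) (\<lambda>y. of_bool (g n x y \<noteq> 0))) \<le> K"
    and V: "(\<lambda>n. (\<theta> n)\<^sup>2 * (\<Sum>x\<in>F n. site_variance (measure_pmf.expectation (Q n) (g n x)) (measure_pmf.expectation (Q n) (\<lambda>y. (g n x y)\<^sup>2)))) \<longlonglongrightarrow> V"
  shows "(\<lambda>n. (\<Prod>x\<in>F n. pgf (measure_pmf.expectation (Q n) (\<lambda>y. iexp (\<theta> n * g n x y)))) *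
      iexp (- (\<theta> n * m0 * (\<Sum>x\<in>F n. measure_pmf.expectation (Q n) (g n x))))) \<longlonglongrightarrow> of_real (exp (- V / 2))"
proof -
  let ?E = "\<lambda>n. measure_pmf.expectation (Q n)"
  have A: "A \<ge> 0" using g[of 0 undefined undefined] by linarith
  define \<alpha> where "\<alpha> n x = ?E n (g n x)" for n x
  define w where "w n x = site_variance (\<alpha> n x) (?E n (\<lambda>y. (g n x y)\<^sup>2))" for n x
  define \<pi>' where "\<pi>' n x = (?E n (\<lambda>y. of_bool (g n x y \<noteq> 0)) :: real)" for n x
  define m where "m n x = ?E n (\<lambda>y. iexp (\<theta> n * g n x y))" for n x
  define z where "z n x = \<i> * of_real (\<theta> n * m0 * \<alpha> n x) - of_real ((\<theta> n)\<^sup>2 * w n x / 2)" for n x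
  define \<tau> where "\<tau> n = \<bar>\<theta> n\<bar> * A" for n
  have \<tau>0: "\<tau> n \<ge> 0" for n using A by (simp add: \<tau>_def)
  have \<tau>lim: "\<tau> \<longlonglongrightarrow> 0" unfolding \<tau>_def using tendsto_mult[OF tendsto_rabs[OF \<theta>] tendsto_const[of A]] by simp
  have mle: "norm (m n x) \<le> 1" for n x
    unfolding m_def by (rule order_trans[OF integral_norm_bound]) simp
  have w0: "w n x \<ge> 0" for n x
    using bounded_site_expansion(9)[where \<theta>=0, OF finQ[of n] g[of n x] refl refl refl refl refl] m0_nonneg v0_nonneg
    unfolding w_def site_variance_def \<alpha>_def by simp
  have ez: "norm (exp (z n x)) \<le> 1" for n x using w0[of n x] by (simp add: z_def)
  have "(\<lambda>n. (\<Prod>x\<in>F n. pgf (m n x)) - (\<Prod>x\<in>F n. exp (z n x))) \<longlonglongrightarrow> 0"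
  proof (rule Lim_null_comparison)
    show "(\<lambda>n. K * A\<^sup>2 * (remainder (\<tau> n) + error_const * \<tau> n)) \<longlonglongrightarrow> 0"
      using tendsto_mult[OF tendsto_const[of "K * A\<^sup>2"] tendsto_add[OF remainder_tendsto[OF \<tau>lim \<tau>0] tendsto_mult[OF tendsto_const[of error_const] \<tau>lim]]] by simp
    have "\<forall>\<^sub>F n in sequentially. \<tau> n < 1" by (rule order_tendstoD[OF \<tau>lim]) simp
    then show "\<forall>\<^sub>F n in sequentially. norm ((\<Prod>x\<in>F n. pgf (m n x)) - (\<Prod>x\<in>F n. exp (z n x))) \<le> K * A\<^sup>2 * (remainder (\<tau> n) + error_const * \<tau> n)"
    proof eventually_elim
      case (elim n)
      define e where "e = remainder (\<tau> n) + error_const * \<tau> n"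
      have e0: "e \<ge> 0"
      proof -
        have "remainder (\<tau> n) \<ge> 0" unfolding remainder_def by (rule Bochner_Integration.integral_nonneg) (use \<tau>0 in auto)
        moreover have "error_const \<ge> 0" unfolding error_const_def using m0_nonneg v0_nonneg by simp
        ultimately show ?thesis using \<tau>0[of n] by (simp add: e_def)
      qed
      have "norm ((\<Prod>x\<in>F n. pgf (m n x)) - (\<Prod>x\<in>F n. exp (z n x))) \<le> (\<Sum>x\<in>F n. norm (pgf (m n x) - exp (z n x)))"
        by (rule norm_prod_diff) (use norm_pgf_le_1[OF mle] ez in auto)
      also have "\<dots> \<le> (\<Sum>x\<in>F n. \<pi>' n x * (\<tau> n)\<^sup>2 * e)"
        unfolding m_def z_def w_def \<alpha>_def \<pi>'_def e_def
        by (intro sum_mono site_estimate[OF finQ g]) (use elim in \<open>auto simp: \<tau>_def\<close>)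
      also have "\<dots> = ((\<theta> n)\<^sup>2 * (\<Sum>x\<in>F n. \<pi>' n x)) * (A\<^sup>2 * e)"
        unfolding \<tau>_def by (simp add: sum_distrib_left sum_distrib_right power_mult_distrib mult_ac)
      also have "\<dots> \<le> K * (A\<^sup>2 * e)" using \<pi>[of n] e0 unfolding \<pi>'_def by (intro mult_right_mono) auto
      finally show ?case by (simp add: e_def mult.assoc)
    qed
  qed
  then have "(\<lambda>n. ((\<Prod>x\<in>F n. pgf (m n x)) - (\<Prod>x\<in>F n. exp (z n x))) * iexp (- (\<theta> n * m0 * (\<Sum>x\<in>F n. \<alpha> n x)))) \<longlonglongrightarrow> 0"
    by (rule Lim_null_comparison[rotated, OF tendsto_norm_zero]) (simp add: norm_mult)
  moreover have "(\<lambda>n. (\<Prod>x\<in>F n. exp (z n x)) * iexp (- (\<theta> n * m0 * (\<Sum>x\<in>F n. \<alpha> n x)))) \<longlonglongrightarrow> of_real (exp (- V / 2))"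
  proof -
    have "(\<Prod>x\<in>F n. exp (z n x)) * iexp (- (\<theta> n * m0 * (\<Sum>x\<in>F n. \<alpha> n x))) = of_real (exp (- ((\<theta> n)\<^sup>2 * (\<Sum>x\<in>F n. w n x)) / 2))" for n
    proof -
      have "(\<Sum>x\<in>F n. z n x) = \<i> * of_real (\<theta> n * m0 * (\<Sum>x\<in>F n. \<alpha> n x)) - of_real ((\<theta> n)\<^sup>2 * (\<Sum>x\<in>F n. w n x) / 2)"
        unfolding z_def sum_subtractf by (simp add: sum_distrib_left sum_divide_distrib)
      then have "(\<Prod>x\<in>F n. exp (z n x)) * iexp (- (\<theta> n * m0 * (\<Sum>x\<in>F n. \<alpha> n x))) = exp (- of_real ((\<theta> n)\<^sup>2 * (\<Sum>x\<in>F n. w n x) / 2))"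
        unfolding exp_sum[OF finF, symmetric] exp_add[symmetric] by simp
      also have "\<dots> = exp (of_real (- ((\<theta> n)\<^sup>2 * (\<Sum>x\<in>F n. w n x)) / 2))" by simp
      finally show ?thesis by (simp only: exp_of_real)
    qed
    moreover have "(\<lambda>n. complex_of_real (exp (- ((\<theta> n)\<^sup>2 * (\<Sum>x\<in>F n. w n x)) / 2))) \<longlonglongrightarrow> of_real (exp (- V / 2))"
      using V unfolding w_def \<alpha>_def by (intro tendsto_intros) auto
    ultimately show ?thesis by simp
  qed
  ultimately have "(\<lambda>n. ((\<Prod>x\<in>F n. pgf (m n x)) - (\<Prod>x\<in>F n. exp (z n x))) * iexp (- (\<theta> n * m0 * (\<Sum>x\<in>F n. \<alpha> n x))) +
      (\<Prod>x\<in>F n. exp (z n x)) * iexp (- (\<theta> n * m0 * (\<Sum>x\<in>F n. \<alpha> n x)))) \<longlonglongrightarrow> 0 + of_real (exp (- V / 2))"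
    by (rule tendsto_add)
  then show ?thesis unfolding m_def \<alpha>_def by (simp add: left_diff_distrib)
qed

end

section \<open>Sums over the starting sites\<close>

text \<open>The contribution to the current of a particle from \<open>x\<close>: it is \<open>1\<close> for a crossing from the left, where
\<open>c < x \<le> 0\<close>, and \<open>-1\<close> for a crossing from the right, where \<open>0 < x \<le> c\<close>.\<close>

definition crossing :: "int \<Rightarrow> int \<Rightarrow> real" where
  "crossing c x = of_bool (x \<le> 0) - of_bool (x \<le> c)"

lemma crossing_bounds: "\<bar>crossing c x\<bar> \<le> 1" "crossing c x * crossing c x = of_bool (crossing c x \<noteq> 0)"
  by (auto simp: crossing_def)

text \<open>The product is the indicator of an interval between \<open>0\<close> and the one of \<open>c\<close>, \<open>d\<close> that is nearer to \<open>0\<close> if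
both have the same sign, and zero otherwise. The right-hand side expresses the length of this interval by
positive parts.\<close>

lemma sum_crossing_product:
  assumes "\<bar>c\<bar> \<le> L" "\<bar>d\<bar> \<le> L"
  shows "(\<Sum>x\<in>{- L..L}. crossing c x * crossing d x) =
    max 0 (real_of_int c) + max 0 (- real_of_int d) - max 0 (real_of_int c - real_of_int d)"
proof -
  have card: "(\<Sum>x\<in>{- L..L}. of_bool (x \<in> A)) = real (card A)" if "A \<subseteq> {- L..L}" for A
    using that by (simp add: Int_absorb1 sum.If_cases of_bool_def if_distrib)
  \<comment> \<open>By the signs of \<open>c\<close> and \<open>d\<close>: the counted interval is \<open>{0<..min c d}\<close>, \<open>{max c d<..0}\<close> or empty.\<close>
  consider "c \<ge> 0 \<and> d \<ge> 0" | "c < 0 \<and> d < 0" | "c \<ge> 0 \<and> d < 0" | "c < 0 \<and> d \<ge> 0" by linarith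
  then show ?thesis
  proof cases
    case 1
    have "(\<Sum>x\<in>{- L..L}. crossing c x * crossing d x) = (\<Sum>x\<in>{- L..L}. of_bool (x \<in> {0<..min c d}))"
      using 1 by (intro sum.cong) (auto simp: crossing_def)
    also have "\<dots> = real (card {0<..min c d})" using 1 assms by (intro card) auto
    finally show ?thesis using 1 by (auto simp: min_def max_def)
  next
    case 2
    have "(\<Sum>x\<in>{- L..L}. crossing c x * crossing d x) = (\<Sum>x\<in>{- L..L}. of_bool (x \<in> {max c d<..0}))"
      using 2 by (intro sum.cong) (auto simp: crossing_def)
    also have "\<dots> = real (card {max c d<..0})" using 2 assms by (intro card) auto
    finally show ?thesis using 2 by (auto simp: min_def max_def)
  next
    case 3
    have "(\<Sum>x\<in>{- L..L}. crossing c x * crossing d x) = 0"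
      using 3 by (intro sum.neutral) (auto simp: crossing_def)
    then show ?thesis using 3 by (auto simp: max_def)
  next
    case 4
    have "(\<Sum>x\<in>{- L..L}. crossing c x * crossing d x) = 0"
      using 4 by (intro sum.neutral) (auto simp: crossing_def)
    then show ?thesis using 4 by (auto simp: max_def)
  qed
qed

context finite_steps
begin

lemma sum_crossing_same_walk:
  assumes i: "\<And>\<xi>. \<xi> \<in> set_pmf (steps p K) \<Longrightarrow> \<bar>excess i n \<xi>\<bar> \<le> L"
    and j: "\<And>\<xi>. \<xi> \<in> set_pmf (steps p K) \<Longrightarrow> \<bar>excess j n \<xi>\<bar> \<le> L"
  shows "(\<Sum>x\<in>{- L..L}. measure_pmf.expectation (steps p K) (\<lambda>\<xi>. crossing (excess i n \<xi>) x * crossing (excess j n \<xi>) x)) =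
    measure_pmf.expectation (steps p K) (\<lambda>\<xi>. max 0 (real_of_int (excess i n \<xi>)))
    + measure_pmf.expectation (steps p K) (\<lambda>\<xi>. max 0 (- real_of_int (excess j n \<xi>)))
    - measure_pmf.expectation (steps p K) (\<lambda>\<xi>. max 0 (real_of_int (excess i n \<xi>) - real_of_int (excess j n \<xi>)))"
proof -
  have "(\<Sum>x\<in>{- L..L}. measure_pmf.expectation (steps p K) (\<lambda>\<xi>. crossing (excess i n \<xi>) x * crossing (excess j n \<xi>) x)) =
      measure_pmf.expectation (steps p K) (\<lambda>\<xi>. \<Sum>x\<in>{- L..L}. crossing (excess i n \<xi>) x * crossing (excess j n \<xi>) x)"
    by (rule Bochner_Integration.integral_sum[symmetric]) simp
  also have "\<dots> = measure_pmf.expectation (steps p K) (\<lambda>\<xi>. max 0 (real_of_int (excess i n \<xi>)) + max 0 (- real_of_int (excess j n \<xi>))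
      - max 0 (real_of_int (excess i n \<xi>) - real_of_int (excess j n \<xi>)))"
    by (rule integral_cong_AE) (auto simp: AE_measure_pmf_iff intro!: sum_crossing_product i j)
  finally show ?thesis by simp
qed

lemma sum_crossing_independent_walks:
  assumes i: "\<And>\<xi>. \<xi> \<in> set_pmf (steps p K) \<Longrightarrow> \<bar>excess i n \<xi>\<bar> \<le> L"
    and j: "\<And>\<xi>. \<xi> \<in> set_pmf (steps p K) \<Longrightarrow> \<bar>excess j n \<xi>\<bar> \<le> L"
  shows "(\<Sum>x\<in>{- L..L}. measure_pmf.expectation (steps p K) (\<lambda>\<xi>. crossing (excess i n \<xi>) x) *
      measure_pmf.expectation (steps p K) (\<lambda>\<xi>. crossing (excess j n \<xi>) x)) =
    measure_pmf.expectation (steps p K) (\<lambda>\<xi>. max 0 (real_of_int (excess i n \<xi>)))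
    + measure_pmf.expectation (steps p K) (\<lambda>\<xi>. max 0 (- real_of_int (excess j n \<xi>)))
    - measure_pmf.expectation (pair_pmf (steps p K) (steps p K))
        (\<lambda>(\<xi>, \<xi>'). max 0 (real_of_int (excess i n \<xi>) - real_of_int (excess j n \<xi>')))"
proof -
  have fin: "finite (set_pmf (steps p K))" by (rule finite_set_pmf_steps[OF finite_p])
  note E = expectation_pair_pmf_finite[OF fin fin]
  have int[simp]: "integrable (measure_pmf (pair_pmf (steps p K) (steps p K))) f" for f :: "_ \<Rightarrow> 'c::{banach, second_countable_topology}"
    by (rule integrable_measure_pmf_finite) (simp add: fin)
  let ?P = "measure_pmf (pair_pmf (steps p K) (steps p K))"
  have "(\<Sum>x\<in>{- L..L}. measure_pmf.expectation (steps p K) (\<lambda>\<xi>. crossing (excess i n \<xi>) x) *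
      measure_pmf.expectation (steps p K) (\<lambda>\<xi>. crossing (excess j n \<xi>) x)) =
      (\<Sum>x\<in>{- L..L}. (LINT z|?P. crossing (excess i n (fst z)) x * crossing (excess j n (snd z)) x))"
    by (simp add: E)
  also have "\<dots> = (LINT z|?P. (\<Sum>x\<in>{- L..L}. crossing (excess i n (fst z)) x * crossing (excess j n (snd z)) x))"
    by (rule Bochner_Integration.integral_sum[symmetric]) simp
  also have "\<dots> = (LINT z|?P. max 0 (real_of_int (excess i n (fst z))) + max 0 (- real_of_int (excess j n (snd z)))
      - max 0 (real_of_int (excess i n (fst z)) - real_of_int (excess j n (snd z))))"
    by (rule integral_cong_AE) (auto simp: AE_measure_pmf_iff intro!: sum_crossing_product i j)
  also have "\<dots> = (LINT z|?P. max 0 (real_of_int (excess i n (fst z)))) + (LINT z|?P. max 0 (- real_of_int (excess j n (snd z))))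
      - (LINT z|?P. max 0 (real_of_int (excess i n (fst z)) - real_of_int (excess j n (snd z))))"
    by simp
  finally show ?thesis by (simp add: split_beta' E)
qed

text \<open>The difference of the two limits is \<open>Gamma1\<close>: the one-walk terms cancel in the covariance, and only
the expected positive parts of the differences of walks remain.\<close>

lemma crossing_limits:
  assumes i: "fst i \<ge> 0" and j: "fst j \<ge> 0"
    and Ki: "\<And>n. ptime (fst i) n \<le> K n" and Kj: "\<And>n. ptime (fst j) n \<le> K n"
    and Li: "\<And>n \<xi>. \<xi> \<in> set_pmf (steps p (K n)) \<Longrightarrow> \<bar>excess i n \<xi>\<bar> \<le> L n"
    and Lj: "\<And>n \<xi>. \<xi> \<in> set_pmf (steps p (K n)) \<Longrightarrow> \<bar>excess j n \<xi>\<bar> \<le> L n"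
  shows "(\<lambda>n. (\<Sum>x\<in>{- L n..L n}. measure_pmf.expectation (steps p (K n)) (\<lambda>\<xi>. crossing (excess i n \<xi>) x * crossing (excess j n \<xi>) x)) / sqrt (real n))
      \<longlonglongrightarrow> Gamma1 s2 i j + Gamma2 s2 i j"
    and "(\<lambda>n. (\<Sum>x\<in>{- L n..L n}. measure_pmf.expectation (steps p (K n)) (\<lambda>\<xi>. crossing (excess i n \<xi>) x) *
        measure_pmf.expectation (steps p (K n)) (\<lambda>\<xi>. crossing (excess j n \<xi>) x)) / sqrt (real n))
      \<longlonglongrightarrow> Gamma2 s2 i j"
proof -
  have G2: "Gamma2 s2 i j = Psi (s2 * fst i) (- snd i) + Psi (s2 * fst j) (snd j) - Psi (s2 * (fst j + fst i)) (snd j - snd i)"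
    by (simp add: Gamma2_def split_beta)
  have G1: "Gamma1 s2 i j = Psi (s2 * (fst j + fst i)) (snd j - snd i) - Psi (s2 * \<bar>fst j - fst i\<bar>) (snd j - snd i)"
    by (simp add: Gamma1_def split_beta)
  let ?E = "\<lambda>n. measure_pmf.expectation (steps p (K n))"
  have ind: "(\<Sum>x\<in>{- L n..L n}. ?E n (\<lambda>\<xi>. crossing (excess i n \<xi>) x) * ?E n (\<lambda>\<xi>. crossing (excess j n \<xi>) x)) =
      ?E n (\<lambda>\<xi>. max 0 (real_of_int (excess i n \<xi>))) + ?E n (\<lambda>\<xi>. max 0 (- real_of_int (excess j n \<xi>)))
      - measure_pmf.expectation (pair_pmf (steps p (K n)) (steps p (K n)))
          (\<lambda>(\<xi>, \<xi>'). max 0 (real_of_int (excess i n \<xi>) - real_of_int (excess j n \<xi>')))" for n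
    by (rule sum_crossing_independent_walks) (erule Li Lj)+
  have same: "(\<Sum>x\<in>{- L n..L n}. ?E n (\<lambda>\<xi>. crossing (excess i n \<xi>) x * crossing (excess j n \<xi>) x)) =
      ?E n (\<lambda>\<xi>. max 0 (real_of_int (excess i n \<xi>))) + ?E n (\<lambda>\<xi>. max 0 (- real_of_int (excess j n \<xi>)))
      - ?E n (\<lambda>\<xi>. max 0 (real_of_int (excess i n \<xi>) - real_of_int (excess j n \<xi>)))" for n
    by (rule sum_crossing_same_walk) (erule Li Lj)+
  show "(\<lambda>n. (\<Sum>x\<in>{- L n..L n}. measure_pmf.expectation (steps p (K n)) (\<lambda>\<xi>. crossing (excess i n \<xi>) x) *
        measure_pmf.expectation (steps p (K n)) (\<lambda>\<xi>. crossing (excess j n \<xi>) x)) / sqrt (real n))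
      \<longlonglongrightarrow> Gamma2 s2 i j"
    unfolding ind G2 add_divide_distrib diff_divide_distrib
    by (intro tendsto_add tendsto_diff excess_pos_limit excess_neg_limit excess_independent_limit i j Ki Kj)
  have "Gamma1 s2 i j + Gamma2 s2 i j = Psi (s2 * fst i) (- snd i) + Psi (s2 * fst j) (snd j) - Psi (s2 * \<bar>fst j - fst i\<bar>) (snd j - snd i)"
    by (simp add: G1 G2)
  then show "(\<lambda>n. (\<Sum>x\<in>{- L n..L n}. measure_pmf.expectation (steps p (K n)) (\<lambda>\<xi>. crossing (excess i n \<xi>) x * crossing (excess j n \<xi>) x)) / sqrt (real n))
      \<longlonglongrightarrow> Gamma1 s2 i j + Gamma2 s2 i j"
    unfolding same add_divide_distrib diff_divide_distrib
    by (simp only:) (intro tendsto_add tendsto_diff excess_pos_limit excess_neg_limit excess_same_limit i j Ki Kj)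
qed

end

text \<open>The two sources of randomness side by side, occupation variables and steps.\<close>

locale current_model = occupation M \<eta>0 + finite_steps p v s2
  for M :: "'a measure" and \<eta>0 p v s2
begin

definition cov :: "real \<times> real \<Rightarrow> real \<times> real \<Rightarrow> real" where
  "cov i j = m0 * Gamma1 s2 i j + v0 * Gamma2 s2 i j"

definition score :: "(real \<times> real) set \<Rightarrow> (real \<times> real \<Rightarrow> real) \<Rightarrow> nat \<Rightarrow> int \<Rightarrow> (nat \<Rightarrow> int) \<Rightarrow> real" where
  "score J a n x \<xi> = (\<Sum>j\<in>J. a j * crossing (excess j n \<xi>) x)"

text \<open>The scores are linear in the weights, so that sums over sites of their variances are quadratic forms in
the weights whose coefficients converge by \<open>crossing_limits\<close>. The diagonal coefficients also bound the
number of contributing sites, because squared contributions are indicators.\<close>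

theorem site_product_limit:
  assumes J: "finite J" "\<And>j. j \<in> J \<Longrightarrow> fst j \<ge> 0" and K: "\<And>n j. j \<in> J \<Longrightarrow> ptime (fst j) n \<le> K n"
    and L: "\<And>n j \<xi>. j \<in> J \<Longrightarrow> \<xi> \<in> set_pmf (steps p (K n)) \<Longrightarrow> \<bar>excess j n \<xi>\<bar> \<le> L n"
  shows "(\<lambda>n. (\<Prod>x\<in>{- L n..L n}. pgf (measure_pmf.expectation (steps p (K n)) (\<lambda>\<xi>. iexp (real n powr (- 1 / 4) * score J a n x \<xi>)))) *
      iexp (- (real n powr (- 1 / 4) * m0 * (\<Sum>x\<in>{- L n..L n}. measure_pmf.expectation (steps p (K n)) (score J a n x)))))
    \<longlonglongrightarrow> of_real (exp (- (\<Sum>i\<in>J. \<Sum>j\<in>J. a i * a j * cov i j) / 2))"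
proof -
  let ?E = "\<lambda>n. measure_pmf.expectation (steps p (K n))"
  define \<theta> where "\<theta> n = real n powr (- 1 / 4)" for n
  have \<theta>2: "(\<theta> n)\<^sup>2 = 1 / sqrt (real n)" for n
  proof -
    have "(\<theta> n)\<^sup>2 = real n powr (- 1 / 4 + - 1 / 4)"
      unfolding \<theta>_def power2_eq_square powr_add ..
    also have "- 1 / 4 + - 1 / 4 = - (1 / 2 :: real)" by simp
    finally show ?thesis by (simp add: powr_minus_divide powr_half_sqrt)
  qed
  have \<theta>0: "\<theta> \<longlonglongrightarrow> 0" unfolding \<theta>_def by real_asymp
  have fin: "finite (set_pmf (steps p k))" for k by (rule finite_set_pmf_steps[OF finite_p])
  define A where "A = (\<Sum>j\<in>J. \<bar>a j\<bar>)"
  have gA: "\<bar>score J a n x \<xi>\<bar> \<le> A" for n x \<xi>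
  proof -
    have "\<bar>score J a n x \<xi>\<bar> \<le> (\<Sum>j\<in>J. \<bar>a j * crossing (excess j n \<xi>) x\<bar>)" unfolding score_def by (rule sum_abs)
    also have "\<dots> \<le> (\<Sum>j\<in>J. \<bar>a j\<bar> * 1)" unfolding abs_mult by (intro sum_mono mult_left_mono crossing_bounds) auto
    finally show ?thesis by (simp add: A_def)
  qed
  define P where "P i j n = (\<Sum>x\<in>{- L n..L n}. ?E n (\<lambda>\<xi>. crossing (excess i n \<xi>) x * crossing (excess j n \<xi>) x)) / sqrt (real n)" for i j n
  define R where "R i j n = (\<Sum>x\<in>{- L n..L n}. ?E n (\<lambda>\<xi>. crossing (excess i n \<xi>) x) * ?E n (\<lambda>\<xi>. crossing (excess j n \<xi>) x)) / sqrt (real n)" for i j n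
  have Plim: "P i j \<longlonglongrightarrow> Gamma1 s2 i j + Gamma2 s2 i j" and Rlim: "R i j \<longlonglongrightarrow> Gamma2 s2 i j" if "i \<in> J" "j \<in> J" for i j
    unfolding P_def[abs_def] R_def[abs_def]
    by (rule crossing_limits; use that J K L in blast)+
  have "\<exists>C. \<forall>n. (\<Sum>j\<in>J. P j j n) \<le> C"
  proof -
    have "(\<lambda>n. \<Sum>j\<in>J. P j j n) \<longlonglongrightarrow> (\<Sum>j\<in>J. Gamma1 s2 j j + Gamma2 s2 j j)" by (intro tendsto_sum Plim)
    from convergent_imp_Bseq[OF convergentI[OF this]] obtain C where "\<And>n. norm (\<Sum>j\<in>J. P j j n) \<le> C" by (auto simp: Bseq_def)
    then show ?thesis by (intro exI[of _ C]) (auto simp: abs_le_iff)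
  qed
  then obtain C where C: "\<And>n. (\<Sum>j\<in>J. P j j n) \<le> C" by blast
  have Eg: "?E n (score J a n x) = (\<Sum>j\<in>J. a j * ?E n (\<lambda>\<xi>. crossing (excess j n \<xi>) x))" for n x
    unfolding score_def by (subst Bochner_Integration.integral_sum) simp_all
  have Eg2: "?E n (\<lambda>\<xi>. (score J a n x \<xi>)\<^sup>2) = (\<Sum>i\<in>J. \<Sum>j\<in>J. a i * a j * ?E n (\<lambda>\<xi>. crossing (excess i n \<xi>) x * crossing (excess j n \<xi>) x))" for n x
  proof -
    have "(score J a n x \<xi>)\<^sup>2 = (\<Sum>i\<in>J. \<Sum>j\<in>J. a i * a j * (crossing (excess i n \<xi>) x * crossing (excess j n \<xi>) x))" for \<xi>
      unfolding score_def power2_eq_square sum_product by (intro sum.cong refl) (simp add: mult_ac)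
    then show ?thesis by (simp add: Bochner_Integration.integral_sum)
  qed
  have "(\<lambda>n. (\<Prod>x\<in>{- L n..L n}. pgf (?E n (\<lambda>\<xi>. iexp (\<theta> n * score J a n x \<xi>)))) *
      iexp (- (\<theta> n * m0 * (\<Sum>x\<in>{- L n..L n}. ?E n (score J a n x)))))
    \<longlonglongrightarrow> of_real (exp (- (\<Sum>i\<in>J. \<Sum>j\<in>J. a i * a j * cov i j) / 2))"
  proof (rule triangular_product_limit[OF _ fin gA \<theta>0])
    show "(\<theta> n)\<^sup>2 * (\<Sum>x\<in>{- L n..L n}. ?E n (\<lambda>\<xi>. of_bool (score J a n x \<xi> \<noteq> 0))) \<le> C" for n
    proof -
      have "?E n (\<lambda>\<xi>. of_bool (score J a n x \<xi> \<noteq> 0)) \<le> (\<Sum>j\<in>J. ?E n (\<lambda>\<xi>. crossing (excess j n \<xi>) x * crossing (excess j n \<xi>) x))" for x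
      proof -
        have "(of_bool (score J a n x \<xi> \<noteq> 0) :: real) \<le> (\<Sum>j\<in>J. crossing (excess j n \<xi>) x * crossing (excess j n \<xi>) x)" for \<xi>
        proof (cases "score J a n x \<xi> = 0")
          case False
          then obtain j where j: "j \<in> J" "crossing (excess j n \<xi>) x \<noteq> 0"
            unfolding score_def by (metis (no_types, lifting) mult_zero_right sum.neutral)
          then have "1 \<le> crossing (excess j n \<xi>) x * crossing (excess j n \<xi>) x" by (simp add: crossing_bounds(2))
          also have "\<dots> \<le> (\<Sum>j\<in>J. crossing (excess j n \<xi>) x * crossing (excess j n \<xi>) x)"
            using j(1) J(1) by (intro member_le_sum) auto
          finally show ?thesis using False by simp
        qed (simp add: sum_nonneg)
        then have "?E n (\<lambda>\<xi>. of_bool (score J a n x \<xi> \<noteq> 0)) \<le> ?E n (\<lambda>\<xi>. \<Sum>j\<in>J. crossing (excess j n \<xi>) x * crossing (excess j n \<xi>) x)"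
          by (intro integral_mono) simp_all
        then show ?thesis by (simp add: Bochner_Integration.integral_sum)
      qed
      then have "(\<Sum>x\<in>{- L n..L n}. ?E n (\<lambda>\<xi>. of_bool (score J a n x \<xi> \<noteq> 0))) \<le>
          (\<Sum>x\<in>{- L n..L n}. \<Sum>j\<in>J. ?E n (\<lambda>\<xi>. crossing (excess j n \<xi>) x * crossing (excess j n \<xi>) x))"
        by (rule sum_mono)
      then have "(\<theta> n)\<^sup>2 * (\<Sum>x\<in>{- L n..L n}. ?E n (\<lambda>\<xi>. of_bool (score J a n x \<xi> \<noteq> 0))) \<le>
          (\<theta> n)\<^sup>2 * (\<Sum>x\<in>{- L n..L n}. \<Sum>j\<in>J. ?E n (\<lambda>\<xi>. crossing (excess j n \<xi>) x * crossing (excess j n \<xi>) x))"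
        by (rule mult_left_mono) simp
      also have "\<dots> = (\<Sum>j\<in>J. P j j n)"
        unfolding \<theta>2 P_def by (subst sum.swap) (simp add: sum_divide_distrib)
      finally show ?thesis using C[of n] by linarith
    qed
    have e: "(\<theta> n)\<^sup>2 * (\<Sum>x\<in>{- L n..L n}. site_variance (?E n (score J a n x)) (?E n (\<lambda>\<xi>. (score J a n x \<xi>)\<^sup>2))) =
        (\<Sum>i\<in>J. \<Sum>j\<in>J. a i * a j * (m0 * (P i j n - R i j n) + v0 * R i j n))" for n
    proof -
      have sq: "(?E n (score J a n x))\<^sup>2 = (\<Sum>i\<in>J. \<Sum>j\<in>J. a i * a j * (?E n (\<lambda>\<xi>. crossing (excess i n \<xi>) x) * ?E n (\<lambda>\<xi>. crossing (excess j n \<xi>) x)))" for x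
        unfolding Eg power2_eq_square sum_product by (intro sum.cong refl) (simp add: mult_ac)
      let ?p = "\<lambda>x i j. ?E n (\<lambda>\<xi>. crossing (excess i n \<xi>) x * crossing (excess j n \<xi>) x)"
      let ?r = "\<lambda>x i j. ?E n (\<lambda>\<xi>. crossing (excess i n \<xi>) x) * ?E n (\<lambda>\<xi>. crossing (excess j n \<xi>) x)"
      have "site_variance (?E n (score J a n x)) (?E n (\<lambda>\<xi>. (score J a n x \<xi>)\<^sup>2)) =
          (\<Sum>i\<in>J. \<Sum>j\<in>J. a i * a j * (m0 * (?p x i j - ?r x i j) + v0 * ?r x i j))" for x
        unfolding site_variance_def sq Eg2
        by (simp add: sum_distrib_left sum.distrib[symmetric] sum_subtractf[symmetric] algebra_simps)
      then have "(\<Sum>x\<in>{- L n..L n}. site_variance (?E n (score J a n x)) (?E n (\<lambda>\<xi>. (score J a n x \<xi>)\<^sup>2))) =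
          (\<Sum>x\<in>{- L n..L n}. \<Sum>i\<in>J. \<Sum>j\<in>J. a i * a j * (m0 * (?p x i j - ?r x i j) + v0 * ?r x i j))" by simp
      also have "\<dots> = (\<Sum>i\<in>J. \<Sum>j\<in>J. \<Sum>x\<in>{- L n..L n}. a i * a j * (m0 * (?p x i j - ?r x i j) + v0 * ?r x i j))"
        by (subst sum.swap) (rule sum.cong[OF refl], rule sum.swap)
      also have "\<dots> = (\<Sum>i\<in>J. \<Sum>j\<in>J. a i * a j * (m0 * ((\<Sum>x\<in>{- L n..L n}. ?p x i j) - (\<Sum>x\<in>{- L n..L n}. ?r x i j)) + v0 * (\<Sum>x\<in>{- L n..L n}. ?r x i j)))"
        by (simp add: sum_distrib_left[symmetric] sum.distrib sum_subtractf)
      finally have F: "(\<Sum>x\<in>{- L n..L n}. site_variance (?E n (score J a n x)) (?E n (\<lambda>\<xi>. (score J a n x \<xi>)\<^sup>2))) =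
        (\<Sum>i\<in>J. \<Sum>j\<in>J. a i * a j * (m0 * ((\<Sum>x\<in>{- L n..L n}. ?p x i j) - (\<Sum>x\<in>{- L n..L n}. ?r x i j)) + v0 * (\<Sum>x\<in>{- L n..L n}. ?r x i j)))" .
      have gen: "1 / s * (\<Sum>i\<in>J. \<Sum>j\<in>J. a i * a j * (m0 * (A i j - B i j) + v0 * B i j)) =
          (\<Sum>i\<in>J. \<Sum>j\<in>J. a i * a j * (m0 * (A i j / s - B i j / s) + v0 * (B i j / s)))" for s and A B :: "real \<times> real \<Rightarrow> real \<times> real \<Rightarrow> real"
        unfolding sum_distrib_left by (intro sum.cong refl) (simp add: divide_inverse algebra_simps)
      show ?thesis unfolding F \<theta>2 P_def R_def by (rule gen)
    qed
    have "(\<lambda>n. \<Sum>i\<in>J. \<Sum>j\<in>J. a i * a j * (m0 * (P i j n - R i j n) + v0 * R i j n)) \<longlonglongrightarrow>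
        (\<Sum>i\<in>J. \<Sum>j\<in>J. a i * a j * (m0 * ((Gamma1 s2 i j + Gamma2 s2 i j) - Gamma2 s2 i j) + v0 * Gamma2 s2 i j))"
      by (intro tendsto_sum tendsto_mult tendsto_add tendsto_diff tendsto_const Plim Rlim)
    then show "(\<lambda>n. (\<theta> n)\<^sup>2 * (\<Sum>x\<in>{- L n..L n}. site_variance (?E n (score J a n x)) (?E n (\<lambda>\<xi>. (score J a n x \<xi>)\<^sup>2))))
       \<longlonglongrightarrow> (\<Sum>i\<in>J. \<Sum>j\<in>J. a i * a j * cov i j)"
      unfolding e by (simp add: cov_def)
  qed simp
  then show ?thesis unfolding \<theta>_def .
qed

end

section \<open>Independence of occupation variables and walks\<close>

text \<open>The sum equals \<open>enn2real\<close> of the supremum of the finite partial sums, also where it diverges, since both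
sides are \<open>0\<close> there.\<close>

lemma borel_measurable_infsum_nonneg:
  fixes f :: "'i::countable \<Rightarrow> 'a \<Rightarrow> real"
  assumes f[measurable]: "\<And>x. f x \<in> borel_measurable M" and nn: "\<And>x \<omega>. 0 \<le> f x \<omega>"
  shows "(\<lambda>\<omega>. infsum (\<lambda>x. f x \<omega>) A) \<in> borel_measurable M"
proof -
  let ?S = "\<lambda>\<omega>. SUP F\<in>{F. finite F \<and> F \<subseteq> A}. ennreal (\<Sum>x\<in>F. f x \<omega>)"
  have eq: "infsum (\<lambda>x. f x \<omega>) A = enn2real (?S \<omega>)" for \<omega>
  proof (cases "(\<lambda>x. f x \<omega>) summable_on A")
    case True
    have "ennreal (infsum (\<lambda>x. f x \<omega>) A) = ?S \<omega>"
      by (rule infsum_nonneg_is_SUPREMUM_ennreal[OF True]) (rule nn)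
    then have "enn2real (?S \<omega>) = enn2real (ennreal (infsum (\<lambda>x. f x \<omega>) A))" by (simp only:)
    then show ?thesis by (simp add: infsum_nonneg nn)
  next
    case False
    have "?S \<omega> = top"
    proof (rule ccontr)
      assume "?S \<omega> \<noteq> top"
      then obtain B where B: "?S \<omega> = ennreal B" "B \<ge> 0" by (cases "?S \<omega>") auto
      have "bdd_above (sum (\<lambda>x. f x \<omega>) ` {F. F \<subseteq> A \<and> finite F})"
      proof (rule bdd_aboveI2)
        fix F assume "F \<in> {F. F \<subseteq> A \<and> finite F}"
        then have "ennreal (\<Sum>x\<in>F. f x \<omega>) \<le> ?S \<omega>" by (intro SUP_upper) auto
        then show "(\<Sum>x\<in>F. f x \<omega>) \<le> B" using B by (simp add: ennreal_le_iff)
      qed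
      then have "(\<lambda>x. f x \<omega>) summable_on A" by (intro nonneg_bdd_above_summable_on nn)
      with False show False ..
    qed
    then show ?thesis unfolding infsum_not_exists[OF False] by (simp only: enn2real_top)
  qed
  have "countable {F. finite F \<and> F \<subseteq> A}"
    by (rule countable_subset[OF _ countable_Collect_finite]) auto
  then have "?S \<in> borel_measurable M"
    by (intro borel_measurable_SUP) auto
  then show ?thesis unfolding eq by measurable
qed

lemma (in prob_space) indep_elements_distr:
  assumes "indep_elements M S X T Y"
  shows "distr M (S \<Otimes>\<^sub>M T) (\<lambda>\<omega>. (X \<omega>, Y \<omega>)) = distr M S X \<Otimes>\<^sub>M distr M T Y"
proof -
  have X[measurable]: "X \<in> measurable M S" and Y[measurable]: "Y \<in> measurable M T"
    and ind: "indep_set {X -` A \<inter> space M | A. A \<in> sets S} {Y -` B \<inter> space M | B. B \<in> sets T}"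
    using assms by (auto simp: indep_elements_def)
  interpret S: prob_space "distr M S X" by (rule prob_space_distr) simp
  interpret T: prob_space "distr M T Y" by (rule prob_space_distr) simp
  show ?thesis
  proof (rule pair_measure_eqI[symmetric])
    show "sigma_finite_measure (distr M S X)" "sigma_finite_measure (distr M T Y)" by unfold_locales
    show "sets (distr M S X \<Otimes>\<^sub>M distr M T Y) = sets (distr M (S \<Otimes>\<^sub>M T) (\<lambda>\<omega>. (X \<omega>, Y \<omega>)))"
      by (simp cong: sets_pair_measure_cong)
    fix A B assume "A \<in> sets (distr M S X)" "B \<in> sets (distr M T Y)"
    then have A[measurable]: "A \<in> sets S" and B[measurable]: "B \<in> sets T" by auto
    have "prob ((X -` A \<inter> space M) \<inter> (Y -` B \<inter> space M)) = prob (X -` A \<inter> space M) * prob (Y -` B \<inter> space M)"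
      using A B by (intro indep_setD[OF ind]) auto
    moreover have "(\<lambda>\<omega>. (X \<omega>, Y \<omega>)) -` (A \<times> B) \<inter> space M = (X -` A \<inter> space M) \<inter> (Y -` B \<inter> space M)" by auto
    ultimately show "emeasure (distr M S X) A * emeasure (distr M T Y) B = emeasure (distr M (S \<Otimes>\<^sub>M T) (\<lambda>\<omega>. (X \<omega>, Y \<omega>))) (A \<times> B)"
      by (simp add: emeasure_distr emeasure_eq_measure ennreal_mult')
  qed
qed

text \<open>Fubini's theorem on the product of the laws: it justifies averaging over the walks with the occupation
variables held fixed.\<close>

lemma (in prob_space) indep_elements_integral:
  fixes f :: "'b \<Rightarrow> 'c \<Rightarrow> 'd::{banach, second_countable_topology}"
  assumes ind: "indep_elements M S X T Y" and f: "(\<lambda>(x, y). f x y) \<in> borel_measurable (S \<Otimes>\<^sub>M T)"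
    and int: "integrable M (\<lambda>\<omega>. f (X \<omega>) (Y \<omega>))"
  shows "(LINT \<omega>|M. f (X \<omega>) (Y \<omega>)) = (LINT \<omega>|M. (LINT \<omega>'|M. f (X \<omega>) (Y \<omega>')))"
proof -
  have X[measurable]: "X \<in> measurable M S" and Y[measurable]: "Y \<in> measurable M T"
    using ind by (auto simp: indep_elements_def)
  note f[measurable]
  interpret S: prob_space "distr M S X" by (rule prob_space_distr) simp
  interpret T: prob_space "distr M T Y" by (rule prob_space_distr) simp
  interpret P: pair_sigma_finite "distr M S X" "distr M T Y" ..
  have i: "integrable (distr M S X \<Otimes>\<^sub>M distr M T Y) (\<lambda>(x, y). f x y)"
    unfolding indep_elements_distr[OF ind, symmetric] using int by (subst integrable_distr_eq) auto
  have "(LINT \<omega>|M. f (X \<omega>) (Y \<omega>)) = (LINT z|distr M (S \<Otimes>\<^sub>M T) (\<lambda>\<omega>. (X \<omega>, Y \<omega>)). (\<lambda>(x, y). f x y) z)"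
    by (subst integral_distr) auto
  also have "\<dots> = (LINT x|distr M S X. (LINT y|distr M T Y. f x y))"
    unfolding indep_elements_distr[OF ind] using P.integral_fst'[OF i] by simp
  also have "\<dots> = (LINT \<omega>|M. (LINT y|distr M T Y. f (X \<omega>) y))"
  proof (rule integral_distr)
    show "(\<lambda>x. LINT y|distr M T Y. f x y) \<in> borel_measurable S"
      by (rule T.borel_measurable_lebesgue_integral) (use f in \<open>simp add: measurable_distr_eq1 cong: measurable_cong_sets\<close>)
  qed simp
  also have "\<dots> = (LINT \<omega>|M. (LINT \<omega>'|M. f (X \<omega>) (Y \<omega>')))"
  proof (rule Bochner_Integration.integral_cong[OF refl])
    fix \<omega> assume "\<omega> \<in> space M"
    then have "X \<omega> \<in> space S" by (rule measurable_space[OF X])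
    then have "(\<lambda>y. f (X \<omega>) y) \<in> borel_measurable T" using measurable_Pair2[OF f] by simp
    then show "(LINT y|distr M T Y. f (X \<omega>) y) = (LINT \<omega>'|M. f (X \<omega>) (Y \<omega>'))"
      by (intro integral_distr) simp_all
  qed
  finally show ?thesis .
qed

definition increments :: "nat \<Rightarrow> (nat \<Rightarrow> 'a \<Rightarrow> int) \<Rightarrow> 'a \<Rightarrow> (nat \<Rightarrow> int)" where
  "increments K W \<omega> = (\<lambda>l. if l < K then W (Suc l) \<omega> - W l \<omega> else 0)"

lemma (in prob_space) iid_distr_steps:
  fixes I :: "nat \<Rightarrow> 'a \<Rightarrow> int"
  assumes ind: "indep_vars (\<lambda>_. count_space UNIV) I {..<K}" and K: "K > 0"
    and law: "\<And>l. l < K \<Longrightarrow> distr M (count_space UNIV) (I l) = measure_pmf p"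
  shows "distr M (PiM {..<K} (\<lambda>_. count_space UNIV)) (\<lambda>\<omega>. \<lambda>l\<in>{..<K}. I l \<omega>) = PiM {..<K} (\<lambda>_. measure_pmf p)"
proof -
  have ne: "{..<K} \<noteq> {}" using K by auto
  have rv: "l \<in> {..<K} \<Longrightarrow> random_variable (count_space UNIV) (I l)" for l
    using ind unfolding indep_vars_def by blast
  have "distr M (PiM {..<K} (\<lambda>_. count_space UNIV)) (\<lambda>\<omega>. \<lambda>l\<in>{..<K}. I l \<omega>) =
      PiM {..<K} (\<lambda>l. distr M (count_space UNIV) (I l))"
    using indep_vars_iff_distr_eq_PiM'[where I="{..<K}" and X=I and M'="\<lambda>_. count_space UNIV"] ne rv ind by blast
  also have "\<dots> = PiM {..<K} (\<lambda>_. measure_pmf p)" by (rule PiM_cong) (use law in auto)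
  finally show ?thesis .
qed

text \<open>Both sides are images of the product measure \<open>PiM {..<K} (\<lambda>_. measure_pmf p)\<close> under extension by zero.\<close>

lemma (in prob_space) increments_law:
  assumes W: "random_walk M p x W" and K: "K > 0"
  shows "distr M (count_space UNIV) (increments K W) = measure_pmf (steps p K)"
    and "increments K W \<in> measurable M (count_space UNIV)"
proof -
  let ?I = "\<lambda>l \<omega>. W (Suc l) \<omega> - W l \<omega>"
  let ?C = "count_space UNIV :: int measure"
  have Wm[measurable]: "W m \<in> measurable M ?C" for m using W by (simp add: random_walk_def)
  have ind: "indep_vars (\<lambda>_. ?C) ?I UNIV" and law: "distr M ?C (?I l) = measure_pmf p" for l
    using W by (auto simp: random_walk_def)
  define h :: "(nat \<Rightarrow> int) \<Rightarrow> (nat \<Rightarrow> int)" where "h \<xi> = (\<lambda>l. if l < K then \<xi> l else 0)" for \<xi>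
  have hm[measurable]: "h \<in> measurable (PiM {..<K} (\<lambda>_. ?C)) (count_space UNIV)"
    by (subst count_space_PiM_finite) auto
  have r1[measurable]: "(\<lambda>\<omega>. \<lambda>l\<in>{..<K}. ?I l \<omega>) \<in> measurable M (PiM {..<K} (\<lambda>_. ?C))" by measurable
  have 1: "increments K W = (\<lambda>\<omega>. h (\<lambda>l\<in>{..<K}. ?I l \<omega>))"
    by (auto simp: increments_def h_def fun_eq_iff)
  show "increments K W \<in> measurable M (count_space UNIV)" unfolding 1 by measurable
  have r2[measurable]: "(\<lambda>\<xi>. \<lambda>l\<in>{..<K}. \<xi> l) \<in> measurable (measure_pmf (steps p K)) (PiM {..<K} (\<lambda>_. ?C))"
    by (simp add: space_PiM)
  have "distr M (count_space UNIV) (increments K W) =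
      distr (distr M (PiM {..<K} (\<lambda>_. ?C)) (\<lambda>\<omega>. \<lambda>l\<in>{..<K}. ?I l \<omega>)) (count_space UNIV) h"
    unfolding 1 by (subst distr_distr[OF hm r1]) (simp add: comp_def)
  also have "distr M (PiM {..<K} (\<lambda>_. ?C)) (\<lambda>\<omega>. \<lambda>l\<in>{..<K}. ?I l \<omega>) = PiM {..<K} (\<lambda>_. measure_pmf p)"
    by (rule iid_distr_steps[OF indep_vars_subset[OF ind] K law]) simp
  also have "\<dots> = distr (measure_pmf (steps p K)) (PiM {..<K} (\<lambda>_. ?C)) (\<lambda>\<xi>. \<lambda>l\<in>{..<K}. \<xi> l)"
  proof (rule prob_space.iid_distr_steps[OF measure_pmf.prob_space_axioms _ K, symmetric])
    show "prob_space.indep_vars (measure_pmf (steps p K)) (\<lambda>_. ?C) (\<lambda>l \<xi>. \<xi> l) {..<K}"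
      unfolding steps_def by (rule indep_vars_Pi_pmf) simp
    show "distr (measure_pmf (steps p K)) ?C (\<lambda>\<xi>. \<xi> l) = measure_pmf p" if "l < K" for l
      unfolding map_pmf_rep_eq[symmetric] steps_def using that by (subst Pi_pmf_component) auto
  qed
  also have "distr \<dots> (count_space UNIV) h = distr (measure_pmf (steps p K)) (count_space UNIV) (\<lambda>\<xi>. h (\<lambda>l\<in>{..<K}. \<xi> l))"
    by (subst distr_distr[OF hm r2]) (simp add: comp_def)
  also have "\<dots> = distr (measure_pmf (steps p K)) (count_space UNIV) (\<lambda>\<xi>. \<xi>)"
  proof (rule distr_cong_AE)
    show "AE \<xi> in measure_pmf (steps p K). h (\<lambda>l\<in>{..<K}. \<xi> l) = \<xi>"
      using set_Pi_pmf_subset[of "{..<K}" 0 "\<lambda>_. p"]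
      by (auto simp: AE_measure_pmf_iff steps_def h_def fun_eq_iff)
  qed auto
  also have "\<dots> = measure_pmf (steps p K)"
    by (simp add: map_pmf_rep_eq[symmetric])
  finally show "distr M (count_space UNIV) (increments K W) = measure_pmf (steps p K)" .
qed

lemma (in prob_space) random_walk_AE:
  assumes W: "random_walk M p x W"
  shows "AE \<omega> in M. (\<forall>m. W m \<omega> = x + (\<Sum>l<m. W (Suc l) \<omega> - W l \<omega>)) \<and> (\<forall>l. W (Suc l) \<omega> - W l \<omega> \<in> set_pmf p)"
proof -
  have Wm[measurable]: "W m \<in> measurable M (count_space UNIV)" for m using W by (simp add: random_walk_def)
  have 0: "AE \<omega> in M. W 0 \<omega> = x" using W by (simp add: random_walk_def)
  have "AE \<omega> in M. W (Suc l) \<omega> - W l \<omega> \<in> set_pmf p" for l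
  proof -
    have "AE y in distr M (count_space UNIV) (\<lambda>\<omega>. W (Suc l) \<omega> - W l \<omega>). y \<in> set_pmf p"
    proof -
      have "distr M (count_space UNIV) (\<lambda>\<omega>. W (Suc l) \<omega> - W l \<omega>) = measure_pmf p"
        using W by (simp only: random_walk_def)
      then show ?thesis by (simp only: AE_measure_pmf)
    qed
    then show ?thesis by (subst (asm) AE_distr_iff) auto
  qed
  then have "AE \<omega> in M. \<forall>l. W (Suc l) \<omega> - W l \<omega> \<in> set_pmf p" by (simp add: AE_all_countable)
  with 0 show ?thesis
  proof eventually_elim
    case (elim \<omega>)
    have "W m \<omega> = x + (\<Sum>l<m. W (Suc l) \<omega> - W l \<omega>)" for m
      using elim(1) sum_lessThan_telescope[of "\<lambda>l. W l \<omega>" m] by linarith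
    then show ?case using elim(2) by blast
  qed
qed

text \<open>The hypotheses of the theorem, with the occupation variable at \<open>0\<close> as representative of their common law.\<close>

locale particle_system = current_model M "\<eta> 0" p v s2
  for M :: "'a measure" and \<eta> :: "int \<Rightarrow> 'a \<Rightarrow> nat" and p v s2 +
  fixes X :: "int \<Rightarrow> nat \<Rightarrow> nat \<Rightarrow> 'a \<Rightarrow> int"
  assumes walks: "\<And>x k. k \<ge> 1 \<Longrightarrow> random_walk M p x (X x k)"
    and indep_walks: "indep_vars (\<lambda>_. path_space) (\<lambda>(x, k) \<omega> m. X x k m \<omega>) (UNIV \<times> {1..})"
    and iid_occupation: "iid_vars M (count_space UNIV) \<eta> UNIV"
    and occupation_walks_indep: "indep_elements M
           (PiM UNIV (\<lambda>_. count_space UNIV)) (\<lambda>\<omega> x. \<eta> x \<omega>)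
           (PiM (UNIV \<times> {1..}) (\<lambda>_. path_space)) (\<lambda>\<omega>. \<lambda>(x, k)\<in>UNIV \<times> {1..}. \<lambda>m. X x k m \<omega>)"
begin

lemma \<eta>_measurable[measurable]: "\<eta> x \<in> measurable M (count_space UNIV)"
  using iid_occupation by (auto simp: iid_vars_def indep_vars_def)

lemma indep_\<eta>: "indep_vars (\<lambda>_. count_space UNIV) \<eta> UNIV"
  using iid_occupation by (simp add: iid_vars_def)

lemma \<eta>_law: "distr M (count_space UNIV) (\<eta> x) = distr M (count_space UNIV) (\<eta> 0)"
  using iid_occupation by (auto simp: iid_vars_def)

lemma integral_\<eta>: "(LINT \<omega>|M. f (\<eta> x \<omega>)) = (LINT \<omega>|M. f (\<eta> 0 \<omega>))"
  for f :: "nat \<Rightarrow> 'c::{banach, second_countable_topology}"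
proof -
  have "(LINT \<omega>|M. f (\<eta> y \<omega>)) = (LINT i|distr M (count_space UNIV) (\<eta> y). f i)" for y
    by (rule integral_distr[symmetric]) auto
  then show ?thesis using \<eta>_law[of x] by simp
qed

lemma integrable_\<eta>: "integrable M (\<lambda>\<omega>. real (\<eta> x \<omega>))"
proof -
  have "integrable M (\<lambda>\<omega>. real (\<eta> y \<omega>)) \<longleftrightarrow> integrable (distr M (count_space UNIV) (\<eta> y)) real" for y
    by (rule integrable_distr_eq[symmetric]) auto
  then show ?thesis using \<eta>_law[of x] int1 by simp
qed

lemma path_measurable[measurable]: "k \<ge> 1 \<Longrightarrow> (\<lambda>\<omega> m. X x k m \<omega>) \<in> measurable M path_space"
  using indep_walks unfolding indep_vars_def by auto

definition total :: "int set \<Rightarrow> (int \<Rightarrow> (nat \<Rightarrow> int) \<Rightarrow> real) \<Rightarrow> (int \<Rightarrow> nat) \<Rightarrow> (int \<times> nat \<Rightarrow> nat \<Rightarrow> int) \<Rightarrow> real" where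
  "total F u h \<xi> = (\<Sum>x\<in>F. \<Sum>k=1..h x. u x (\<xi> (x, k)))"

definition paths :: "'a \<Rightarrow> int \<times> nat \<Rightarrow> nat \<Rightarrow> int" where
  "paths \<omega> = (\<lambda>(x, k)\<in>UNIV \<times> {1..}. \<lambda>m. X x k m \<omega>)"

lemma total_paths: "total F u h (paths \<omega>) = (\<Sum>x\<in>F. \<Sum>k=1..h x. u x (\<lambda>m. X x k m \<omega>))"
  unfolding total_def paths_def by (intro sum.cong refl) auto

lemma total_measurable:
  assumes u: "\<And>x. u x \<in> borel_measurable path_space"
  shows "(\<lambda>(h, \<xi>). total F u h \<xi>) \<in> borel_measurable (PiM UNIV (\<lambda>_. count_space UNIV) \<Otimes>\<^sub>M PiM (UNIV \<times> {1..}) (\<lambda>_. path_space))"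
    (is "_ \<in> borel_measurable (?S \<Otimes>\<^sub>M ?T)")
proof -
  have "(\<lambda>z. \<Sum>k=1..fst z x. u x (snd z (x, k))) \<in> borel_measurable (?S \<Otimes>\<^sub>M ?T)" for x
  proof (rule measurable_compose_countable[where g="\<lambda>z. fst z x" and f="\<lambda>i z. \<Sum>k=1..i. u x (snd z (x, k))"])
    show "(\<lambda>z. fst z x) \<in> measurable (?S \<Otimes>\<^sub>M ?T) (count_space UNIV)"
      by (rule measurable_compose[OF measurable_fst]) simp
    show "(\<lambda>z. \<Sum>k=1..i. u x (snd z (x, k))) \<in> borel_measurable (?S \<Otimes>\<^sub>M ?T)" for i
    proof (rule borel_measurable_sum)
      fix k assume "k \<in> {1..i}"
      then have "(x, k) \<in> UNIV \<times> {1..}" by simp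
      then have "(\<lambda>\<xi>. \<xi> (x, k)) \<in> measurable ?T path_space" by (rule measurable_component_singleton)
      then show "(\<lambda>z. u x (snd z (x, k))) \<in> borel_measurable (?S \<Otimes>\<^sub>M ?T)"
        by (intro measurable_compose[OF _ u] measurable_compose[OF measurable_snd])
    qed
  qed
  then show ?thesis unfolding total_def split_beta' by (intro borel_measurable_sum)
qed

lemma occupation_vector_measurable: "(\<lambda>\<omega> x. \<eta> x \<omega>) \<in> measurable M (PiM UNIV (\<lambda>_. count_space UNIV))"
  and paths_measurable: "paths \<in> measurable M (PiM (UNIV \<times> {1..}) (\<lambda>_. path_space))"
  using occupation_walks_indep unfolding indep_elements_def paths_def[abs_def] by blast+

lemma total_random_measurable:
  assumes u: "\<And>x. u x \<in> borel_measurable path_space"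
  shows "(\<lambda>\<omega>. total F u (\<lambda>x. \<eta> x \<omega>) (paths \<omega>)) \<in> borel_measurable M"
  using measurable_compose[OF measurable_Pair[OF occupation_vector_measurable paths_measurable] total_measurable[OF u, of F]]
  by simp

text \<open>For fixed occupation numbers \<open>h\<close> the walks are independent, which gives the product of the powers
\<open>c x ^ h x\<close>; averaging over the independent occupation variables turns the powers into generating functions.\<close>

theorem total_char:
  assumes F: "finite F" and u: "\<And>x. u x \<in> borel_measurable path_space"
    and c: "\<And>x k. x \<in> F \<Longrightarrow> k \<ge> 1 \<Longrightarrow> (LINT \<omega>|M. iexp (\<theta> * u x (\<lambda>m. X x k m \<omega>))) = c x"
  shows "(LINT \<omega>|M. iexp (\<theta> * total F u (\<lambda>x. \<eta> x \<omega>) (paths \<omega>))) = (\<Prod>x\<in>F. pgf (c x))"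
proof -
  have um[measurable]: "(\<lambda>\<omega>. u x (\<lambda>m. X x k m \<omega>)) \<in> borel_measurable M" if "k \<ge> 1" for x k
    by (rule measurable_compose[OF path_measurable[OF that] u])
  have c1: "norm (c x) \<le> 1" if "x \<in> F" for x
  proof -
    have "norm (LINT \<omega>|M. iexp (\<theta> * u x (\<lambda>m. X x 1 m \<omega>))) \<le> (LINT \<omega>|M. norm (iexp (\<theta> * u x (\<lambda>m. X x 1 m \<omega>))))"
      by (rule integral_norm_bound)
    then show ?thesis using c[OF that, of 1] by (simp add: prob_space)
  qed
  have quenched: "(LINT \<omega>|M. iexp (\<theta> * total F u h (paths \<omega>))) = (\<Prod>x\<in>F. c x ^ h x)" for h
  proof -
    define I where "I = (SIGMA x:F. {1..h x})"
    have I: "finite I" "I \<subseteq> UNIV \<times> {1..}" using F by (auto simp: I_def)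
    define Y where "Y = (\<lambda>(x, k) \<omega>. iexp (\<theta> * u x (\<lambda>m. X x k m \<omega>)))"
    have "indep_vars (\<lambda>_. borel) (\<lambda>i \<omega>. (\<lambda>w. iexp (\<theta> * u (fst i) w)) ((case i of (x, k) \<Rightarrow> \<lambda>\<omega> m. X x k m \<omega>) \<omega>)) I"
    proof (rule indep_vars_compose2[OF indep_vars_subset[OF indep_walks I(2)]])
      fix i :: "int \<times> nat"
      have [measurable]: "u (fst i) \<in> borel_measurable path_space" by (rule u)
      show "(\<lambda>w. iexp (\<theta> * u (fst i) w)) \<in> borel_measurable path_space" by measurable
    qed
    then have ind: "indep_vars (\<lambda>_. borel) Y I" by (simp add: Y_def split_beta')
    have "(LINT \<omega>|M. iexp (\<theta> * total F u h (paths \<omega>))) = (LINT \<omega>|M. (\<Prod>i\<in>I. Y i \<omega>))"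
    proof (rule Bochner_Integration.integral_cong[OF refl])
      fix \<omega>
      have "(\<Prod>i\<in>I. Y i \<omega>) = (\<Prod>x\<in>F. \<Prod>k=1..h x. iexp (\<theta> * u x (\<lambda>m. X x k m \<omega>)))"
        unfolding I_def Y_def using F by (subst prod.Sigma) (auto simp: split_beta')
      also have "\<dots> = iexp (\<theta> * total F u h (paths \<omega>))"
        unfolding total_paths using F by (simp add: exp_sum sum_distrib_left)
      finally show "iexp (\<theta> * total F u h (paths \<omega>)) = (\<Prod>i\<in>I. Y i \<omega>)" by simp
    qed
    also have "\<dots> = (\<Prod>i\<in>I. LINT \<omega>|M. Y i \<omega>)"
    proof (rule indep_vars_lebesgue_integral[OF I(1) ind])
      fix i assume "i \<in> I"
      then have "snd i \<ge> 1" by (auto simp: I_def)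
      then show "integrable M (Y i)" unfolding Y_def split_beta by (intro integrable_iexp) (use um in auto)
    qed
    also have "\<dots> = (\<Prod>i\<in>I. c (fst i))"
      by (intro prod.cong refl) (auto simp: I_def Y_def simp del: of_real_mult intro!: c)
    also have "\<dots> = (\<Prod>x\<in>F. \<Prod>k=1..h x. c x)"
      unfolding I_def using F by (subst prod.Sigma) (auto simp: split_beta')
    finally show ?thesis by simp
  qed
  have fm: "(\<lambda>(h, \<xi>). iexp (\<theta> * total F u h \<xi>)) \<in> borel_measurable (PiM UNIV (\<lambda>_. count_space UNIV) \<Otimes>\<^sub>M PiM (UNIV \<times> {1..}) (\<lambda>_. path_space))"
  proof -
    note [measurable] = total_measurable[OF u, of F, unfolded split_beta']
    show ?thesis unfolding split_beta' by measurable
  qed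
  have "(LINT \<omega>|M. iexp (\<theta> * total F u (\<lambda>x. \<eta> x \<omega>) (paths \<omega>))) =
      (LINT \<omega>|M. (LINT \<omega>'|M. iexp (\<theta> * total F u (\<lambda>x. \<eta> x \<omega>) (paths \<omega>'))))"
  proof (rule indep_elements_integral[OF _ fm])
    show "indep_elements M (PiM UNIV (\<lambda>_. count_space UNIV)) (\<lambda>\<omega> x. \<eta> x \<omega>) (PiM (UNIV \<times> {1..}) (\<lambda>_. path_space)) paths"
      using occupation_walks_indep by (simp add: paths_def[abs_def])
    show "integrable M (\<lambda>\<omega>. iexp (\<theta> * total F u (\<lambda>x. \<eta> x \<omega>) (paths \<omega>)))"
      by (rule integrable_iexp) (use total_random_measurable[OF u] in auto)
  qed
  also have "\<dots> = (LINT \<omega>|M. (\<Prod>x\<in>F. c x ^ \<eta> x \<omega>))" unfolding quenched ..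
  also have "\<dots> = (\<Prod>x\<in>F. LINT \<omega>|M. c x ^ \<eta> x \<omega>)"
  proof (rule indep_vars_lebesgue_integral[OF F])
    show "indep_vars (\<lambda>_. borel) (\<lambda>x \<omega>. c x ^ \<eta> x \<omega>) F"
      by (rule indep_vars_compose2[OF indep_vars_subset[OF indep_\<eta>]]) auto
    show "integrable M (\<lambda>\<omega>. c x ^ \<eta> x \<omega>)" if "x \<in> F" for x
      using c1[OF that] by (intro integrable_const_bound[where B=1]) (auto simp: norm_power power_le_one)
  qed
  also have "\<dots> = (\<Prod>x\<in>F. pgf (c x))"
    unfolding pgf_def by (intro prod.cong refl integral_\<eta>)
  finally show ?thesis .
qed

theorem total_mean:
  assumes F: "finite F" and u: "\<And>x. u x \<in> borel_measurable path_space" and A: "\<And>x w. \<bar>u x w\<bar> \<le> A"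
    and \<alpha>: "\<And>x k. x \<in> F \<Longrightarrow> k \<ge> 1 \<Longrightarrow> (LINT \<omega>|M. u x (\<lambda>m. X x k m \<omega>)) = \<alpha> x"
  shows "integrable M (\<lambda>\<omega>. total F u (\<lambda>x. \<eta> x \<omega>) (paths \<omega>))"
    and "(LINT \<omega>|M. total F u (\<lambda>x. \<eta> x \<omega>) (paths \<omega>)) = m0 * (\<Sum>x\<in>F. \<alpha> x)"
proof -
  have um[measurable]: "(\<lambda>\<omega>. u x (\<lambda>m. X x k m \<omega>)) \<in> borel_measurable M" if "k \<ge> 1" for x k
    by (rule measurable_compose[OF path_measurable[OF that] u])
  have bound: "\<bar>total F u h \<xi>\<bar> \<le> (\<Sum>x\<in>F. real (h x) * A)" for h \<xi>
  proof -
    have "\<bar>total F u h \<xi>\<bar> \<le> (\<Sum>x\<in>F. \<bar>\<Sum>k=1..h x. u x (\<xi> (x, k))\<bar>)" unfolding total_def by (rule sum_abs)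
    also have "\<dots> \<le> (\<Sum>x\<in>F. \<Sum>k=1..h x. \<bar>u x (\<xi> (x, k))\<bar>)" by (intro sum_mono sum_abs)
    also have "\<dots> \<le> (\<Sum>x\<in>F. \<Sum>k=1..h x. A)" by (intro sum_mono A)
    finally show ?thesis by simp
  qed
  show int: "integrable M (\<lambda>\<omega>. total F u (\<lambda>x. \<eta> x \<omega>) (paths \<omega>))"
  proof (rule Bochner_Integration.integrable_bound[OF _ total_random_measurable[OF u]])
    show "integrable M (\<lambda>\<omega>. \<Sum>x\<in>F. real (\<eta> x \<omega>) * A)"
      by (intro Bochner_Integration.integrable_sum integrable_mult_left integrable_\<eta>)
    show "AE \<omega> in M. norm (total F u (\<lambda>x. \<eta> x \<omega>) (paths \<omega>)) \<le> norm (\<Sum>x\<in>F. real (\<eta> x \<omega>) * A)"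
      by (intro AE_I2) (use order_trans[OF bound abs_ge_self] in auto)
  qed
  have quenched: "(LINT \<omega>|M. total F u h (paths \<omega>)) = (\<Sum>x\<in>F. real (h x) * \<alpha> x)" for h
  proof -
    have i: "integrable M (\<lambda>\<omega>. u x (\<lambda>m. X x k m \<omega>))" if "k \<ge> 1" for x k
      by (rule integrable_const_bound[where B=A]) (use A um[OF that] in auto)
    have "(LINT \<omega>|M. total F u h (paths \<omega>)) = (\<Sum>x\<in>F. LINT \<omega>|M. (\<Sum>k=1..h x. u x (\<lambda>m. X x k m \<omega>)))"
      unfolding total_paths by (rule Bochner_Integration.integral_sum) (auto intro!: Bochner_Integration.integrable_sum i)
    also have "\<dots> = (\<Sum>x\<in>F. \<Sum>k=1..h x. LINT \<omega>|M. u x (\<lambda>m. X x k m \<omega>))"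
      by (intro sum.cong refl Bochner_Integration.integral_sum i) auto
    also have "\<dots> = (\<Sum>x\<in>F. \<Sum>k=1..h x. \<alpha> x)" by (intro sum.cong refl \<alpha>) auto
    finally show ?thesis by simp
  qed
  have "(LINT \<omega>|M. total F u (\<lambda>x. \<eta> x \<omega>) (paths \<omega>)) =
      (LINT \<omega>|M. (LINT \<omega>'|M. total F u (\<lambda>x. \<eta> x \<omega>) (paths \<omega>')))"
  proof (rule indep_elements_integral[where f="total F u" and X="\<lambda>\<omega> x. \<eta> x \<omega>" and Y=paths])
    show "integrable M (\<lambda>\<omega>. total F u (\<lambda>x. \<eta> x \<omega>) (paths \<omega>))" by (rule int)
    show "(\<lambda>(h, \<xi>). total F u h \<xi>) \<in> borel_measurable (PiM UNIV (\<lambda>_. count_space UNIV) \<Otimes>\<^sub>M PiM (UNIV \<times> {1..}) (\<lambda>_. path_space))"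
      by (rule total_measurable) (rule u)
    show "indep_elements M (PiM UNIV (\<lambda>_. count_space UNIV)) (\<lambda>\<omega> x. \<eta> x \<omega>) (PiM (UNIV \<times> {1..}) (\<lambda>_. path_space)) paths"
      using occupation_walks_indep by (simp add: paths_def[abs_def])
  qed
  also have "\<dots> = (LINT \<omega>|M. (\<Sum>x\<in>F. real (\<eta> x \<omega>) * \<alpha> x))" unfolding quenched ..
  also have "\<dots> = (\<Sum>x\<in>F. (LINT \<omega>|M. real (\<eta> x \<omega>)) * \<alpha> x)"
    using integrable_\<eta> by (subst Bochner_Integration.integral_sum) auto
  also have "\<dots> = (\<Sum>x\<in>F. m0 * \<alpha> x)"
    unfolding m0_def by (intro sum.cong refl arg_cong2[where f="(*)"] integral_\<eta>)
  finally show "(LINT \<omega>|M. total F u (\<lambda>x. \<eta> x \<omega>) (paths \<omega>)) = m0 * (\<Sum>x\<in>F. \<alpha> x)"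
    by (simp add: sum_distrib_left)
qed

end

context particle_system
begin

section \<open>The limit of the current\<close>

text \<open>The score of a particle in terms of its trajectory \<open>w\<close> instead of its steps.\<close>

definition path_score :: "(real \<times> real) set \<Rightarrow> (real \<times> real \<Rightarrow> real) \<Rightarrow> nat \<Rightarrow> int \<Rightarrow> (nat \<Rightarrow> int) \<Rightarrow> real" where
  "path_score J a n x w = (\<Sum>j\<in>J. a j * (of_bool (x \<le> 0) - of_bool (w (ptime (fst j) n) \<le> plevel v j n)))"

lemma path_score_measurable: "path_score J a n x \<in> borel_measurable path_space"
proof -
  have "(\<lambda>w. of_bool (w m \<le> c) :: real) \<in> borel_measurable path_space" for m and c :: int
    by (rule measurable_compose[where f="\<lambda>w. w m" and g="\<lambda>y. of_bool (y \<le> c)" and N="count_space UNIV"]) simp_all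
  then show ?thesis unfolding path_score_def by measurable
qed

lemma path_score_bound: "\<bar>path_score J a n x w\<bar> \<le> (\<Sum>j\<in>J. \<bar>a j\<bar>)"
proof -
  have "\<bar>path_score J a n x w\<bar> \<le> (\<Sum>j\<in>J. \<bar>a j * (of_bool (x \<le> 0) - of_bool (w (ptime (fst j) n) \<le> plevel v j n))\<bar>)"
    unfolding path_score_def by (rule sum_abs)
  also have "\<dots> \<le> (\<Sum>j\<in>J. \<bar>a j\<bar> * 1)"
    unfolding abs_mult by (intro sum_mono mult_left_mono) auto
  finally show ?thesis by simp
qed

lemma expectation_path_score:
  fixes f :: "real \<Rightarrow> 'c::{banach, second_countable_topology}"
  assumes k: "k \<ge> 1" and K: "K > 0" "\<And>j. j \<in> J \<Longrightarrow> ptime (fst j) n \<le> K" and f[measurable]: "f \<in> borel_measurable borel"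
  shows "(LINT \<omega>|M. f (path_score J a n x (\<lambda>m. X x k m \<omega>))) = measure_pmf.expectation (steps p K) (\<lambda>\<xi>. f (score J a n x \<xi>))"
proof -
  note W = walks[OF k, of x]
  note law = increments_law[OF W K(1)]
  have m1[measurable]: "(\<lambda>\<omega>. path_score J a n x (\<lambda>m. X x k m \<omega>)) \<in> borel_measurable M"
    by (rule measurable_compose[OF path_measurable[OF k] path_score_measurable])
  have m2[measurable]: "(\<lambda>\<omega>. score J a n x (increments K (X x k) \<omega>)) \<in> borel_measurable M"
    by (rule measurable_compose[OF law(2)]) simp
  have "(LINT \<omega>|M. f (path_score J a n x (\<lambda>m. X x k m \<omega>))) = (LINT \<omega>|M. f (score J a n x (increments K (X x k) \<omega>)))"
  proof (rule integral_cong_AE)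
    show "AE \<omega> in M. f (path_score J a n x (\<lambda>m. X x k m \<omega>)) = f (score J a n x (increments K (X x k) \<omega>))"
      using random_walk_AE[OF W]
    proof eventually_elim
      case (elim \<omega>)
      have "path_score J a n x (\<lambda>m. X x k m \<omega>) = score J a n x (increments K (X x k) \<omega>)"
        unfolding path_score_def score_def
      proof (intro sum.cong refl)
        fix j assume j: "j \<in> J"
        let ?m = "ptime (fst j) n"
        have "(\<Sum>l<?m. increments K (X x k) \<omega> l) = (\<Sum>l<?m. X x k (Suc l) \<omega> - X x k l \<omega>)"
          using K(2)[OF j] by (intro sum.cong) (auto simp: increments_def)
        moreover have "X x k ?m \<omega> = x + (\<Sum>l<?m. X x k (Suc l) \<omega> - X x k l \<omega>)" using elim by blast
        ultimately have "X x k ?m \<omega> = x + (\<Sum>l<?m. increments K (X x k) \<omega> l)" by simp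
        then show "a j * (of_bool (x \<le> 0) - of_bool (X x k ?m \<omega> \<le> plevel v j n)) = a j * crossing (excess j n (increments K (X x k) \<omega>)) x"
          by (simp add: crossing_def excess_def le_diff_eq)
      qed
      then show ?case by simp
    qed
  qed measurable
  also have "\<dots> = (LINT \<xi>|distr M (count_space UNIV) (increments K (X x k)). f (score J a n x \<xi>))"
    by (rule integral_distr[symmetric]) (use law(2) in auto)
  finally show ?thesis unfolding law(1) .
qed

text \<open>The sum of the sizes of all possible jumps is a crude but sufficient bound for each of them.\<close>

definition max_jump :: int where "max_jump = (\<Sum>y\<in>set_pmf p. \<bar>y\<bar>)"

lemma abs_le_max_jump: "y \<in> set_pmf p \<Longrightarrow> \<bar>y\<bar> \<le> max_jump"
  unfolding max_jump_def using finite_p by (intro member_le_sum) auto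

lemma max_jump_nonneg: "max_jump \<ge> 0" unfolding max_jump_def by (rule sum_nonneg) simp

lemma abs_sum_le_max_jump:
  fixes \<xi> :: "nat \<Rightarrow> int"
  assumes "\<And>l. l < m \<Longrightarrow> \<bar>\<xi> l\<bar> \<le> max_jump"
  shows "\<bar>\<Sum>l<m. \<xi> l\<bar> \<le> max_jump * int m"
proof -
  have "\<bar>\<Sum>l<m. \<xi> l\<bar> \<le> (\<Sum>l<m. \<bar>\<xi> l\<bar>)" by (rule sum_abs)
  also have "\<dots> \<le> (\<Sum>l<m. max_jump)" by (rule sum_mono) (use assms in auto)
  finally show ?thesis by (simp add: mult.commute)
qed

definition width :: "(real \<times> real) set \<Rightarrow> nat \<Rightarrow> int" where
  "width J n = (\<Sum>j\<in>J. \<bar>plevel v j n\<bar> + max_jump * int (ptime (fst j) n))"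

lemma le_width: "finite J \<Longrightarrow> j \<in> J \<Longrightarrow> \<bar>plevel v j n\<bar> + max_jump * int (ptime (fst j) n) \<le> width J n"
  unfolding width_def using max_jump_nonneg by (intro member_le_sum) auto

lemma excess_le_width:
  assumes "finite J" "j \<in> J" "\<xi> \<in> set_pmf (steps p K)"
  shows "\<bar>excess j n \<xi>\<bar> \<le> width J n"
proof -
  have "\<bar>\<xi> l\<bar> \<le> max_jump" for l
    using assms(3) abs_le_max_jump[of "\<xi> l"] max_jump_nonneg
    by (cases "l < K") (auto simp: steps_def set_Pi_pmf PiE_dflt_def)
  then have "\<bar>\<Sum>l<ptime (fst j) n. \<xi> l\<bar> \<le> max_jump * int (ptime (fst j) n)" by (intro abs_sum_le_max_jump)
  then show ?thesis using le_width[OF assms(1,2), of n] unfolding excess_def by linarith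
qed

lemma current_measurable: "current \<eta> X v n i \<in> borel_measurable M"
proof -
  obtain t r where i: "i = (t, r)" by (cases i)
  have X[measurable]: "X x k m \<in> measurable M (count_space UNIV)" if "k \<ge> 1" for x k m
    using walks[OF that] by (simp add: random_walk_def)
  have m: "(\<lambda>\<omega>. \<Sum>k=1..\<eta> x \<omega>. of_bool (P (X x k m \<omega>)) :: real) \<in> borel_measurable M" for x m and P :: "int \<Rightarrow> bool"
  proof (rule measurable_compose_countable[where g="\<eta> x" and f="\<lambda>h \<omega>. \<Sum>k=1..h. of_bool (P (X x k m \<omega>)) :: real"])
    show "(\<lambda>\<omega>. \<Sum>k=1..h. of_bool (P (X x k m \<omega>)) :: real) \<in> borel_measurable M" for h
    proof (rule borel_measurable_sum)
      fix k assume "k \<in> {1..h}"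
      then show "(\<lambda>\<omega>. of_bool (P (X x k m \<omega>)) :: real) \<in> borel_measurable M"
        by (intro measurable_compose[OF X, where g="\<lambda>y. of_bool (P y)"]) auto
    qed
  qed simp
  show ?thesis unfolding current_def i prod.case
    by (intro borel_measurable_diff borel_measurable_infsum_nonneg m sum_nonneg) simp_all
qed

text \<open>Almost surely a particle moves at most \<open>max_jump\<close> per step. A particle that starts further than \<open>L\<close> from
the origin therefore stays on its side of the level and contributes nothing.\<close>

lemma current_AE:
  assumes L: "\<bar>plevel v (t, r) n\<bar> + max_jump * int (ptime t n) \<le> L"
  shows "AE \<omega> in M. current \<eta> X v n (t, r) \<omega> = total {- L..L} (path_score {(t, r)} (\<lambda>_. 1) n) (\<lambda>x. \<eta> x \<omega>) (paths \<omega>)"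
proof -
  let ?m = "ptime t n" and ?b = "plevel v (t, r) n"
  have "AE \<omega> in M. \<forall>x. \<forall>k\<in>{1..}. \<bar>X x k ?m \<omega> - x\<bar> \<le> max_jump * int ?m"
  proof (subst AE_all_countable, intro allI, subst AE_ball_countable, simp, intro ballI)
    fix x k assume "k \<in> {1::nat..}"
    then have k: "k \<ge> 1" by simp
    show "AE \<omega> in M. \<bar>X x k ?m \<omega> - x\<bar> \<le> max_jump * int ?m"
      using random_walk_AE[OF walks[OF k, of x]]
    proof eventually_elim
      case (elim \<omega>)
      have "X x k ?m \<omega> - x = (\<Sum>l<?m. X x k (Suc l) \<omega> - X x k l \<omega>)" using elim by (metis add_diff_cancel_left')
      then show ?case using abs_sum_le_max_jump[of ?m "\<lambda>l. X x k (Suc l) \<omega> - X x k l \<omega>"] abs_le_max_jump elim by metis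
    qed
  qed
  then show ?thesis
  proof eventually_elim
    case (elim \<omega>)
    have near: "\<bar>X x k ?m \<omega> - x\<bar> \<le> max_jump * int ?m" if "k \<ge> 1" for x k using elim that by auto
    have L0: "L \<ge> 0" using L max_jump_nonneg by (meson abs_ge_zero add_nonneg_nonneg mult_nonneg_nonneg of_nat_0_le_iff order_trans)
    define A where "A x = (\<Sum>k=1..\<eta> x \<omega>. of_bool (\<not> X x k ?m \<omega> \<le> ?b) :: real)" for x
    define B where "B x = (\<Sum>k=1..\<eta> x \<omega>. of_bool (X x k ?m \<omega> \<le> ?b) :: real)" for x
    have A0: "A x = 0" if "x \<in> {..0} - {- L..0}" for x
    proof -
      have "X x k ?m \<omega> \<le> ?b" if "k \<in> {1..\<eta> x \<omega>}" for k
        using near[of k x] that \<open>x \<in> {..0} - {- L..0}\<close> L by auto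
      then show ?thesis unfolding A_def by (intro sum.neutral) auto
    qed
    have B0: "B x = 0" if "x \<in> {0<..} - {0<..L}" for x
    proof -
      have "\<not> X x k ?m \<omega> \<le> ?b" if "k \<in> {1..\<eta> x \<omega>}" for k
        using near[of k x] that \<open>x \<in> {0<..} - {0<..L}\<close> L by auto
      then show ?thesis unfolding B_def by (intro sum.neutral) auto
    qed
    have "current \<eta> X v n (t, r) \<omega> = infsum A {..0} - infsum B {0<..}"
      unfolding current_def prod.case A_def B_def ptime_def[symmetric] le_plevel_iff[symmetric] by (simp add: not_le)
    also have "infsum A {..0} = (\<Sum>x\<in>{- L..0}. A x)"
      using infsum_cong_neutral[of "{- L..0}" "{..0}" A A] A0 by auto
    also have "infsum B {0<..} = (\<Sum>x\<in>{0<..L}. B x)"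
      using infsum_cong_neutral[of "{0<..L}" "{0<..}" B B] B0 by auto
    also have "(\<Sum>x\<in>{- L..0}. A x) - (\<Sum>x\<in>{0<..L}. B x) = (\<Sum>x\<in>{- L..0}. A x) + (\<Sum>x\<in>{0<..L}. - B x)"
      by (simp add: sum_negf)
    also have "\<dots> = (\<Sum>x\<in>{- L..L}. \<Sum>k=1..\<eta> x \<omega>. of_bool (x \<le> 0) - of_bool (X x k ?m \<omega> \<le> ?b))"
    proof -
      have "{- L..L} = {- L..0} \<union> {0<..L}" using L0 by auto
      then have "sum G {- L..L} = sum G {- L..0} + sum G {0<..L}" for G :: "int \<Rightarrow> real"
        by (simp only:) (rule sum.union_disjoint, auto)
      moreover have "(\<Sum>x\<in>{- L..0}. \<Sum>k=1..\<eta> x \<omega>. of_bool (x \<le> 0) - of_bool (X x k ?m \<omega> \<le> ?b)) = (\<Sum>x\<in>{- L..0}. A x)"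
        unfolding A_def by (intro sum.cong) auto
      moreover have "(\<Sum>x\<in>{0<..L}. \<Sum>k=1..\<eta> x \<omega>. of_bool (x \<le> 0) - of_bool (X x k ?m \<omega> \<le> ?b)) = (\<Sum>x\<in>{0<..L}. - B x)"
        unfolding B_def sum_negf[symmetric] by (intro sum.cong) auto
      ultimately show ?thesis by (simp only:)
    qed
    also have "\<dots> = total {- L..L} (path_score {(t, r)} (\<lambda>_. 1) n) (\<lambda>x. \<eta> x \<omega>) (paths \<omega>)"
      unfolding total_paths path_score_def by simp
    finally show ?case .
  qed
qed

lemma total_path_score_linear:
  "(\<Sum>j\<in>J. a j * total F (path_score {j} (\<lambda>_. 1) n) h \<xi>) = total F (path_score J a n) h \<xi>"
proof -
  have "(\<Sum>j\<in>J. a j * total F (path_score {j} (\<lambda>_. 1) n) h \<xi>) =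
      (\<Sum>j\<in>J. \<Sum>x\<in>F. \<Sum>k=1..h x. a j * (of_bool (x \<le> 0) - of_bool (\<xi> (x, k) (ptime (fst j) n) \<le> plevel v j n)))"
    by (simp add: total_def path_score_def sum_distrib_left)
  also have "\<dots> = (\<Sum>x\<in>F. \<Sum>j\<in>J. \<Sum>k=1..h x. a j * (of_bool (x \<le> 0) - of_bool (\<xi> (x, k) (ptime (fst j) n) \<le> plevel v j n)))"
    by (rule sum.swap)
  also have "\<dots> = total F (path_score J a n) h \<xi>"
    unfolding total_def path_score_def by (rule sum.cong[OF refl], rule sum.swap)
  finally show ?thesis .
qed

lemma score_linear: "(\<Sum>j\<in>J. a j * score {j} (\<lambda>_. 1) n x \<xi>) = score J a n x \<xi>"
  by (simp add: score_def)

theorem scaled_current_char: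
  assumes J: "finite J" and K: "K > 0" "\<And>j. j \<in> J \<Longrightarrow> ptime (fst j) n \<le> K"
  defines "\<theta> \<equiv> real n powr (- 1 / 4)" and "L \<equiv> width J n"
  shows "(LINT \<omega>|M. iexp (\<Sum>j\<in>J. a j * scaled_current M \<eta> X v n j \<omega>)) =
    (\<Prod>x\<in>{- L..L}. pgf (measure_pmf.expectation (steps p K) (\<lambda>\<xi>. iexp (\<theta> * score J a n x \<xi>)))) *
      iexp (- (\<theta> * m0 * (\<Sum>x\<in>{- L..L}. measure_pmf.expectation (steps p K) (score J a n x))))"
proof -
  let ?E = "measure_pmf.expectation (steps p K)"
  let ?N = "\<lambda>J a \<omega>. total {- L..L} (path_score J a n) (\<lambda>x. \<eta> x \<omega>) (paths \<omega>)"
  have cur: "AE \<omega> in M. current \<eta> X v n j \<omega> = ?N {j} (\<lambda>_. 1) \<omega>" if "j \<in> J" for j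
    using current_AE[of "fst j" "snd j" n L] le_width[OF J that, of n] by (simp add: L_def)
  have Nm[measurable]: "?N J' a' \<in> borel_measurable M" for J' a'
    by (rule total_random_measurable) (rule path_score_measurable)
  have mean: "(LINT \<omega>|M. current \<eta> X v n j \<omega>) = m0 * (\<Sum>x\<in>{- L..L}. ?E (score {j} (\<lambda>_. 1) n x))" if j: "j \<in> J" for j
  proof -
    have "(LINT \<omega>|M. current \<eta> X v n j \<omega>) = (LINT \<omega>|M. ?N {j} (\<lambda>_. 1) \<omega>)"
      by (rule integral_cong_AE[OF current_measurable Nm cur[OF j]])
    also have "\<dots> = m0 * (\<Sum>x\<in>{- L..L}. ?E (score {j} (\<lambda>_. 1) n x))"
    proof (rule total_mean(2)[where A="\<Sum>j\<in>{j}. \<bar>1\<bar>"])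
      show "\<bar>path_score {j} (\<lambda>_. 1) n x w\<bar> \<le> (\<Sum>j\<in>{j}. \<bar>1\<bar>)" for x w by (rule path_score_bound)
      show "(LINT \<omega>|M. path_score {j} (\<lambda>_. 1) n x (\<lambda>m. X x k m \<omega>)) = ?E (score {j} (\<lambda>_. 1) n x)" if "k \<ge> 1" for x k
        using expectation_path_score[OF that K(1), of "{j}" n "\<lambda>y. y"] K(2) j by simp
    qed (simp_all add: path_score_measurable)
    finally show ?thesis .
  qed
  define \<mu> where "\<mu> = m0 * (\<Sum>x\<in>{- L..L}. ?E (score J a n x))"
  have \<mu>: "(\<Sum>j\<in>J. a j * (LINT \<omega>|M. current \<eta> X v n j \<omega>)) = \<mu>"
  proof -
    have "(\<Sum>j\<in>J. a j * (LINT \<omega>|M. current \<eta> X v n j \<omega>)) = (\<Sum>j\<in>J. m0 * (\<Sum>x\<in>{- L..L}. a j * ?E (score {j} (\<lambda>_. 1) n x)))"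
      by (intro sum.cong refl) (simp add: mean sum_distrib_left mult.left_commute)
    also have "\<dots> = m0 * (\<Sum>x\<in>{- L..L}. \<Sum>j\<in>J. a j * ?E (score {j} (\<lambda>_. 1) n x))"
      unfolding sum_distrib_left by (rule sum.swap)
    also have "(\<Sum>x\<in>{- L..L}. \<Sum>j\<in>J. a j * ?E (score {j} (\<lambda>_. 1) n x)) = (\<Sum>x\<in>{- L..L}. ?E (score J a n x))"
      unfolding score_linear[of a n _ _ J, symmetric] by (intro sum.cong refl) (simp add: Bochner_Integration.integral_sum)
    finally show ?thesis by (simp add: \<mu>_def)
  qed
  have "AE \<omega> in M. \<forall>j\<in>J. current \<eta> X v n j \<omega> = ?N {j} (\<lambda>_. 1) \<omega>"
    using cur J by (simp add: AE_finite_all)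
  then have ae: "AE \<omega> in M. iexp (\<Sum>j\<in>J. a j * scaled_current M \<eta> X v n j \<omega>) = iexp (- (\<theta> * \<mu>)) * iexp (\<theta> * ?N J a \<omega>)"
  proof eventually_elim
    case (elim \<omega>)
    have "(\<Sum>j\<in>J. a j * scaled_current M \<eta> X v n j \<omega>) = \<theta> * ((\<Sum>j\<in>J. a j * current \<eta> X v n j \<omega>) - (\<Sum>j\<in>J. a j * (LINT \<omega>|M. current \<eta> X v n j \<omega>)))"
      unfolding scaled_current_def \<theta>_def sum_subtractf[symmetric] sum_distrib_left by (intro sum.cong refl) (simp add: algebra_simps)
    also have "(\<Sum>j\<in>J. a j * current \<eta> X v n j \<omega>) = (\<Sum>j\<in>J. a j * ?N {j} (\<lambda>_. 1) \<omega>)"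
      by (intro sum.cong refl) (use elim in auto)
    also have "\<dots> = ?N J a \<omega>" by (rule total_path_score_linear)
    finally have E: "(\<Sum>j\<in>J. a j * scaled_current M \<eta> X v n j \<omega>) = - (\<theta> * \<mu>) + \<theta> * ?N J a \<omega>" by (simp add: \<mu> algebra_simps)
    show ?case unfolding E by (rule iexp_of_real_add)
  qed
  have "(LINT \<omega>|M. iexp (\<Sum>j\<in>J. a j * scaled_current M \<eta> X v n j \<omega>)) = (LINT \<omega>|M. iexp (- (\<theta> * \<mu>)) * iexp (\<theta> * ?N J a \<omega>))"
  proof (rule integral_cong_AE[OF _ _ ae])
    note [measurable] = current_measurable
    show "(\<lambda>\<omega>. iexp (\<Sum>j\<in>J. a j * scaled_current M \<eta> X v n j \<omega>)) \<in> borel_measurable M"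
      unfolding scaled_current_def by measurable
  qed measurable
  also have "\<dots> = iexp (- (\<theta> * \<mu>)) * (LINT \<omega>|M. iexp (\<theta> * ?N J a \<omega>))" by simp
  also have "(LINT \<omega>|M. iexp (\<theta> * ?N J a \<omega>)) = (\<Prod>x\<in>{- L..L}. pgf (?E (\<lambda>\<xi>. iexp (\<theta> * score J a n x \<xi>))))"
  proof (rule total_char)
    show "(LINT \<omega>|M. iexp (\<theta> * path_score J a n x (\<lambda>m. X x k m \<omega>))) = ?E (\<lambda>\<xi>. iexp (\<theta> * score J a n x \<xi>))" if "k \<ge> 1" for x k
      by (rule expectation_path_score[OF that K, where f="\<lambda>y. iexp (\<theta> * y)"]) simp_all
  qed (simp_all add: path_score_measurable)
  finally show ?thesis by (simp add: \<mu>_def mult.assoc mult.commute)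
qed

theorem scaled_current_char_limit:
  assumes J: "finite J" "J \<subseteq> {0..} \<times> UNIV"
  shows "(\<lambda>n. LINT \<omega>|M. iexp (\<Sum>j\<in>J. a j * scaled_current M \<eta> X v n j \<omega>))
    \<longlonglongrightarrow> of_real (exp (- (\<Sum>i\<in>J. \<Sum>j\<in>J. a i * a j * cov i j) / 2))"
proof -
  \<comment> \<open>At least one step is drawn, since the law of the steps is identified over a nonempty index set.\<close>
  define K where "K n = Suc (\<Sum>j\<in>J. ptime (fst j) n)" for n
  have K: "K n > 0" "\<And>j. j \<in> J \<Longrightarrow> ptime (fst j) n \<le> K n" for n
    using member_le_sum[of _ J "\<lambda>j. ptime (fst j) n"] J(1) by (auto simp: K_def intro: le_SucI)
  have e: "(LINT \<omega>|M. iexp (\<Sum>j\<in>J. a j * scaled_current M \<eta> X v n j \<omega>)) =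
    (\<Prod>x\<in>{- width J n..width J n}. pgf (measure_pmf.expectation (steps p (K n)) (\<lambda>\<xi>. iexp (real n powr (- 1 / 4) * score J a n x \<xi>)))) *
      iexp (- (real n powr (- 1 / 4) * m0 * (\<Sum>x\<in>{- width J n..width J n}. measure_pmf.expectation (steps p (K n)) (score J a n x))))" for n
    by (rule scaled_current_char[OF J(1)]) (rule K, erule K)
  show ?thesis
    unfolding e
  proof (rule site_product_limit)
    show "\<bar>excess j n \<xi>\<bar> \<le> width J n" if "j \<in> J" "\<xi> \<in> set_pmf (steps p (K n))" for n j \<xi>
      by (rule excess_le_width[OF J(1) that])
  qed (use J K in auto)
qed

text \<open>A limit of characteristic functions has modulus at most 1, so that its exponent cannot be positive.\<close>

lemma cov_psd:
  assumes J: "finite J" "J \<subseteq> {0..} \<times> UNIV"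
  shows "0 \<le> (\<Sum>i\<in>J. \<Sum>j\<in>J. a i * a j * cov i j)"
proof -
  let ?V = "\<Sum>i\<in>J. \<Sum>j\<in>J. a i * a j * cov i j"
  have "norm (complex_of_real (exp (- ?V / 2))) \<le> 1"
  proof (rule LIMSEQ_le_const2[OF tendsto_norm[OF scaled_current_char_limit[OF J, of a]]])
    have "norm (LINT \<omega>|M. iexp (\<Sum>j\<in>J. a j * scaled_current M \<eta> X v n j \<omega>)) \<le> 1" for n
    proof -
      have "norm (LINT \<omega>|M. iexp (\<Sum>j\<in>J. a j * scaled_current M \<eta> X v n j \<omega>)) \<le>
          (LINT \<omega>|M. norm (iexp (\<Sum>j\<in>J. a j * scaled_current M \<eta> X v n j \<omega>)))" by (rule integral_norm_bound)
      then show ?thesis by (simp only: norm_exp_i_times) (simp add: prob_space)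
    qed
    then show "\<exists>N. \<forall>n\<ge>N. norm (LINT \<omega>|M. iexp (\<Sum>j\<in>J. a j * scaled_current M \<eta> X v n j \<omega>)) \<le> 1" by blast
  qed
  then show ?thesis by simp
qed

text \<open>The sums that converge to \<open>Gamma1 s2 i j + Gamma2 s2 i j\<close> and to \<open>Gamma2 s2 i j\<close> are symmetric in \<open>i\<close> and \<open>j\<close>.\<close>

lemma cov_sym:
  assumes i: "fst i \<ge> 0" and j: "fst j \<ge> 0"
  shows "cov i j = cov j i"
proof -
  define K where "K n = ptime (fst i) n + ptime (fst j) n" for n
  define L where "L n = width {i, j} n" for n
  have K: "ptime (fst i) n \<le> K n" "ptime (fst j) n \<le> K n" for n by (auto simp: K_def)
  have L: "\<bar>excess i n \<xi>\<bar> \<le> L n" "\<bar>excess j n \<xi>\<bar> \<le> L n" if "\<xi> \<in> set_pmf (steps p (K n))" for n \<xi>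
    unfolding L_def by (rule excess_le_width[OF _ _ that]; simp)+
  let ?E = "\<lambda>n. measure_pmf.expectation (steps p (K n))"
  define P where "P i j n = (\<Sum>x\<in>{- L n..L n}. ?E n (\<lambda>\<xi>. crossing (excess i n \<xi>) x * crossing (excess j n \<xi>) x)) / sqrt (real n)" for i j n
  define R where "R i j n = (\<Sum>x\<in>{- L n..L n}. ?E n (\<lambda>\<xi>. crossing (excess i n \<xi>) x) * ?E n (\<lambda>\<xi>. crossing (excess j n \<xi>) x)) / sqrt (real n)" for i j n
  have comm: "P i j = P j i" "R i j = R j i"
    unfolding P_def R_def by (subst mult.commute, rule refl)+
  have ij: "P i j \<longlonglongrightarrow> Gamma1 s2 i j + Gamma2 s2 i j" "R i j \<longlonglongrightarrow> Gamma2 s2 i j"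
    unfolding P_def[abs_def] R_def[abs_def] by (rule crossing_limits; use i j K L in blast)+
  have ji: "P j i \<longlonglongrightarrow> Gamma1 s2 j i + Gamma2 s2 j i" "R j i \<longlonglongrightarrow> Gamma2 s2 j i"
    unfolding P_def[abs_def] R_def[abs_def] by (rule crossing_limits; use i j K L in blast)+
  have g2: "Gamma2 s2 i j = Gamma2 s2 j i"
    by (rule LIMSEQ_unique[OF ij(2)]) (subst comm(2), rule ji(2))
  have "Gamma1 s2 i j + Gamma2 s2 i j = Gamma1 s2 j i + Gamma2 s2 j i"
    by (rule LIMSEQ_unique[OF ij(1)]) (subst comm(1), rule ji(1))
  then show ?thesis using g2 by (simp add: cov_def)
qed

end

context particle_system
begin

lemma scaled_current_measurable: "scaled_current M \<eta> X v n i \<in> borel_measurable M"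
  unfolding scaled_current_def[abs_def] using current_measurable[of n i] by measurable

theorem scaled_current_fdd_limit:
  obtains N :: "(real \<times> real \<Rightarrow> real) measure" where
    "gaussian_process N ({0..} \<times> UNIV) (\<lambda>i \<omega>. \<omega> i)"
    "\<And>i. i \<in> {0..} \<times> UNIV \<Longrightarrow> (LINT \<omega>|N. \<omega> i) = 0"
    "\<And>i j. i \<in> {0..} \<times> UNIV \<Longrightarrow> j \<in> {0..} \<times> UNIV \<Longrightarrow> (LINT \<omega>|N. \<omega> i * \<omega> j) = cov i j"
    "fdd_converges ({0..} \<times> UNIV) M (scaled_current M \<eta> X v) N (\<lambda>i \<omega>. \<omega> i)"
proof (rule gaussian_process_exists[where T="{0..} \<times> UNIV" and C=cov])
  show "cov i j = cov j i" if "i \<in> {0..} \<times> UNIV" "j \<in> {0..} \<times> UNIV" for i j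
    by (rule cov_sym) (use that in auto)
  show "0 \<le> (\<Sum>i\<in>J. \<Sum>j\<in>J. a i * a j * cov i j)" if "finite J" "J \<subseteq> {0..} \<times> UNIV" for J a
    by (rule cov_psd[OF that])
  fix N :: "(real \<times> real \<Rightarrow> real) measure"
  assume N: "gaussian_process N ({0..} \<times> UNIV) (\<lambda>i \<omega>. \<omega> i)"
    "\<And>i. i \<in> {0..} \<times> UNIV \<Longrightarrow> (LINT \<omega>|N. \<omega> i) = 0"
    "\<And>i j. i \<in> {0..} \<times> UNIV \<Longrightarrow> j \<in> {0..} \<times> UNIV \<Longrightarrow> (LINT \<omega>|N. \<omega> i * \<omega> j) = cov i j"
    and ch: "\<And>J a. finite J \<Longrightarrow> J \<subseteq> {0..} \<times> UNIV \<Longrightarrow>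
       (LINT \<omega>|N. iexp (\<Sum>i\<in>J. a i * \<omega> i)) = exp (- ((\<Sum>i\<in>J. \<Sum>j\<in>J. a i * a j * cov i j) / 2))"
  interpret N: prob_space N using N(1) by (simp add: gaussian_process_def)
  have Nm: "(\<lambda>\<omega>. \<omega> i) \<in> borel_measurable N" if "i \<in> {0..} \<times> UNIV" for i
    using N(1) that unfolding gaussian_process_def by blast
  have "fdd_converges ({0..} \<times> UNIV) M (scaled_current M \<eta> X v) N (\<lambda>i \<omega>. \<omega> i)"
    unfolding fdd_converges_def
  proof (intro allI impI, elim conjE)
    fix J :: "(real \<times> real) set" assume J: "finite J" "J \<subseteq> {0..} \<times> UNIV"
    have m1: "(\<lambda>\<omega>. \<lambda>i\<in>J. scaled_current M \<eta> X v n i \<omega>) \<in> measurable M (PiM J (\<lambda>_. borel))" for n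
      by (rule measurable_restrict) (rule scaled_current_measurable)
    have m2: "(\<lambda>\<omega>. \<lambda>i\<in>J. \<omega> i) \<in> measurable N (PiM J (\<lambda>_. borel))"
      by (rule measurable_restrict) (use Nm J in auto)
    have me: "(\<lambda>x. iexp (\<Sum>i\<in>J. a i * x i)) \<in> borel_measurable (PiM J (\<lambda>_. borel))" for a :: "real \<times> real \<Rightarrow> real"
      by measurable
    show "weakly_converges (product_topology (\<lambda>_. euclideanreal) J)
          (\<lambda>n. fdd M J (scaled_current M \<eta> X v n)) (fdd N J (\<lambda>i \<omega>. \<omega> i))"
    proof (rule cramer_wold_weak_convergence[OF J(1)])
      show "prob_space (fdd M J (scaled_current M \<eta> X v n))" for n
        unfolding fdd_def by (rule prob_space_distr[OF m1])
      show "prob_space (fdd N J (\<lambda>i \<omega>. \<omega> i))"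
        unfolding fdd_def by (rule N.prob_space_distr[OF m2])
      fix a :: "real \<times> real \<Rightarrow> real"
      have e1: "(LINT x|fdd M J (scaled_current M \<eta> X v n). iexp (\<Sum>i\<in>J. a i * x i)) =
          (LINT \<omega>|M. iexp (\<Sum>j\<in>J. a j * scaled_current M \<eta> X v n j \<omega>))" for n
        unfolding fdd_def by (subst integral_distr[OF m1 me]) (simp cong: sum.cong)
      have e2: "(LINT x|fdd N J (\<lambda>i \<omega>. \<omega> i). iexp (\<Sum>i\<in>J. a i * x i)) =
          of_real (exp (- (\<Sum>i\<in>J. \<Sum>j\<in>J. a i * a j * cov i j) / 2))"
      proof -
        have "(LINT x|fdd N J (\<lambda>i \<omega>. \<omega> i). iexp (\<Sum>i\<in>J. a i * x i)) = (LINT \<omega>|N. iexp (\<Sum>i\<in>J. a i * \<omega> i))"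
          unfolding fdd_def by (subst integral_distr[OF m2 me]) (simp cong: sum.cong)
        then show ?thesis unfolding ch[OF J] by simp
      qed
      show "(\<lambda>n. LINT x|fdd M J (scaled_current M \<eta> X v n). iexp (\<Sum>i\<in>J. a i * x i))
          \<longlonglongrightarrow> (LINT x|fdd N J (\<lambda>i \<omega>. \<omega> i). iexp (\<Sum>i\<in>J. a i * x i))"
        unfolding e1 e2 by (rule scaled_current_char_limit[OF J])
    qed (simp_all add: fdd_def)
  qed
  with N show thesis by (rule that)
qed

end

theorem theorem2p2:
  fixes M :: "'a measure"
    and p :: "int pmf"
    and v \<sigma>1_sq \<mu>0 \<sigma>0_sq :: real
    and \<eta> :: "int \<Rightarrow> 'a \<Rightarrow> nat"
    and X :: "int \<Rightarrow> nat \<Rightarrow> nat \<Rightarrow> 'a \<Rightarrow> int"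
  assumes "prob_space M"
    and "finite (set_pmf p)"
    and "v = (\<Sum>x\<in>set_pmf p. real_of_int x * pmf p x)"
    and "\<sigma>1_sq = (\<Sum>x\<in>set_pmf p. (real_of_int x - v)\<^sup>2 * pmf p x)"
    and "\<And>x k. k \<ge> 1 \<Longrightarrow> random_walk M p x (X x k)"
    and "prob_space.indep_vars M (\<lambda>_. path_space) (\<lambda>(x, k) \<omega> m. X x k m \<omega>) (UNIV \<times> {1..})"
    and "iid_vars M (count_space UNIV) \<eta> UNIV"
    and "\<And>x. integrable M (\<lambda>\<omega>. real (\<eta> x \<omega>))"
    and "\<And>x. integrable M (\<lambda>\<omega>. (real (\<eta> x \<omega>))\<^sup>2)"
    and "\<And>x. \<mu>0 = (LINT \<omega>|M. real (\<eta> x \<omega>))"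
    and "\<And>x. \<sigma>0_sq = (LINT \<omega>|M. (real (\<eta> x \<omega>) - \<mu>0)\<^sup>2)"
    and "indep_elements M
           (PiM UNIV (\<lambda>_. count_space UNIV)) (\<lambda>\<omega> x. \<eta> x \<omega>)
           (PiM (UNIV \<times> {1..}) (\<lambda>_. path_space)) (\<lambda>\<omega>. \<lambda>(x, k)\<in>UNIV \<times> {1..}. \<lambda>m. X x k m \<omega>)"
  shows "\<exists>(N :: (real \<times> real \<Rightarrow> real) measure) (Z :: real \<times> real \<Rightarrow> (real \<times> real \<Rightarrow> real) \<Rightarrow> real).
           gaussian_process N ({0..} \<times> UNIV) Z \<and>
           (\<forall>i\<in>{0..} \<times> UNIV. (LINT \<omega>|N. Z i \<omega>) = 0) \<and>
           (\<forall>i\<in>{0..} \<times> UNIV. \<forall>j\<in>{0..} \<times> UNIV.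
              (LINT \<omega>|N. Z i \<omega> * Z j \<omega>) = \<mu>0 * Gamma1 \<sigma>1_sq i j + \<sigma>0_sq * Gamma2 \<sigma>1_sq i j) \<and>
           fdd_converges ({0..} \<times> UNIV) M (scaled_current M \<eta> X v) N Z"
proof -
  interpret M: prob_space M by fact
  have p: "measure_pmf.expectation p f = (\<Sum>x\<in>set_pmf p. f x * pmf p x)" for f :: "int \<Rightarrow> real"
    by (rule integral_measure_pmf_real[OF assms(2)]) simp
  interpret particle_system M \<eta> p v \<sigma>1_sq X
  proof unfold_locales
    show "\<eta> 0 \<in> M \<rightarrow>\<^sub>M count_space UNIV"
      using assms(7) by (auto simp: iid_vars_def M.indep_vars_def)
    show "measure_pmf.expectation p (\<lambda>x. real_of_int x - v) = 0"
      unfolding p left_diff_distrib sum_subtractf sum_distrib_left[symmetric] assms(3)[symmetric]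
      using assms(2) by (simp add: sum_pmf_eq_1)
    show "measure_pmf.expectation p (\<lambda>x. (real_of_int x - v)\<^sup>2) = \<sigma>1_sq"
      unfolding p assms(4) ..
  qed (fact assms)+
  have m0: "m0 = \<mu>0" and v0: "v0 = \<sigma>0_sq"
    using assms(10)[of 0] assms(11)[of 0] by (simp_all add: m0_def v0_def)
  show ?thesis
  proof (rule scaled_current_fdd_limit)
    fix N :: "(real \<times> real \<Rightarrow> real) measure"
    assume N: "gaussian_process N ({0..} \<times> UNIV) (\<lambda>i \<omega>. \<omega> i)"
      "\<And>i. i \<in> {0..} \<times> UNIV \<Longrightarrow> (LINT \<omega>|N. \<omega> i) = 0"
      "\<And>i j. i \<in> {0..} \<times> UNIV \<Longrightarrow> j \<in> {0..} \<times> UNIV \<Longrightarrow> (LINT \<omega>|N. \<omega> i * \<omega> j) = cov i j"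
      "fdd_converges ({0..} \<times> UNIV) M (scaled_current M \<eta> X v) N (\<lambda>i \<omega>. \<omega> i)"
    show ?thesis
    proof (intro exI conjI ballI)
      show "gaussian_process N ({0..} \<times> UNIV) (\<lambda>i \<omega>. \<omega> i)" by (rule N(1))
      show "(LINT \<omega>|N. \<omega> i) = 0" if "i \<in> {0..} \<times> UNIV" for i by (rule N(2)[OF that])
      show "(LINT \<omega>|N. \<omega> i * \<omega> j) = \<mu>0 * Gamma1 \<sigma>1_sq i j + \<sigma>0_sq * Gamma2 \<sigma>1_sq i j"
        if "i \<in> {0..} \<times> UNIV" "j \<in> {0..} \<times> UNIV" for i j
        using N(3)[OF that] by (simp add: cov_def m0 v0)
      show "fdd_converges ({0..} \<times> UNIV) M (scaled_current M \<eta> X v) N (\<lambda>i \<omega>. \<omega> i)" by (rule N(4))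
    qed
  qed
qed

end
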